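(* Let $\mathcal{C}$ be a non-zero $A$-coring with ${}_A\mathcal{C}$ flat, let $M$ be a non-zero right $\mathcal{C}$-comodule and let $\mathrm{E}_M^{\mathcal{C}}=\mathrm{End}^{\mathcal{C}}(M)^{op}$. (1) If $M=Mf\mathrm{E}_M^{\mathcal{C}}$ for every $0\neq f\in \mathrm{E}_M^{\mathcal{C}}$, then $M$ is $\mathrm{E}$-prime; if $M=Mf$ for every $0\neq f\in \mathrm{E}_M^{\mathcal{C}}$, then $M$ is completely $\mathrm{E}$-prime. If $M$ is coretractable, then $M$ is $\mathrm{E}$-prime if and only if $M=Mf\mathrm{E}_M^{\mathcal{C}}$ for every $0\neq f\in \mathrm{E}_M^{\mathcal{C}}$, and $M$ is completely $\mathrm{E}$-prime if and only if $M=Mf$ for every $0\neq f\in \mathrm{E}_M^{\mathcal{C}}$. (2) If $Mf=Mf\mathrm{E}_M^{\mathcal{C}}f$ for every $0\neq f\in \mathrm{E}_M^{\mathcal{C}}$, then $M$ is $\mathrm{E}$-semiprime; if $Mf=Mf^{2}$ for every $0\neq f\in \mathrm{E}_M^{\mathcal{C}}$, then $M$ is completely $\mathrm{E}$-semiprime. If $M$ is self-cogenerator, then $M$ is $\mathrm{E}$-semiprime if and only if $Mf=Mf\mathrm{E}_M^{\mathcal{C}}f$ for every $0\neq f\in \mathrm{E}_M^{\mathcal{C}}$, and $M$ is completely $\mathrm{E}$-semiprime if and only if $Mf=Mf^{2}$ for every $0\neq f\in \mathrm{E}_M^{\mathcal{C}}$.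
   Context: $R$ is a commutative ring with $1\neq 0$, $A$ is a unital $R$-algebra, $(\mathcal{C},\Delta,\varepsilon)$ is an $A$-coring (a coalgebra in the monoidal category of $(A,A)$-bimodules), and $\mathbb{M}^{\mathcal{C}}$ is the category of right $\mathcal{C}$-comodules with $\mathcal{C}$-colinear maps. Since ${}_A\mathcal{C}$ is flat, $\mathbb{M}^{\mathcal{C}}$ is a Grothendieck category with kernels formed in right $A$-modules. All rings are unital. The ring $\mathrm{E}_M^{\mathcal{C}}=\mathrm{End}^{\mathcal{C}}(M)^{op}$ has multiplication $(fg)(m)=g(f(m))$, so $M$ is a right $\mathrm{E}_M^{\mathcal{C}}$-module via $mf:=f(m)$. Thus $Mf=f(M)$, $Mf\mathrm{E}_M^{\mathcal{C}}=\sum_{g}g(f(M))$, $Mf\mathrm{E}_M^{\mathcal{C}}f=\sum_g f(g(f(M)))$ and $Mf^2=f(f(M))$, with $g$ running over $\mathrm{End}^{\mathcal{C}}(M)$. $M$ is $\mathrm{E}$-prime (resp. $\mathrm{E}$-semiprime, completely $\mathrm{E}$-prime, completely $\mathrm{E}$-semiprime) if the ring $\mathrm{E}_M^{\mathcal{C}}$ is prime (resp. semiprime, a not necessarily commutative domain, reduced). $M$ is coretractable if $\mathrm{Hom}^{\mathcal{C}}(M/K,M)\neq 0$ for every proper $\mathcal{C}$-subcomodule $K\subsetneq M$. $M$ is self-cogenerator if $M$ cogenerates all its factor comodules, i.e. for every $\mathcal{C}$-subcomodule $K\subseteq M$ the intersection of the kernels of all $h\in\mathrm{Hom}^{\mathcal{C}}(M/K,M)$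 is $0$. *)

theory Defs
  imports "HOL-Algebra.Algebra" "HOL-Algebra.Free_Abelian_Groups"
begin

section \<open>Algebras, right modules and bimodules over a non-commutative ring\<close>

text \<open>The locale \<open>algebra\<close> of the library is restricted to commutative algebras; here
  \<open>A\<close> is any unital ring with a compatible module structure over the commutative ring \<open>R\<close>.\<close>

locale unital_algebra = module R A + ring A
  for R :: "('r, 's) ring_scheme" (structure) and A :: "('r, 'a, 'k) module_scheme" (structure) +
  assumes smult_mult_left:
      "\<lbrakk>r \<in> carrier R; x \<in> carrier A; y \<in> carrier A\<rbrakk> \<Longrightarrow> (r \<odot>\<^bsub>A\<^esub> x) \<otimes>\<^bsub>A\<^esub> y = r \<odot>\<^bsub>A\<^esub> (x \<otimes>\<^bsub>A\<^esub> y)"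
    and smult_mult_right:
      "\<lbrakk>r \<in> carrier R; x \<in> carrier A; y \<in> carrier A\<rbrakk> \<Longrightarrow> x \<otimes>\<^bsub>A\<^esub> (r \<odot>\<^bsub>A\<^esub> y) = r \<odot>\<^bsub>A\<^esub> (x \<otimes>\<^bsub>A\<^esub> y)"

text \<open>As in the library record \<open>module\<close>, the fields \<open>mult\<close> and \<open>one\<close> inherited from
  \<open>ring\<close> carry no information.\<close>

record ('a, 'm) rmodule = "'m ring" +
  rsmult :: "['m, 'a] \<Rightarrow> 'm" (infixl \<open>\<triangleleft>\<index>\<close> 70)

record ('a, 'm) bimodule = "('a, 'm) rmodule" +
  lsmult :: "['a, 'm] \<Rightarrow> 'm" (infixr \<open>\<triangleright>\<index>\<close> 71)

locale right_module = A?: ring A + M?: abelian_group M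
  for A :: "('a, 'k) ring_scheme" (structure) and M :: "('a, 'm, 'x) rmodule_scheme" (structure) +
  assumes rsmult_closed:
      "\<lbrakk>x \<in> carrier M; a \<in> carrier A\<rbrakk> \<Longrightarrow> x \<triangleleft>\<^bsub>M\<^esub> a \<in> carrier M"
    and rsmult_l_distr:
      "\<lbrakk>x \<in> carrier M; y \<in> carrier M; a \<in> carrier A\<rbrakk>
        \<Longrightarrow> (x \<oplus>\<^bsub>M\<^esub> y) \<triangleleft>\<^bsub>M\<^esub> a = x \<triangleleft>\<^bsub>M\<^esub> a \<oplus>\<^bsub>M\<^esub> y \<triangleleft>\<^bsub>M\<^esub> a"
    and rsmult_r_distr:
      "\<lbrakk>x \<in> carrier M; a \<in> carrier A; b \<in> carrier A\<rbrakk>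
        \<Longrightarrow> x \<triangleleft>\<^bsub>M\<^esub> (a \<oplus>\<^bsub>A\<^esub> b) = x \<triangleleft>\<^bsub>M\<^esub> a \<oplus>\<^bsub>M\<^esub> x \<triangleleft>\<^bsub>M\<^esub> b"
    and rsmult_assoc:
      "\<lbrakk>x \<in> carrier M; a \<in> carrier A; b \<in> carrier A\<rbrakk>
        \<Longrightarrow> x \<triangleleft>\<^bsub>M\<^esub> (a \<otimes>\<^bsub>A\<^esub> b) = (x \<triangleleft>\<^bsub>M\<^esub> a) \<triangleleft>\<^bsub>M\<^esub> b"
    and rsmult_one:
      "x \<in> carrier M \<Longrightarrow> x \<triangleleft>\<^bsub>M\<^esub> \<one>\<^bsub>A\<^esub> = x"

locale bimodule = right_module A M
  for A :: "('a, 'k) ring_scheme" (structure) and M :: "('a, 'm, 'x) bimodule_scheme" (structure) +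
  assumes lsmult_closed:
      "\<lbrakk>a \<in> carrier A; x \<in> carrier M\<rbrakk> \<Longrightarrow> a \<triangleright>\<^bsub>M\<^esub> x \<in> carrier M"
    and lsmult_r_distr:
      "\<lbrakk>a \<in> carrier A; x \<in> carrier M; y \<in> carrier M\<rbrakk>
        \<Longrightarrow> a \<triangleright>\<^bsub>M\<^esub> (x \<oplus>\<^bsub>M\<^esub> y) = (a \<triangleright>\<^bsub>M\<^esub> x) \<oplus>\<^bsub>M\<^esub> (a \<triangleright>\<^bsub>M\<^esub> y)"
    and lsmult_l_distr:
      "\<lbrakk>a \<in> carrier A; b \<in> carrier A; x \<in> carrier M\<rbrakk>
        \<Longrightarrow> (a \<oplus>\<^bsub>A\<^esub> b) \<triangleright>\<^bsub>M\<^esub> x = (a \<triangleright>\<^bsub>M\<^esub> x) \<oplus>\<^bsub>M\<^esub> (b \<triangleright>\<^bsub>M\<^esub> x)"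
    and lsmult_assoc:
      "\<lbrakk>a \<in> carrier A; b \<in> carrier A; x \<in> carrier M\<rbrakk>
        \<Longrightarrow> (a \<otimes>\<^bsub>A\<^esub> b) \<triangleright>\<^bsub>M\<^esub> x = a \<triangleright>\<^bsub>M\<^esub> (b \<triangleright>\<^bsub>M\<^esub> x)"
    and lsmult_one:
      "x \<in> carrier M \<Longrightarrow> \<one>\<^bsub>A\<^esub> \<triangleright>\<^bsub>M\<^esub> x = x"
    and lsmult_rsmult:
      "\<lbrakk>a \<in> carrier A; x \<in> carrier M; b \<in> carrier A\<rbrakk>
        \<Longrightarrow> (a \<triangleright>\<^bsub>M\<^esub> x) \<triangleleft>\<^bsub>M\<^esub> b = a \<triangleright>\<^bsub>M\<^esub> (x \<triangleleft>\<^bsub>M\<^esub> b)"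

definition regular_bimodule :: "('a, 'k) ring_scheme \<Rightarrow> ('a, 'a) bimodule" where
  "regular_bimodule A =
    \<lparr>carrier = carrier A, monoid.mult = monoid.mult A, monoid.one = monoid.one A,
     ring.zero = ring.zero A, ring.add = ring.add A, rsmult = monoid.mult A, lsmult = monoid.mult A\<rparr>"

definition rmodule_hom ::
    "('a, 'k) ring_scheme \<Rightarrow> ('a, 'm, 'x) rmodule_scheme \<Rightarrow> ('a, 'n, 'y) rmodule_scheme \<Rightarrow> ('m \<Rightarrow> 'n) set"
  where "rmodule_hom A M N =
    {f \<in> hom (add_monoid M) (add_monoid N).
      \<forall>x\<in>carrier M. \<forall>a\<in>carrier A. f (x \<triangleleft>\<^bsub>M\<^esub> a) = f x \<triangleleft>\<^bsub>N\<^esub> a}"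

definition bimodule_hom ::
    "('a, 'k) ring_scheme \<Rightarrow> ('a, 'm, 'x) bimodule_scheme \<Rightarrow> ('a, 'n, 'y) bimodule_scheme \<Rightarrow> ('m \<Rightarrow> 'n) set"
  where "bimodule_hom A M N =
    {f \<in> rmodule_hom A M N.
      \<forall>a\<in>carrier A. \<forall>x\<in>carrier M. f (a \<triangleright>\<^bsub>M\<^esub> x) = a \<triangleright>\<^bsub>N\<^esub> f x}"


section \<open>Tensor products over \<open>A\<close>\<close>

type_synonym ('m, 'n) tensor = "('m \<times> 'n \<Rightarrow>\<^sub>0 int) set"

text \<open>\<open>M \<otimes>\<^sub>A N\<close> is the free abelian group on pairs modulo biadditivity and
  \<open>A\<close>-balancedness; its elements are cosets.\<close>

definition tensor_rel ::
    "('a, 'k) ring_scheme \<Rightarrow> ('a, 'm, 'x) rmodule_scheme \<Rightarrow> ('a, 'n, 'y) bimodule_scheme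
      \<Rightarrow> ('m, 'n) tensor"
  where "tensor_rel A M N = generate (free_Abelian_group (carrier M \<times> carrier N))
    ({frag_of (x \<oplus>\<^bsub>M\<^esub> x', y) - frag_of (x, y) - frag_of (x', y) | x x' y.
        x \<in> carrier M \<and> x' \<in> carrier M \<and> y \<in> carrier N} \<union>
     {frag_of (x, y \<oplus>\<^bsub>N\<^esub> y') - frag_of (x, y) - frag_of (x, y') | x y y'.
        x \<in> carrier M \<and> y \<in> carrier N \<and> y' \<in> carrier N} \<union>
     {frag_of (x \<triangleleft>\<^bsub>M\<^esub> a, y) - frag_of (x, a \<triangleright>\<^bsub>N\<^esub> y) | x a y.
        x \<in> carrier M \<and> a \<in> carrier A \<and> y \<in> carrier N})"

definition tensor_group ::
    "('a, 'k) ring_scheme \<Rightarrow> ('a, 'm, 'x) rmodule_scheme \<Rightarrow> ('a, 'n, 'y) bimodule_scheme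
      \<Rightarrow> ('m, 'n) tensor monoid"
  where "tensor_group A M N =
    free_Abelian_group (carrier M \<times> carrier N) Mod tensor_rel A M N"

definition pure_tensor ::
    "('a, 'k) ring_scheme \<Rightarrow> ('a, 'm, 'x) rmodule_scheme \<Rightarrow> ('a, 'n, 'y) bimodule_scheme
      \<Rightarrow> 'm \<Rightarrow> 'n \<Rightarrow> ('m, 'n) tensor"
  where "pure_tensor A M N x y =
    tensor_rel A M N #>\<^bsub>free_Abelian_group (carrier M \<times> carrier N)\<^esub> frag_of (x, y)"

text \<open>The homomorphism induced by a balanced map \<open>\<phi>\<close> through the universal property. It is
  well defined on the carrier if \<open>G\<close> is an abelian group and \<open>\<phi>\<close> is balanced.\<close>

definition tensor_lift ::
    "('a, 'k) ring_scheme \<Rightarrow> ('a, 'm, 'x) rmodule_scheme \<Rightarrow> ('a, 'n, 'y) bimodule_scheme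
      \<Rightarrow> ('g, 'z) monoid_scheme \<Rightarrow> ('m \<Rightarrow> 'n \<Rightarrow> 'g) \<Rightarrow> ('m, 'n) tensor \<Rightarrow> 'g"
  where "tensor_lift A M N G \<phi> =
    (SOME h. h \<in> hom (tensor_group A M N) G \<and>
      (\<forall>x\<in>carrier M. \<forall>y\<in>carrier N. h (pure_tensor A M N x y) = \<phi> x y))"

lemma tensor_lift_universal:
  assumes G: "comm_group G"
   and M: "abelian_group M" and N: "abelian_group N"
   and act: "\<And>x a. x \<in> carrier M \<Longrightarrow> a \<in> carrier A \<Longrightarrow> x \<triangleleft>\<^bsub>M\<^esub> a \<in> carrier M"
     "\<And>x a. x \<in> carrier N \<Longrightarrow> a \<in> carrier A \<Longrightarrow> a \<triangleright>\<^bsub>N\<^esub> x \<in> carrier N"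
   and p: "\<And>x y. x \<in> carrier M \<Longrightarrow> y \<in> carrier N \<Longrightarrow> \<phi> x y \<in> carrier G"
   and p1: "\<And>x x' y. x \<in> carrier M \<Longrightarrow> x' \<in> carrier M \<Longrightarrow> y \<in> carrier N \<Longrightarrow> \<phi> (x \<oplus>\<^bsub>M\<^esub> x') y = \<phi> x y \<otimes>\<^bsub>G\<^esub> \<phi> x' y"
   and p2: "\<And>x y' y. x \<in> carrier M \<Longrightarrow> y' \<in> carrier N \<Longrightarrow> y \<in> carrier N \<Longrightarrow> \<phi> x (y \<oplus>\<^bsub>N\<^esub> y') = \<phi> x y \<otimes>\<^bsub>G\<^esub> \<phi> x y'"
   and p3: "\<And>x a y. x \<in> carrier M \<Longrightarrow> a \<in> carrier A \<Longrightarrow> y \<in> carrier N \<Longrightarrow> \<phi> (x \<triangleleft>\<^bsub>M\<^esub> a) y = \<phi> x (a \<triangleright>\<^bsub>N\<^esub> y)"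
  shows "tensor_lift A M N G \<phi> \<in> hom (tensor_group A M N) G \<and>
      (\<forall>x\<in>carrier M. \<forall>y\<in>carrier N. tensor_lift A M N G \<phi> (pure_tensor A M N x y) = \<phi> x y)"
proof -
  interpret G: comm_group G by fact
  interpret M: abelian_group M by fact
  interpret N: abelian_group N by fact
  let ?S = "carrier M \<times> carrier N" let ?F = "free_Abelian_group ?S"
  interpret F: comm_group ?F by (rule abelian_free_Abelian_group)
  have "case_prod \<phi> \<in> ?S \<rightarrow> carrier G" using p by auto
  then obtain h where h: "h \<in> hom ?F G" "\<And>s. s \<in> ?S \<Longrightarrow> h (frag_of s) = case_prod \<phi> s"
    by (metis G.free_Abelian_group_universal funcset_image)
  interpret h: group_hom ?F G h using h(1) by unfold_locales
  have sub: "h (u - v) = h u \<otimes>\<^bsub>G\<^esub> inv\<^bsub>G\<^esub> h v" if "u \<in> carrier ?F" "v \<in> carrier ?F" for u v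
  proof -
    have "u - v = u \<otimes>\<^bsub>?F\<^esub> inv\<^bsub>?F\<^esub> v" using that by simp
    then show ?thesis using that by (simp only: h.hom_mult h.hom_inv F.inv_closed)
  qed
  let ?T = "tensor_rel A M N"
  have fr: "frag_of s \<in> carrier ?F" if "s \<in> ?S" for s using that by simp
  have di: "u - v \<in> carrier ?F" if "u \<in> carrier ?F" "v \<in> carrier ?F" for u v
    using that keys_diff[of u v] by auto
  define B where "B = ({frag_of (x \<oplus>\<^bsub>M\<^esub> x', y) - frag_of (x, y) - frag_of (x', y) | x x' y.
        x \<in> carrier M \<and> x' \<in> carrier M \<and> y \<in> carrier N} \<union>
     {frag_of (x, y \<oplus>\<^bsub>N\<^esub> y') - frag_of (x, y) - frag_of (x, y') | x y y'.
        x \<in> carrier M \<and> y \<in> carrier N \<and> y' \<in> carrier N} \<union>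
     {frag_of (x \<triangleleft>\<^bsub>M\<^esub> a, y) - frag_of (x, a \<triangleright>\<^bsub>N\<^esub> y) | x a y.
        x \<in> carrier M \<and> a \<in> carrier A \<and> y \<in> carrier N})"
  have TB: "?T = generate ?F B" unfolding tensor_rel_def B_def ..
  have Bk: "B \<subseteq> kernel ?F G h"
    unfolding B_def kernel_def using act p
    by (auto simp del: carrier_free_Abelian_group_iff intro!: di fr simp: sub di fr h(2) p1 p2 p3 G.m_assoc G.inv_mult_group[symmetric])
       (metis G.inv_mult G.m_closed G.r_inv G.m_assoc G.inv_closed p G.m_comm)+
  have sg: "subgroup ?T ?F" unfolding TB
    by (rule F.generate_is_subgroup) (use Bk in \<open>auto simp: kernel_def\<close>)
  then have nt: "?T \<lhd> ?F" by (rule F.subgroup_imp_normal)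
  have Tk: "?T \<subseteq> kernel ?F G h" unfolding TB by (rule F.generate_subgroup_incl[OF Bk h.subgroup_kernel])
  have wd: "h u = h v" if uv: "u \<in> carrier ?F" "v \<in> carrier ?F" "?T #>\<^bsub>?F\<^esub> u = ?T #>\<^bsub>?F\<^esub> v" for u v
  proof -
    have "u \<in> ?T #>\<^bsub>?F\<^esub> v" using uv F.rcos_self[OF uv(1) sg] by simp
    then obtain t where t: "t \<in> ?T" "u = t \<otimes>\<^bsub>?F\<^esub> v" by (auto simp: r_coset_def)
    then have "h t = \<one>\<^bsub>G\<^esub>" "t \<in> carrier ?F" using Tk by (auto simp: kernel_def)
    then show ?thesis unfolding t(2) using uv by (simp only: h.hom_mult) simp
  qed
  obtain g where g: "g \<in> hom (?F Mod ?T) G" "\<And>u. u \<in> carrier ?F \<Longrightarrow> g (?T #>\<^bsub>?F\<^esub> u) = h u"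
    using FactGroup_universal[OF h(1) nt wd] by metis
  show ?thesis unfolding tensor_lift_def
    by (rule someI[of _ g]) (use g h(2) in \<open>auto simp: tensor_group_def pure_tensor_def\<close>)
qed

definition tensor_rmodule ::
    "('a, 'k) ring_scheme \<Rightarrow> ('a, 'm, 'x) rmodule_scheme \<Rightarrow> ('a, 'n, 'y) bimodule_scheme
      \<Rightarrow> ('a, ('m, 'n) tensor) rmodule"
  where "tensor_rmodule A M N =
    \<lparr>carrier = carrier (tensor_group A M N), monoid.mult = undefined, monoid.one = undefined,
     ring.zero = monoid.one (tensor_group A M N), ring.add = monoid.mult (tensor_group A M N),
     rsmult = (\<lambda>t a. tensor_lift A M N (tensor_group A M N)
       (\<lambda>x y. pure_tensor A M N x (y \<triangleleft>\<^bsub>N\<^esub> a)) t)\<rparr>"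

definition tensor_bimodule ::
    "('a, 'k) ring_scheme \<Rightarrow> ('a, 'm, 'x) bimodule_scheme \<Rightarrow> ('a, 'n, 'y) bimodule_scheme
      \<Rightarrow> ('a, ('m, 'n) tensor) bimodule"
  where "tensor_bimodule A M N =
    \<lparr>carrier = carrier (tensor_group A M N), monoid.mult = undefined, monoid.one = undefined,
     ring.zero = monoid.one (tensor_group A M N), ring.add = monoid.mult (tensor_group A M N),
     rsmult = rsmult (tensor_rmodule A M N),
     lsmult = (\<lambda>a t. tensor_lift A M N (tensor_group A M N)
       (\<lambda>x y. pure_tensor A M N (a \<triangleright>\<^bsub>M\<^esub> x) y) t)\<rparr>"

text \<open>\<open>tensor_map A M N M' N' f g\<close> is \<open>f \<otimes> g : M \<otimes> N \<rightarrow> M' \<otimes> N'\<close>.\<close>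

definition tensor_map ::
    "('a, 'k) ring_scheme \<Rightarrow> ('a, 'm, 'x) rmodule_scheme \<Rightarrow> ('a, 'n, 'y) bimodule_scheme
      \<Rightarrow> ('a, 'p, 'z) rmodule_scheme \<Rightarrow> ('a, 'q, 'w) bimodule_scheme
      \<Rightarrow> ('m \<Rightarrow> 'p) \<Rightarrow> ('n \<Rightarrow> 'q) \<Rightarrow> ('m, 'n) tensor \<Rightarrow> ('p, 'q) tensor"
  where "tensor_map A M N M' N' f g =
    tensor_lift A M N (tensor_group A M' N') (\<lambda>x y. pure_tensor A M' N' (f x) (g y))"

text \<open>The canonical maps \<open>(M \<otimes> N) \<otimes> P \<rightarrow> M \<otimes> (N \<otimes> P)\<close>, \<open>M \<otimes> A \<rightarrow> M\<close> and
  \<open>A \<otimes> N \<rightarrow> N\<close>.\<close>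

definition tensor_assoc ::
    "('a, 'k) ring_scheme \<Rightarrow> ('a, 'm, 'x) rmodule_scheme \<Rightarrow> ('a, 'n, 'y) bimodule_scheme
      \<Rightarrow> ('a, 'p, 'z) bimodule_scheme \<Rightarrow> (('m, 'n) tensor, 'p) tensor \<Rightarrow> ('m, ('n, 'p) tensor) tensor"
  where "tensor_assoc A M N P =
    (let G = tensor_group A M (tensor_bimodule A N P) in
     tensor_lift A (tensor_rmodule A M N) P G
       (\<lambda>t z. tensor_lift A M N G
         (\<lambda>x y. pure_tensor A M (tensor_bimodule A N P) x (pure_tensor A N P y z)) t))"

definition tensor_runit ::
    "('a, 'k) ring_scheme \<Rightarrow> ('a, 'm, 'x) rmodule_scheme \<Rightarrow> ('m, 'a) tensor \<Rightarrow> 'm"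
  where "tensor_runit A M =
    tensor_lift A M (regular_bimodule A) (add_monoid M) (\<lambda>x a. x \<triangleleft>\<^bsub>M\<^esub> a)"

definition tensor_lunit ::
    "('a, 'k) ring_scheme \<Rightarrow> ('a, 'n, 'y) bimodule_scheme \<Rightarrow> ('a, 'n) tensor \<Rightarrow> 'n"
  where "tensor_lunit A N =
    tensor_lift A (regular_bimodule A) N (add_monoid N) (\<lambda>a y. a \<triangleright>\<^bsub>N\<^esub> y)"

text \<open>Flatness of the left module \<open>N\<close>: \<open>- \<otimes>\<^sub>A N\<close> preserves injectivity of homomorphisms of right
  modules. HOL cannot quantify over types inside a formula, so the type holding the carriers of
  the test modules is a parameter. By the ideal criterion, flatness with respect to the type of
  the elements of \<open>A\<close> already implies flatness with respect to every other type.\<close>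

definition left_flat ::
    "'u itself \<Rightarrow> ('a, 'k) ring_scheme \<Rightarrow> ('a, 'n, 'y) bimodule_scheme \<Rightarrow> bool"
  where "left_flat _ A N \<longleftrightarrow>
    (\<forall>(L :: ('a, 'u) rmodule) (L' :: ('a, 'u) rmodule) j.
      right_module A L \<and> right_module A L' \<and> j \<in> rmodule_hom A L L' \<and> inj_on j (carrier L)
      \<longrightarrow> inj_on (tensor_map A L N L' N j (\<lambda>y. y)) (carrier (tensor_group A L N)))"


section \<open>Corings and comodules\<close>

record ('a, 'c) coring = "('a, 'c) bimodule" +
  comult :: "'c \<Rightarrow> ('c, 'c) tensor"
  counit :: "'c \<Rightarrow> 'a"

locale coring = bimodule A C
  for A :: "('a, 'k) ring_scheme" (structure) and C :: "('a, 'c, 'x) coring_scheme" (structure) +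
  assumes comult_hom: "comult C \<in> bimodule_hom A C (tensor_bimodule A C C)"
    and counit_hom: "counit C \<in> bimodule_hom A C (regular_bimodule A)"
    and coassoc: "c \<in> carrier C \<Longrightarrow>
      tensor_assoc A C C C
        (tensor_map A C C (tensor_rmodule A C C) C (comult C) (\<lambda>y. y) (comult C c)) =
      tensor_map A C C C (tensor_bimodule A C C) (\<lambda>x. x) (comult C) (comult C c)"
    and left_counit: "c \<in> carrier C \<Longrightarrow>
      tensor_lunit A C
        (tensor_map A C C (regular_bimodule A) C (counit C) (\<lambda>y. y) (comult C c)) = c"
    and right_counit: "c \<in> carrier C \<Longrightarrow>
      tensor_runit A C
        (tensor_map A C C C (regular_bimodule A) (\<lambda>x. x) (counit C) (comult C c)) = c"

record ('a, 'm, 'c) comodule = "('a, 'm) rmodule" +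
  coaction :: "'m \<Rightarrow> ('m, 'c) tensor"

locale right_comodule = right_module A M + C?: coring A C
  for A :: "('a, 'k) ring_scheme" (structure) and C :: "('a, 'c, 'z) coring_scheme" (structure)
    and M :: "('a, 'm, 'c, 'x) comodule_scheme" (structure) +
  assumes coaction_hom: "coaction M \<in> rmodule_hom A M (tensor_rmodule A M C)"
    and coaction_coassoc: "x \<in> carrier M \<Longrightarrow>
      tensor_assoc A M C C
        (tensor_map A M C (tensor_rmodule A M C) C (coaction M) (\<lambda>y. y) (coaction M x)) =
      tensor_map A M C M (tensor_bimodule A C C) (\<lambda>x. x) (comult C) (coaction M x)"
    and coaction_counit: "x \<in> carrier M \<Longrightarrow>
      tensor_runit A M
        (tensor_map A M C M (regular_bimodule A) (\<lambda>x. x) (counit C) (coaction M x)) = x"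

text \<open>Colinear maps are represented by their extensional versions, so that \<open>Hom\<close> and
  \<open>End\<close> are genuine sets of maps on the carrier.\<close>

definition colinear_hom ::
    "('a, 'k) ring_scheme \<Rightarrow> ('a, 'c, 'z) coring_scheme \<Rightarrow> ('a, 'm, 'c, 'x) comodule_scheme
      \<Rightarrow> ('a, 'n, 'c, 'y) comodule_scheme \<Rightarrow> ('m \<Rightarrow> 'n) set"
  where "colinear_hom A C M N =
    {f \<in> rmodule_hom A M N \<inter> extensional (carrier M).
      \<forall>x\<in>carrier M. coaction N (f x) = tensor_map A M C N C f (\<lambda>y. y) (coaction M x)}"

definition subcomodule ::
    "('a, 'k) ring_scheme \<Rightarrow> ('a, 'c, 'z) coring_scheme \<Rightarrow> 'm set
      \<Rightarrow> ('a, 'm, 'c, 'x) comodule_scheme \<Rightarrow> bool"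
  where "subcomodule A C K M \<longleftrightarrow> K \<subseteq> carrier M \<and>
    (\<exists>\<rho>. right_comodule A C (M\<lparr>carrier := K, coaction := \<rho>\<rparr>) \<and>
         (\<lambda>x\<in>K. x) \<in> colinear_hom A C (M\<lparr>carrier := K, coaction := \<rho>\<rparr>) M)"

definition quotient_rmodule ::
    "('a, 'm, 'x) rmodule_scheme \<Rightarrow> 'm set \<Rightarrow> ('a, 'm set) rmodule"
  where "quotient_rmodule M K =
    \<lparr>carrier = a_rcosets\<^bsub>M\<^esub> K, monoid.mult = undefined, monoid.one = undefined,
     ring.zero = K, ring.add = set_add M,
     rsmult = (\<lambda>Y a. \<Union>x\<in>Y. K +>\<^bsub>M\<^esub> (x \<triangleleft>\<^bsub>M\<^esub> a))\<rparr>"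

text \<open>The coaction of \<open>M / K\<close> sends \<open>x + K\<close> to \<open>(\<pi> \<otimes> C) (\<rho> x)\<close>, where \<open>\<pi>\<close> is the
  projection; for a subcomodule \<open>K\<close> this does not depend on the representative \<open>x\<close>.\<close>

definition quotient_comodule ::
    "('a, 'k) ring_scheme \<Rightarrow> ('a, 'c, 'z) coring_scheme \<Rightarrow> ('a, 'm, 'c, 'x) comodule_scheme
      \<Rightarrow> 'm set \<Rightarrow> ('a, 'm set, 'c) comodule"
  where "quotient_comodule A C M K =
    \<lparr>carrier = a_rcosets\<^bsub>M\<^esub> K, monoid.mult = undefined, monoid.one = undefined,
     ring.zero = K, ring.add = set_add M,
     rsmult = rsmult (quotient_rmodule M K),
     coaction = (\<lambda>Y. the_elem
       ((\<lambda>x. tensor_map A M C (quotient_rmodule M K) C (\<lambda>m. K +>\<^bsub>M\<^esub> m) (\<lambda>y. y) (coaction M x)) ` Y))\<rparr>"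

definition coretractable ::
    "('a, 'k) ring_scheme \<Rightarrow> ('a, 'c, 'z) coring_scheme \<Rightarrow> ('a, 'm, 'c, 'x) comodule_scheme \<Rightarrow> bool"
  where "coretractable A C M \<longleftrightarrow>
    (\<forall>K. subcomodule A C K M \<and> K \<noteq> carrier M \<longrightarrow>
      colinear_hom A C (quotient_comodule A C M K) M
        \<noteq> {\<lambda>Y\<in>carrier (quotient_comodule A C M K). \<zero>\<^bsub>M\<^esub>})"

definition self_cogenerator ::
    "('a, 'k) ring_scheme \<Rightarrow> ('a, 'c, 'z) coring_scheme \<Rightarrow> ('a, 'm, 'c, 'x) comodule_scheme \<Rightarrow> bool"
  where "self_cogenerator A C M \<longleftrightarrow>
    (\<forall>K. subcomodule A C K M \<longrightarrow>
      (\<Inter>h\<in>colinear_hom A C (quotient_comodule A C M K) M.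
        a_kernel (quotient_comodule A C M K) M h) = {\<zero>\<^bsub>quotient_comodule A C M K\<^esub>})"


section \<open>The opposite endomorphism ring and its primeness conditions\<close>

text \<open>The product \<open>f g\<close> is \<open>g \<circ> f\<close>.\<close>

definition End_op ::
    "('a, 'k) ring_scheme \<Rightarrow> ('a, 'c, 'z) coring_scheme \<Rightarrow> ('a, 'm, 'c, 'x) comodule_scheme
      \<Rightarrow> ('m \<Rightarrow> 'm) ring"
  where "End_op A C M =
    \<lparr>carrier = colinear_hom A C M M, monoid.mult = (\<lambda>f g. compose (carrier M) g f),
     monoid.one = (\<lambda>x\<in>carrier M. x), ring.zero = (\<lambda>x\<in>carrier M. \<zero>\<^bsub>M\<^esub>),
     ring.add = (\<lambda>f g. \<lambda>x\<in>carrier M. f x \<oplus>\<^bsub>M\<^esub> g x)\<rparr>"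

text \<open>For a set \<open>F\<close> of endomorphisms, \<open>M F\<close> is the sum of the subgroups \<open>M f = f(M)\<close>, \<open>f \<in> F\<close>.\<close>

definition image_sum :: "('m, 'x) ring_scheme \<Rightarrow> ('m \<Rightarrow> 'm) set \<Rightarrow> 'm set" where
  "image_sum M F = generate (add_monoid M) (\<Union>f\<in>F. f ` carrier M)"

text \<open>The library's \<open>primeideal\<close>, \<open>domain\<close> are restricted to commutative rings. The product
  \<open>I J\<close> of ideals vanishes iff all products \<open>a b\<close> do.\<close>

definition prime_ring :: "('e, 'x) ring_scheme \<Rightarrow> bool" where
  "prime_ring E \<longleftrightarrow> ring E \<and> \<one>\<^bsub>E\<^esub> \<noteq> \<zero>\<^bsub>E\<^esub> \<and>
    (\<forall>I J. ideal I E \<and> ideal J E \<and> (\<forall>a\<in>I. \<forall>b\<in>J. a \<otimes>\<^bsub>E\<^esub> b = \<zero>\<^bsub>E\<^esub>)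
      \<longrightarrow> I = {\<zero>\<^bsub>E\<^esub>} \<or> J = {\<zero>\<^bsub>E\<^esub>})"

definition semiprime_ring :: "('e, 'x) ring_scheme \<Rightarrow> bool" where
  "semiprime_ring E \<longleftrightarrow> ring E \<and>
    (\<forall>I. ideal I E \<and> (\<forall>a\<in>I. \<forall>b\<in>I. a \<otimes>\<^bsub>E\<^esub> b = \<zero>\<^bsub>E\<^esub>) \<longrightarrow> I = {\<zero>\<^bsub>E\<^esub>})"

definition noncomm_domain :: "('e, 'x) ring_scheme \<Rightarrow> bool" where
  "noncomm_domain E \<longleftrightarrow> ring E \<and> \<one>\<^bsub>E\<^esub> \<noteq> \<zero>\<^bsub>E\<^esub> \<and>
    (\<forall>a\<in>carrier E. \<forall>b\<in>carrier E. a \<otimes>\<^bsub>E\<^esub> b = \<zero>\<^bsub>E\<^esub> \<longrightarrow> a = \<zero>\<^bsub>E\<^esub> \<or> b = \<zero>\<^bsub>E\<^esub>)"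

definition reduced_ring :: "('e, 'x) ring_scheme \<Rightarrow> bool" where
  "reduced_ring E \<longleftrightarrow> ring E \<and>
    (\<forall>a\<in>carrier E. \<forall>n::nat. a [^]\<^bsub>E\<^esub> n = \<zero>\<^bsub>E\<^esub> \<longrightarrow> a = \<zero>\<^bsub>E\<^esub>)"

definition E_prime ::
    "('a, 'k) ring_scheme \<Rightarrow> ('a, 'c, 'z) coring_scheme \<Rightarrow> ('a, 'm, 'c, 'x) comodule_scheme \<Rightarrow> bool"
  where "E_prime A C M \<longleftrightarrow> prime_ring (End_op A C M)"

definition E_semiprime ::
    "('a, 'k) ring_scheme \<Rightarrow> ('a, 'c, 'z) coring_scheme \<Rightarrow> ('a, 'm, 'c, 'x) comodule_scheme \<Rightarrow> bool"
  where "E_semiprime A C M \<longleftrightarrow> semiprime_ring (End_op A C M)"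

definition completely_E_prime ::
    "('a, 'k) ring_scheme \<Rightarrow> ('a, 'c, 'z) coring_scheme \<Rightarrow> ('a, 'm, 'c, 'x) comodule_scheme \<Rightarrow> bool"
  where "completely_E_prime A C M \<longleftrightarrow> noncomm_domain (End_op A C M)"

definition completely_E_semiprime ::
    "('a, 'k) ring_scheme \<Rightarrow> ('a, 'c, 'z) coring_scheme \<Rightarrow> ('a, 'm, 'c, 'x) comodule_scheme \<Rightarrow> bool"
  where "completely_E_semiprime A C M \<longleftrightarrow> reduced_ring (End_op A C M)"

end

theory Submission
  imports Defs
begin

text \<open>If \<open>M\<close> is coretractable, a proper subcomodule \<open>K\<close> is killed by some nonzero endomorphism, namely
  a nonzero map \<open>M / K \<rightarrow> M\<close> composed with the projection; if \<open>M\<close> is a self-cogenerator, this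
  endomorphism can be chosen nonzero at any given element outside \<open>K\<close>. Applied to \<open>K = M F\<close> for a set
  \<open>F\<close> of endomorphisms, this produces \<open>g\<close> with \<open>F g = 0\<close>, so that \<open>M f E \<noteq> M\<close> contradicts primeness
  and \<open>M f E f \<noteq> M f\<close> contradicts semiprimeness of \<open>E\<close>. The substance is that \<open>M F\<close> is a
  subcomodule: by flatness \<open>K \<otimes> C \<rightarrow> M \<otimes> C\<close> and \<open>K \<otimes> (C \<otimes> C) \<rightarrow> M \<otimes> (C \<otimes> C)\<close> are injective, so the
  coaction of \<open>M\<close>, which maps \<open>K\<close> into the image of \<open>K \<otimes> C\<close>, lifts to \<open>K\<close> together with its axioms.\<close>

section \<open>Tensor products\<close>

text \<open>Flatness is assumed of C alone, while coassociativity on a subcomodule K is an equation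
  in K \<otimes> (C \<otimes> C). Injectivity into M \<otimes> (C \<otimes> C) is therefore obtained
  by tensoring the inclusion with C twice and moving the brackets with the natural associativity
  isomorphism; the second flatness test has K \<otimes> C and M \<otimes> C as its modules. Tensor
  products are cosets of formal sums and induced maps are fixed by choice, so identities between
  them are usually verified on pure tensors and asserted on carriers. Primeness is stated through
  two-sided ideals, but the arguments produce products f e g of elements; annihilator ideals
  translate between the two. For a reduced endomorphism ring, f f g = 0 has to give f g = 0, which
  takes the two square-zero elements f g f and f g in turn. The locale below asks of the factors
  what the universal property of the tensor product asks: additive groups and closed actions. Hence
  it applies directly to C \<otimes> C and to quotients of M.\<close>

locale tensor_factors = M: abelian_group M + N: abelian_group N
  for A :: "('a, 'k) ring_scheme" and M :: "('a, 'm, 'x) rmodule_scheme"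
    and N :: "('a, 'n, 'y) bimodule_scheme" +
  assumes rsmult_in: "\<lbrakk>x \<in> carrier M; a \<in> carrier A\<rbrakk> \<Longrightarrow> x \<triangleleft>\<^bsub>M\<^esub> a \<in> carrier M"
    and lsmult_in: "\<lbrakk>a \<in> carrier A; y \<in> carrier N\<rbrakk> \<Longrightarrow> a \<triangleright>\<^bsub>N\<^esub> y \<in> carrier N"

lemma bimodule_right_module: "bimodule A N \<Longrightarrow> right_module A N"
  by (rule bimodule.axioms(1))

lemma right_module_abelian_group: "right_module A M \<Longrightarrow> abelian_group M"
  by (rule right_module.axioms(2))

lemma tensor_factorsI:
  assumes "right_module A M" "bimodule A N"
  shows "tensor_factors A M N"
proof -
  interpret M: right_module A M by fact
  interpret N: bimodule A N by fact
  show ?thesis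
    by unfold_locales (auto simp: M.rsmult_closed N.lsmult_closed)
qed

text \<open>The conditions on \<phi> in the universal property, bundled so that a lift needs a
  single premise. The target \<open>G\<close> is multiplicative; a module enters as its
  \<open>add_monoid\<close>.\<close>

definition balanced ::
    "('a, 'k) ring_scheme \<Rightarrow> ('a, 'm, 'x) rmodule_scheme \<Rightarrow> ('a, 'n, 'y) bimodule_scheme
      \<Rightarrow> ('g, 'z) monoid_scheme \<Rightarrow> ('m \<Rightarrow> 'n \<Rightarrow> 'g) \<Rightarrow> bool"
  where "balanced A M N G \<phi> \<longleftrightarrow>
    (\<forall>x\<in>carrier M. \<forall>y\<in>carrier N. \<phi> x y \<in> carrier G) \<and>
    (\<forall>x\<in>carrier M. \<forall>x'\<in>carrier M. \<forall>y\<in>carrier N. \<phi> (x \<oplus>\<^bsub>M\<^esub> x') y = \<phi> x y \<otimes>\<^bsub>G\<^esub> \<phi> x' y) \<and>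
    (\<forall>x\<in>carrier M. \<forall>y\<in>carrier N. \<forall>y'\<in>carrier N. \<phi> x (y \<oplus>\<^bsub>N\<^esub> y') = \<phi> x y \<otimes>\<^bsub>G\<^esub> \<phi> x y') \<and>
    (\<forall>x\<in>carrier M. \<forall>a\<in>carrier A. \<forall>y\<in>carrier N. \<phi> (x \<triangleleft>\<^bsub>M\<^esub> a) y = \<phi> x (a \<triangleright>\<^bsub>N\<^esub> y))"

lemma balancedI:
  assumes "\<And>x y. \<lbrakk>x \<in> carrier M; y \<in> carrier N\<rbrakk> \<Longrightarrow> \<phi> x y \<in> carrier G"
    and "\<And>x x' y. \<lbrakk>x \<in> carrier M; x' \<in> carrier M; y \<in> carrier N\<rbrakk>
      \<Longrightarrow> \<phi> (x \<oplus>\<^bsub>M\<^esub> x') y = \<phi> x y \<otimes>\<^bsub>G\<^esub> \<phi> x' y"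
    and "\<And>x y y'. \<lbrakk>x \<in> carrier M; y \<in> carrier N; y' \<in> carrier N\<rbrakk>
      \<Longrightarrow> \<phi> x (y \<oplus>\<^bsub>N\<^esub> y') = \<phi> x y \<otimes>\<^bsub>G\<^esub> \<phi> x y'"
    and "\<And>x a y. \<lbrakk>x \<in> carrier M; a \<in> carrier A; y \<in> carrier N\<rbrakk>
      \<Longrightarrow> \<phi> (x \<triangleleft>\<^bsub>M\<^esub> a) y = \<phi> x (a \<triangleright>\<^bsub>N\<^esub> y)"
  shows "balanced A M N G \<phi>"
  unfolding balanced_def using assms by blast

context tensor_factors
begin

lemma tensor_rel_subgroup:
  "subgroup (tensor_rel A M N) (free_Abelian_group (carrier M \<times> carrier N))"
proof -
  let ?F = "free_Abelian_group (carrier M \<times> carrier N)"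
  interpret F: comm_group ?F by (rule abelian_free_Abelian_group)
  have di: "u - v \<in> carrier ?F" if "u \<in> carrier ?F" "v \<in> carrier ?F" for u v
    using that keys_diff[of u v] by auto
  have fr: "frag_of s \<in> carrier ?F" if "s \<in> carrier M \<times> carrier N" for s using that by simp
  show ?thesis
    unfolding tensor_rel_def
    by (rule F.generate_is_subgroup)
      (auto simp del: carrier_free_Abelian_group_iff intro!: di fr rsmult_in lsmult_in)
qed

lemma tensor_rel_normal:
  "tensor_rel A M N \<lhd> free_Abelian_group (carrier M \<times> carrier N)"
  using comm_group.subgroup_imp_normal[OF abelian_free_Abelian_group tensor_rel_subgroup] .

lemma tensor_comm_group: "comm_group (tensor_group A M N)"
  unfolding tensor_group_def
  by (rule comm_group.abelian_FactGroup[OF abelian_free_Abelian_group tensor_rel_subgroup])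

sublocale T: comm_group "tensor_group A M N"
  by (rule tensor_comm_group)

lemma tensor_coset_mult:
  assumes "u \<in> carrier (free_Abelian_group (carrier M \<times> carrier N))"
    and "v \<in> carrier (free_Abelian_group (carrier M \<times> carrier N))"
  shows "(tensor_rel A M N #>\<^bsub>free_Abelian_group (carrier M \<times> carrier N)\<^esub> u)
      \<otimes>\<^bsub>tensor_group A M N\<^esub> (tensor_rel A M N #>\<^bsub>free_Abelian_group (carrier M \<times> carrier N)\<^esub> v)
    = tensor_rel A M N #>\<^bsub>free_Abelian_group (carrier M \<times> carrier N)\<^esub> (u + v)"
  using normal.rcos_sum[OF tensor_rel_normal assms]
  by (simp add: tensor_group_def)

lemma tensor_coset_eq:
  assumes "u \<in> carrier (free_Abelian_group (carrier M \<times> carrier N))"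
    and "v \<in> carrier (free_Abelian_group (carrier M \<times> carrier N))"
    and "u - v \<in> tensor_rel A M N"
  shows "tensor_rel A M N #>\<^bsub>free_Abelian_group (carrier M \<times> carrier N)\<^esub> u
    = tensor_rel A M N #>\<^bsub>free_Abelian_group (carrier M \<times> carrier N)\<^esub> v"
proof -
  let ?F = "free_Abelian_group (carrier M \<times> carrier N)"
  interpret F: comm_group ?F by (rule abelian_free_Abelian_group)
  have "u = (u - v) \<otimes>\<^bsub>?F\<^esub> v" by simp
  then have "u \<in> tensor_rel A M N #>\<^bsub>?F\<^esub> v"
    using assms(3) unfolding r_coset_def by blast
  then show ?thesis
    using F.repr_independence[OF _ assms(2) tensor_rel_subgroup] by blast
qed

lemma pure_closed:
  assumes "x \<in> carrier M" "y \<in> carrier N"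
  shows "pure_tensor A M N x y \<in> carrier (tensor_group A M N)"
  using assms by (auto simp: pure_tensor_def tensor_group_def carrier_FactGroup)

lemma pure_add_left:
  assumes "x \<in> carrier M" "x' \<in> carrier M" "y \<in> carrier N"
  shows "pure_tensor A M N (x \<oplus>\<^bsub>M\<^esub> x') y =
    pure_tensor A M N x y \<otimes>\<^bsub>tensor_group A M N\<^esub> pure_tensor A M N x' y"
proof -
  have k: "frag_of (x, y) + frag_of (x', y) \<in> carrier (free_Abelian_group (carrier M \<times> carrier N))"
    using assms keys_add[of "frag_of (x, y)" "frag_of (x', y)"] by auto
  have "frag_of (x \<oplus>\<^bsub>M\<^esub> x', y) - frag_of (x, y) - frag_of (x', y) \<in> tensor_rel A M N"
    unfolding tensor_rel_def using assms by (intro generate.incl) blast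
  then show ?thesis
    using assms k unfolding pure_tensor_def
    by (subst tensor_coset_mult, simp, simp, intro tensor_coset_eq) (auto simp: diff_diff_eq)
qed

lemma pure_add_right:
  assumes "x \<in> carrier M" "y \<in> carrier N" "y' \<in> carrier N"
  shows "pure_tensor A M N x (y \<oplus>\<^bsub>N\<^esub> y') =
    pure_tensor A M N x y \<otimes>\<^bsub>tensor_group A M N\<^esub> pure_tensor A M N x y'"
proof -
  have k: "frag_of (x, y) + frag_of (x, y') \<in> carrier (free_Abelian_group (carrier M \<times> carrier N))"
    using assms keys_add[of "frag_of (x, y)" "frag_of (x, y')"] by auto
  have "frag_of (x, y \<oplus>\<^bsub>N\<^esub> y') - frag_of (x, y) - frag_of (x, y') \<in> tensor_rel A M N"
    unfolding tensor_rel_def using assms by (intro generate.incl) blast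
  then show ?thesis
    using assms k unfolding pure_tensor_def
    by (subst tensor_coset_mult, simp, simp, intro tensor_coset_eq) (auto simp: diff_diff_eq)
qed

lemma pure_balanced:
  assumes "x \<in> carrier M" "a \<in> carrier A" "y \<in> carrier N"
  shows "pure_tensor A M N (x \<triangleleft>\<^bsub>M\<^esub> a) y = pure_tensor A M N x (a \<triangleright>\<^bsub>N\<^esub> y)"
proof -
  have "frag_of (x \<triangleleft>\<^bsub>M\<^esub> a, y) - frag_of (x, a \<triangleright>\<^bsub>N\<^esub> y) \<in> tensor_rel A M N"
    unfolding tensor_rel_def using assms by (intro generate.incl) blast
  then show ?thesis
    using assms unfolding pure_tensor_def
    by (intro tensor_coset_eq) (auto simp: rsmult_in lsmult_in)
qed

text \<open>The last case is a quotient rather than a product because a formal sum is built from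
  generators by subtraction. The induction runs on a representative of the coset, and the coset map,
  being a homomorphism, turns differences into quotients.\<close>

lemma tensor_induct [consumes 1, case_names one pure diff]:
  assumes t: "t \<in> carrier (tensor_group A M N)"
    and one: "P \<one>\<^bsub>tensor_group A M N\<^esub>"
    and pure: "\<And>x y. \<lbrakk>x \<in> carrier M; y \<in> carrier N\<rbrakk> \<Longrightarrow> P (pure_tensor A M N x y)"
    and diff: "\<And>u v. \<lbrakk>u \<in> carrier (tensor_group A M N); v \<in> carrier (tensor_group A M N); P u; P v\<rbrakk>
      \<Longrightarrow> P (u \<otimes>\<^bsub>tensor_group A M N\<^esub> inv\<^bsub>tensor_group A M N\<^esub> v)"
  shows "P t"
proof -
  let ?F = "free_Abelian_group (carrier M \<times> carrier N)"
  let ?c = "\<lambda>u. tensor_rel A M N #>\<^bsub>?F\<^esub> u"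
  interpret F: comm_group ?F by (rule abelian_free_Abelian_group)
  obtain u where u: "u \<in> carrier ?F" "t = ?c u"
    using t by (auto simp: tensor_group_def carrier_FactGroup)
  have ch: "?c \<in> hom ?F (tensor_group A M N)"
    unfolding tensor_group_def by (rule normal.r_coset_hom_Mod[OF tensor_rel_normal])
  interpret c: group_hom ?F "tensor_group A M N" ?c
    by unfold_locales (rule ch)
  \<comment> \<open>Membership is part of the induction predicate because the difference case of
    \<open>frag_induction\<close> says nothing about the supports of its two elements.\<close>
  have "u \<in> carrier ?F \<and> P (?c u)"
    using u(1)[unfolded carrier_free_Abelian_group_iff]
  proof (induction u rule: frag_induction)
    case zero
    then show ?case using c.hom_one one F.one_closed by simp
  next
    case (one s)
    then show ?case
      using pure[of "fst s" "snd s"] by (auto simp: pure_tensor_def)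
  next
    case (diff a b)
    then have ab: "a \<in> carrier ?F" "b \<in> carrier ?F" by auto
    then have e: "a - b = a \<otimes>\<^bsub>?F\<^esub> inv\<^bsub>?F\<^esub> b" by simp
    show ?case
      unfolding e using ab diff assms(4) c.hom_closed
      by (simp only: c.hom_mult c.hom_inv F.inv_closed F.m_closed)
  qed
  then show ?thesis using u(2) by simp
qed

text \<open>The elements on which two homomorphisms agree are closed under quotients, so pure
  tensors decide. Most identities between maps out of a tensor product are reduced to generators by
  this rule.\<close>

lemma tensor_hom_eq:
  assumes h: "h \<in> hom (tensor_group A M N) G" and k: "k \<in> hom (tensor_group A M N) G" and G: "group G"
    and eq: "\<And>x y. \<lbrakk>x \<in> carrier M; y \<in> carrier N\<rbrakk> \<Longrightarrow> h (pure_tensor A M N x y) = k (pure_tensor A M N x y)"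
    and t: "t \<in> carrier (tensor_group A M N)"
  shows "h t = k t"
proof -
  interpret G: group G by fact
  interpret h: group_hom "tensor_group A M N" G h by unfold_locales (rule h)
  interpret k: group_hom "tensor_group A M N" G k by unfold_locales (rule k)
  show ?thesis using t
    by (induction rule: tensor_induct) (auto simp: eq)
qed

lemma lift_hom:
  assumes "comm_group G" "balanced A M N G \<phi>"
  shows "tensor_lift A M N G \<phi> \<in> hom (tensor_group A M N) G"
  using assms unfolding balanced_def
  by (intro tensor_lift_universal[THEN conjunct1])
    (auto intro: M.abelian_group_axioms N.abelian_group_axioms rsmult_in lsmult_in)

lemma lift_pure:
  assumes "comm_group G" "balanced A M N G \<phi>" "x \<in> carrier M" "y \<in> carrier N"
  shows "tensor_lift A M N G \<phi> (pure_tensor A M N x y) = \<phi> x y"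
proof -
  have "\<forall>x\<in>carrier M. \<forall>y\<in>carrier N. tensor_lift A M N G \<phi> (pure_tensor A M N x y) = \<phi> x y"
    using assms(1,2) unfolding balanced_def
    by (intro tensor_lift_universal[THEN conjunct2])
      (auto intro: M.abelian_group_axioms N.abelian_group_axioms rsmult_in lsmult_in)
  then show ?thesis using assms(3,4) by blast
qed

end

subsection \<open>Functoriality\<close>

text \<open>The second map in f \<otimes> g has to commute with the left action only, the one that
  moves scalars across the tensor sign. Comultiplication and counit enter in this role.\<close>

definition lmodule_hom ::
    "('a, 'k) ring_scheme \<Rightarrow> ('a, 'm, 'x) bimodule_scheme \<Rightarrow> ('a, 'n, 'y) bimodule_scheme \<Rightarrow> ('m \<Rightarrow> 'n) set"
  where "lmodule_hom A M N =
    {f \<in> hom (add_monoid M) (add_monoid N).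
      \<forall>a\<in>carrier A. \<forall>x\<in>carrier M. f (a \<triangleright>\<^bsub>M\<^esub> x) = a \<triangleright>\<^bsub>N\<^esub> f x}"

lemma bimodule_hom_lmodule_hom: "f \<in> bimodule_hom A M N \<Longrightarrow> f \<in> lmodule_hom A M N"
  by (simp add: bimodule_hom_def rmodule_hom_def lmodule_hom_def)

lemma id_lmodule_hom: "(\<lambda>y. y) \<in> lmodule_hom A N N"
  by (simp add: lmodule_hom_def hom_def)

lemma id_rmodule_hom: "(\<lambda>y. y) \<in> rmodule_hom A N N"
  by (simp add: rmodule_hom_def hom_def)

lemma lmodule_hom_comp:
  "\<lbrakk>f \<in> lmodule_hom A M N; g \<in> lmodule_hom A N P\<rbrakk> \<Longrightarrow> (\<lambda>x. g (f x)) \<in> lmodule_hom A M P"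
  by (auto simp: lmodule_hom_def hom_def Pi_iff)

lemma rmodule_hom_comp:
  "\<lbrakk>f \<in> rmodule_hom A M N; g \<in> rmodule_hom A N P\<rbrakk> \<Longrightarrow> (\<lambda>x. g (f x)) \<in> rmodule_hom A M P"
  by (auto simp: rmodule_hom_def hom_def Pi_iff)

lemma rmodule_homD:
  assumes "f \<in> rmodule_hom A M N"
  shows "f \<in> hom (add_monoid M) (add_monoid N)"
    and "x \<in> carrier M \<Longrightarrow> f x \<in> carrier N"
    and "\<lbrakk>x \<in> carrier M; y \<in> carrier M\<rbrakk> \<Longrightarrow> f (x \<oplus>\<^bsub>M\<^esub> y) = f x \<oplus>\<^bsub>N\<^esub> f y"
    and "\<lbrakk>x \<in> carrier M; a \<in> carrier A\<rbrakk> \<Longrightarrow> f (x \<triangleleft>\<^bsub>M\<^esub> a) = f x \<triangleleft>\<^bsub>N\<^esub> a"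
  using assms by (auto simp: rmodule_hom_def hom_def)

lemma lmodule_homD:
  assumes "f \<in> lmodule_hom A M N"
  shows "x \<in> carrier M \<Longrightarrow> f x \<in> carrier N"
    and "\<lbrakk>x \<in> carrier M; y \<in> carrier M\<rbrakk> \<Longrightarrow> f (x \<oplus>\<^bsub>M\<^esub> y) = f x \<oplus>\<^bsub>N\<^esub> f y"
    and "\<lbrakk>x \<in> carrier M; a \<in> carrier A\<rbrakk> \<Longrightarrow> f (a \<triangleright>\<^bsub>M\<^esub> x) = a \<triangleright>\<^bsub>N\<^esub> f x"
  using assms by (auto simp: lmodule_hom_def hom_def)

lemma rmodule_hom_zero:
  assumes "f \<in> rmodule_hom A M N" "abelian_group M" "abelian_group N"
  shows "f \<zero>\<^bsub>M\<^esub> = \<zero>\<^bsub>N\<^esub>"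
  using hom_one[OF rmodule_homD(1)[OF assms(1)]] assms(2,3) by (simp add: abelian_group.a_group)

lemma tensor_map_balanced:
  assumes "tensor_factors A M' N'" "f \<in> rmodule_hom A M M'" "g \<in> lmodule_hom A N N'"
  shows "balanced A M N (tensor_group A M' N') (\<lambda>x y. pure_tensor A M' N' (f x) (g y))"
proof -
  interpret M': tensor_factors A M' N' by fact
  show ?thesis
    by (intro balancedI)
      (auto simp: rmodule_homD[OF assms(2)] lmodule_homD[OF assms(3)] M'.pure_closed
        M'.pure_add_left M'.pure_add_right M'.pure_balanced)
qed

lemma tensor_map_hom:
  assumes "tensor_factors A M N" "tensor_factors A M' N'"
    "f \<in> rmodule_hom A M M'" "g \<in> lmodule_hom A N N'"
  shows "tensor_map A M N M' N' f g \<in> hom (tensor_group A M N) (tensor_group A M' N')"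
  unfolding tensor_map_def
  by (rule tensor_factors.lift_hom[OF assms(1) tensor_factors.tensor_comm_group[OF assms(2)]
        tensor_map_balanced[OF assms(2-4)]])

lemma tensor_map_pure:
  assumes "tensor_factors A M N" "tensor_factors A M' N'"
    "f \<in> rmodule_hom A M M'" "g \<in> lmodule_hom A N N'" "x \<in> carrier M" "y \<in> carrier N"
  shows "tensor_map A M N M' N' f g (pure_tensor A M N x y) = pure_tensor A M' N' (f x) (g y)"
  unfolding tensor_map_def
  by (rule tensor_factors.lift_pure[OF assms(1) tensor_factors.tensor_comm_group[OF assms(2)]
        tensor_map_balanced[OF assms(2-4)] assms(5,6)])

lemma tensor_map_closed:
  assumes "tensor_factors A M N" "tensor_factors A M' N'"
    "f \<in> rmodule_hom A M M'" "g \<in> lmodule_hom A N N'" "t \<in> carrier (tensor_group A M N)"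
  shows "tensor_map A M N M' N' f g t \<in> carrier (tensor_group A M' N')"
  using hom_in_carrier[OF tensor_map_hom[OF assms(1-4)] assms(5)] .

text \<open>The choice in \<open>tensor_lift\<close> depends on the map only through its values on
  the carriers, so the two lifts are equal as functions, even outside the tensor product. This lets
  a map be exchanged with its extensional restriction inside \<open>tensor_map\<close>.\<close>

lemma tensor_lift_cong:
  assumes "\<And>x y. \<lbrakk>x \<in> carrier M; y \<in> carrier N\<rbrakk> \<Longrightarrow> \<phi> x y = \<psi> x y"
  shows "tensor_lift A M N G \<phi> = tensor_lift A M N G \<psi>"
  unfolding tensor_lift_def using assms by (simp cong: ball_cong)

lemma tensor_map_cong:
  assumes "\<And>x. x \<in> carrier M \<Longrightarrow> f x = f' x" "\<And>y. y \<in> carrier N \<Longrightarrow> g y = g' y"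
  shows "tensor_map A M N M' N' f g = tensor_map A M N M' N' f' g'"
  unfolding tensor_map_def using assms by (intro tensor_lift_cong) simp

text \<open>Both sides agree on pure tensors. Read from right to left, the equation inserts an
  intermediate module, which is how a map into M is factored through a submodule.\<close>

lemma tensor_map_comp:
  assumes "tensor_factors A M N" "tensor_factors A M' N'" "tensor_factors A M'' N''"
    and "f \<in> rmodule_hom A M M'" "g \<in> lmodule_hom A N N'"
    and "f' \<in> rmodule_hom A M' M''" "g' \<in> lmodule_hom A N' N''"
    and t: "t \<in> carrier (tensor_group A M N)"
  shows "tensor_map A M' N' M'' N'' f' g' (tensor_map A M N M' N' f g t) =
    tensor_map A M N M'' N'' (\<lambda>x. f' (f x)) (\<lambda>y. g' (g y)) t"
proof -
  interpret M'': tensor_factors A M'' N'' by fact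
  note c = rmodule_hom_comp[OF assms(4,6)] lmodule_hom_comp[OF assms(5,7)]
  have "(tensor_map A M' N' M'' N'' f' g' \<circ> tensor_map A M N M' N' f g) t =
      tensor_map A M N M'' N'' (\<lambda>x. f' (f x)) (\<lambda>y. g' (g y)) t"
  proof (rule tensor_factors.tensor_hom_eq[OF assms(1) _ _ M''.T.is_group _ t])
    show "tensor_map A M' N' M'' N'' f' g' \<circ> tensor_map A M N M' N' f g
        \<in> hom (tensor_group A M N) (tensor_group A M'' N'')"
      by (rule hom_compose[OF tensor_map_hom[OF assms(1,2,4,5)] tensor_map_hom[OF assms(2,3,6,7)]])
    show "tensor_map A M N M'' N'' (\<lambda>x. f' (f x)) (\<lambda>y. g' (g y))
        \<in> hom (tensor_group A M N) (tensor_group A M'' N'')"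
      by (rule tensor_map_hom[OF assms(1,3) c])
  qed (simp add: tensor_map_pure[OF assms(1,2,4,5)] tensor_map_pure[OF assms(2,3,6,7)]
      tensor_map_pure[OF assms(1,3) c] rmodule_homD[OF assms(4)] lmodule_homD[OF assms(5)])
  then show ?thesis by simp
qed

lemma tensor_map_id:
  assumes "tensor_factors A M N" "t \<in> carrier (tensor_group A M N)"
  shows "tensor_map A M N M N (\<lambda>x. x) (\<lambda>y. y) t = t"
proof -
  interpret tensor_factors A M N by fact
  have i: "(\<lambda>t. t) \<in> hom (tensor_group A M N) (tensor_group A M N)" by (simp add: hom_def)
  show ?thesis
    by (rule tensor_hom_eq[OF tensor_map_hom[OF assms(1,1) id_rmodule_hom id_lmodule_hom] i
          T.is_group _ assms(2)])
      (rule tensor_map_pure[OF assms(1,1) id_rmodule_hom id_lmodule_hom])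
qed

lemma (in tensor_factors) pure_zero_left:
  assumes "y \<in> carrier N"
  shows "pure_tensor A M N \<zero>\<^bsub>M\<^esub> y = \<one>\<^bsub>tensor_group A M N\<^esub>"
proof -
  have "pure_tensor A M N \<zero>\<^bsub>M\<^esub> y \<otimes>\<^bsub>tensor_group A M N\<^esub> pure_tensor A M N \<zero>\<^bsub>M\<^esub> y
      = pure_tensor A M N \<zero>\<^bsub>M\<^esub> y"
    using pure_add_left[of "\<zero>\<^bsub>M\<^esub>" "\<zero>\<^bsub>M\<^esub>" y] assms by simp
  then show ?thesis
    using pure_closed[OF M.zero_closed assms] by (simp add: T.l_cancel_one)
qed

lemma tensor_map_zero:
  assumes "tensor_factors A M N" "tensor_factors A M' N'"
    "f \<in> rmodule_hom A M M'" "g \<in> lmodule_hom A N N'"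
    "\<And>x. x \<in> carrier M \<Longrightarrow> f x = \<zero>\<^bsub>M'\<^esub>" "t \<in> carrier (tensor_group A M N)"
  shows "tensor_map A M N M' N' f g t = \<one>\<^bsub>tensor_group A M' N'\<^esub>"
proof -
  interpret M': tensor_factors A M' N' by fact
  have h: "(\<lambda>t. \<one>\<^bsub>tensor_group A M' N'\<^esub>) \<in> hom (tensor_group A M N) (tensor_group A M' N')"
    by (simp add: hom_def)
  show ?thesis
    by (rule tensor_factors.tensor_hom_eq[OF assms(1) tensor_map_hom[OF assms(1-4)] h M'.T.is_group _ assms(6)])
      (simp add: tensor_map_pure[OF assms(1-4)] assms(5) M'.pure_zero_left lmodule_homD(1)[OF assms(4)])
qed

text \<open>The sum is a variable \<open>f''\<close> constrained on the carrier only, so that the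
  zero map can take its place as the sum of a map and its negative.\<close>

lemma tensor_map_add:
  assumes "tensor_factors A M N" "tensor_factors A M' N'"
    "f \<in> rmodule_hom A M M'" "f' \<in> rmodule_hom A M M'" "f'' \<in> rmodule_hom A M M'" "g \<in> lmodule_hom A N N'"
    "\<And>x. x \<in> carrier M \<Longrightarrow> f'' x = f x \<oplus>\<^bsub>M'\<^esub> f' x" "t \<in> carrier (tensor_group A M N)"
  shows "tensor_map A M N M' N' f'' g t =
    tensor_map A M N M' N' f g t \<otimes>\<^bsub>tensor_group A M' N'\<^esub> tensor_map A M N M' N' f' g t"
proof -
  interpret M': tensor_factors A M' N' by fact
  let ?F = "tensor_map A M N M' N' f g" let ?F' = "tensor_map A M N M' N' f' g"
  note h = tensor_map_hom[OF assms(1,2,3,6)] tensor_map_hom[OF assms(1,2,4,6)]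
  \<comment> \<open>A pointwise product of two homomorphisms is again one because the target group
    is commutative.\<close>
  have hh: "(\<lambda>t. ?F t \<otimes>\<^bsub>tensor_group A M' N'\<^esub> ?F' t) \<in> hom (tensor_group A M N) (tensor_group A M' N')"
    using hom_in_carrier[OF h(1)] hom_in_carrier[OF h(2)] hom_mult[OF h(1)] hom_mult[OF h(2)]
    by (intro homI) (auto simp: M'.T.m_ac)
  show ?thesis
    by (rule tensor_factors.tensor_hom_eq[OF assms(1) tensor_map_hom[OF assms(1,2,5,6)] hh M'.T.is_group _ assms(8)])
      (simp add: tensor_map_pure[OF assms(1,2,3,6)] tensor_map_pure[OF assms(1,2,4,6)]
        tensor_map_pure[OF assms(1,2,5,6)] assms(7) M'.pure_add_left
        rmodule_homD(2)[OF assms(3)] rmodule_homD(2)[OF assms(4)] lmodule_homD(1)[OF assms(6)])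
qed

text \<open>The tensor product only sees the module structure, not the further fields of a record.\<close>

definition same_rmodule :: "('a, 'm, 'x) rmodule_scheme \<Rightarrow> ('a, 'm, 'y) rmodule_scheme \<Rightarrow> bool" where
  "same_rmodule M M' \<longleftrightarrow> carrier M = carrier M' \<and> ring.add M = ring.add M' \<and>
    ring.zero M = ring.zero M' \<and> rsmult M = rsmult M'"

lemma same_tensor:
  assumes "same_rmodule M M'"
  shows "tensor_group A M N = tensor_group A M' N" "pure_tensor A M N = pure_tensor A M' N"
    "tensor_lift A M N = tensor_lift A M' N"
proof -
  have "tensor_rel A M N = tensor_rel A M' N"
    using assms by (simp add: tensor_rel_def same_rmodule_def)
  then show 1: "tensor_group A M N = tensor_group A M' N" "pure_tensor A M N = pure_tensor A M' N"
    using assms by (auto simp: tensor_group_def pure_tensor_def same_rmodule_def fun_eq_iff)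
  then show "tensor_lift A M N = tensor_lift A M' N"
    using assms by (auto simp: tensor_lift_def same_rmodule_def fun_eq_iff)
qed

lemma same_tensor_map:
  assumes "same_rmodule M M'" "same_rmodule L L'"
  shows "tensor_map A M N L P f g = tensor_map A M' N L' P f g"
  unfolding tensor_map_def using assms by (simp add: same_tensor)

lemma same_rmodule_hom:
  assumes "same_rmodule M M'" "same_rmodule L L'"
  shows "rmodule_hom A M L = rmodule_hom A M' L'"
  using assms by (simp add: rmodule_hom_def hom_def same_rmodule_def)

lemma comm_group_cong:
  assumes "comm_group G" "carrier H = carrier G" "monoid.mult H = monoid.mult G" "monoid.one H = monoid.one G"
  shows "comm_group H"
proof -
  interpret comm_group G by fact
  show ?thesis
    using assms(2-4) by (intro comm_groupI) (auto simp: m_ac intro: l_inv_ex)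
qed

lemma same_abelian_group:
  assumes "same_rmodule M M'" "abelian_group M"
  shows "abelian_group M'"
  using assms(1)
  by (intro comm_group_abelian_groupI comm_group_cong[OF abelian_group.a_comm_group[OF assms(2)]])
    (auto simp: same_rmodule_def)

lemma same_right_module:
  assumes "same_rmodule M M'" "right_module A M"
  shows "right_module A M'"
proof -
  interpret right_module A M by fact
  show ?thesis
    using assms(1) rsmult_closed rsmult_l_distr rsmult_r_distr rsmult_assoc rsmult_one
    by (intro right_module.intro same_abelian_group[OF assms(1)] right_module_axioms.intro
        A.ring_axioms M.abelian_group_axioms) (auto simp: same_rmodule_def)
qed

text \<open>\<open>left_flat\<close> tests records without further fields, whereas the modules of
  interest are comodules. \<open>rmodule.truncate\<close> drops the extra fields and leaves the
  tensor products unchanged.\<close>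

lemma left_flat_inj:
  fixes A :: "('a, 'k) ring_scheme" and L :: "('a, 'u, 'x) rmodule_scheme"
    and L' :: "('a, 'u, 'y) rmodule_scheme"
  assumes "left_flat TYPE('u) A N" "right_module A L" "right_module A L'"
    "j \<in> rmodule_hom A L L'" "inj_on j (carrier L)"
  shows "inj_on (tensor_map A L N L' N j (\<lambda>y. y)) (carrier (tensor_group A L N))"
proof -
  have L: "same_rmodule L (rmodule.truncate L)" "same_rmodule L' (rmodule.truncate L')"
    by (simp_all add: same_rmodule_def rmodule.truncate_def)
  have "j \<in> rmodule_hom A (rmodule.truncate L) (rmodule.truncate L')"
    using assms(4) same_rmodule_hom[OF L] by blast
  moreover have "inj_on j (carrier (rmodule.truncate L))"
    using assms(5) L(1) by (simp add: same_rmodule_def)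
  ultimately have "inj_on (tensor_map A (rmodule.truncate L) N (rmodule.truncate L') N j (\<lambda>y. y))
      (carrier (tensor_group A (rmodule.truncate L) N))"
    using assms(1) same_right_module[OF L(1) assms(2)] same_right_module[OF L(2) assms(3)]
    unfolding left_flat_def by blast
  then show ?thesis
    using same_tensor_map[OF L] same_tensor(1)[OF L(1)] by metis
qed

subsection \<open>Module structures on tensor products\<close>

lemma tensor_rmodule_simps [simp]:
  "carrier (tensor_rmodule A M N) = carrier (tensor_group A M N)"
  "ring.add (tensor_rmodule A M N) = monoid.mult (tensor_group A M N)"
  "ring.zero (tensor_rmodule A M N) = monoid.one (tensor_group A M N)"
  by (simp_all add: tensor_rmodule_def)

lemma tensor_bimodule_simps [simp]:
  "carrier (tensor_bimodule A M N) = carrier (tensor_group A M N)"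
  "ring.add (tensor_bimodule A M N) = monoid.mult (tensor_group A M N)"
  "ring.zero (tensor_bimodule A M N) = monoid.one (tensor_group A M N)"
  by (simp_all add: tensor_bimodule_def)

lemma abelian_group_tensor_rmodule:
  assumes "tensor_factors A M N"
  shows "abelian_group (tensor_rmodule A M N)"
  by (auto intro!: comm_group_abelian_groupI comm_group_cong[OF tensor_factors.tensor_comm_group[OF assms]])

lemma abelian_group_tensor_bimodule:
  assumes "tensor_factors A M N"
  shows "abelian_group (tensor_bimodule A M N)"
  by (auto intro!: comm_group_abelian_groupI comm_group_cong[OF tensor_factors.tensor_comm_group[OF assms]])

text \<open>Compatibility with the balancing relation is the bimodule law (b y) a = b (y a) of the
  second factor.\<close>

lemma rsmult_balanced:
  assumes "right_module A M" "bimodule A N" "a \<in> carrier A"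
  shows "balanced A M N (tensor_group A M N) (\<lambda>x y. pure_tensor A M N x (y \<triangleleft>\<^bsub>N\<^esub> a))"
proof -
  interpret N: bimodule A N by fact
  interpret T: tensor_factors A M N by (rule tensor_factorsI) fact+
  show ?thesis
    using assms(3)
    by (intro balancedI)
      (auto simp: N.rsmult_closed T.pure_closed T.pure_add_left T.pure_add_right N.rsmult_l_distr
        T.pure_balanced N.lsmult_rsmult)
qed

lemma tensor_rsmult_hom:
  assumes "right_module A M" "bimodule A N" "a \<in> carrier A"
  shows "(\<lambda>t. t \<triangleleft>\<^bsub>tensor_rmodule A M N\<^esub> a) \<in> hom (tensor_group A M N) (tensor_group A M N)"
proof -
  interpret T: tensor_factors A M N by (rule tensor_factorsI) fact+
  show ?thesis
    using T.lift_hom[OF T.tensor_comm_group rsmult_balanced[OF assms]]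
    by (simp add: tensor_rmodule_def)
qed

lemma tensor_rsmult_pure:
  assumes "right_module A M" "bimodule A N" "a \<in> carrier A" "x \<in> carrier M" "y \<in> carrier N"
  shows "pure_tensor A M N x y \<triangleleft>\<^bsub>tensor_rmodule A M N\<^esub> a = pure_tensor A M N x (y \<triangleleft>\<^bsub>N\<^esub> a)"
proof -
  interpret T: tensor_factors A M N by (rule tensor_factorsI) fact+
  show ?thesis
    using T.lift_pure[OF T.tensor_comm_group rsmult_balanced[OF assms(1-3)] assms(4,5)]
    by (simp add: tensor_rmodule_def)
qed

text \<open>Each law compares two homomorphisms in the tensor variable, so it is inherited through
  pure tensors from the right action on N.\<close>

lemma right_module_tensor:
  assumes M: "right_module A M" and N: "bimodule A N"
  shows "right_module A (tensor_rmodule A M N)"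
proof -
  interpret N: bimodule A N by fact
  interpret T: tensor_factors A M N by (rule tensor_factorsI) fact+
  let ?T = "tensor_rmodule A M N"
  note h = tensor_rsmult_hom[OF M N]
  note p = tensor_rsmult_pure[OF M N]
  have i: "(\<lambda>t. t) \<in> hom (tensor_group A M N) (tensor_group A M N)" by (simp add: hom_def)
  show ?thesis
  proof (intro right_module.intro right_module_axioms.intro)
    show "ring A" by (rule N.A.ring_axioms)
    show "abelian_group ?T" by (rule abelian_group_tensor_rmodule[OF T.tensor_factors_axioms])
  next
    fix x a assume "x \<in> carrier ?T" "a \<in> carrier A"
    then show "x \<triangleleft>\<^bsub>?T\<^esub> a \<in> carrier ?T" using hom_in_carrier[OF h] by simp
  next
    fix x y a assume "x \<in> carrier ?T" "y \<in> carrier ?T" "a \<in> carrier A"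
    then show "(x \<oplus>\<^bsub>?T\<^esub> y) \<triangleleft>\<^bsub>?T\<^esub> a = x \<triangleleft>\<^bsub>?T\<^esub> a \<oplus>\<^bsub>?T\<^esub> y \<triangleleft>\<^bsub>?T\<^esub> a"
      using hom_mult[OF h] by simp
  next
    fix x a b assume x: "x \<in> carrier ?T" and a: "a \<in> carrier A" and b: "b \<in> carrier A"
    have ab: "a \<oplus>\<^bsub>A\<^esub> b \<in> carrier A" using a b by simp
    note cl = hom_in_carrier[OF h[OF a]] hom_in_carrier[OF h[OF b]]
    have hh: "(\<lambda>t. (t \<triangleleft>\<^bsub>?T\<^esub> a) \<otimes>\<^bsub>tensor_group A M N\<^esub> (t \<triangleleft>\<^bsub>?T\<^esub> b)) \<in> hom (tensor_group A M N) (tensor_group A M N)"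
      using cl hom_mult[OF h[OF a]] hom_mult[OF h[OF b]]
      by (intro homI) (auto simp: T.T.m_ac)
    have "x \<triangleleft>\<^bsub>?T\<^esub> (a \<oplus>\<^bsub>A\<^esub> b) = (x \<triangleleft>\<^bsub>?T\<^esub> a) \<otimes>\<^bsub>tensor_group A M N\<^esub> (x \<triangleleft>\<^bsub>?T\<^esub> b)"
      by (rule T.tensor_hom_eq[OF h[OF ab] hh T.T.is_group])
        (use x a b in \<open>auto simp: p N.rsmult_r_distr T.pure_add_right N.rsmult_closed\<close>)
    then show "x \<triangleleft>\<^bsub>?T\<^esub> (a \<oplus>\<^bsub>A\<^esub> b) = x \<triangleleft>\<^bsub>?T\<^esub> a \<oplus>\<^bsub>?T\<^esub> x \<triangleleft>\<^bsub>?T\<^esub> b" by simp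
    have "x \<triangleleft>\<^bsub>?T\<^esub> (a \<otimes>\<^bsub>A\<^esub> b) = ((\<lambda>t. t \<triangleleft>\<^bsub>?T\<^esub> b) \<circ> (\<lambda>t. t \<triangleleft>\<^bsub>?T\<^esub> a)) x"
      by (rule T.tensor_hom_eq[OF h hom_compose[OF h[OF a] h[OF b]] T.T.is_group])
        (use x a b in \<open>auto simp: p N.rsmult_assoc N.rsmult_closed\<close>)
    then show "x \<triangleleft>\<^bsub>?T\<^esub> (a \<otimes>\<^bsub>A\<^esub> b) = (x \<triangleleft>\<^bsub>?T\<^esub> a) \<triangleleft>\<^bsub>?T\<^esub> b" by simp
  next
    fix x assume "x \<in> carrier ?T"
    then show "x \<triangleleft>\<^bsub>?T\<^esub> \<one>\<^bsub>A\<^esub> = x"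
      by (intro T.tensor_hom_eq[OF h i T.T.is_group, of "\<one>\<^bsub>A\<^esub>" x]) (auto simp: p N.rsmult_one)
  qed
qed

text \<open>Right linearity admits f \<otimes> N as a test map for flatness, so that injectivity
  survives a second tensoring with the coring.\<close>

lemma tensor_map_rmodule_hom:
  assumes M: "right_module A M" and M': "right_module A M'" and N: "bimodule A N"
    and f: "f \<in> rmodule_hom A M M'"
  shows "tensor_map A M N M' N f (\<lambda>y. y) \<in> rmodule_hom A (tensor_rmodule A M N) (tensor_rmodule A M' N)"
proof -
  interpret N: bimodule A N by fact
  have T: "tensor_factors A M N" and T': "tensor_factors A M' N"
    using M M' N by (auto intro: tensor_factorsI)
  interpret T: tensor_factors A M N by fact
  interpret T': tensor_factors A M' N by fact
  let ?F = "tensor_map A M N M' N f (\<lambda>y. y)"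
  note F = tensor_map_hom[OF T T' f id_lmodule_hom]
  note P = tensor_map_pure[OF T T' f id_lmodule_hom]
  have "?F (t \<triangleleft>\<^bsub>tensor_rmodule A M N\<^esub> a) = ?F t \<triangleleft>\<^bsub>tensor_rmodule A M' N\<^esub> a"
    if t: "t \<in> carrier (tensor_group A M N)" and a: "a \<in> carrier A" for t a
  proof -
    have "(?F \<circ> (\<lambda>t. t \<triangleleft>\<^bsub>tensor_rmodule A M N\<^esub> a)) t = ((\<lambda>t. t \<triangleleft>\<^bsub>tensor_rmodule A M' N\<^esub> a) \<circ> ?F) t"
      by (rule T.tensor_hom_eq[OF hom_compose[OF tensor_rsmult_hom[OF M N a] F]
            hom_compose[OF F tensor_rsmult_hom[OF M' N a]] T'.T.is_group])
        (use a t in \<open>auto simp: P tensor_rsmult_pure[OF M N] tensor_rsmult_pure[OF M' N] N.rsmult_closed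
          rmodule_homD(2)[OF f]\<close>)
    then show ?thesis by simp
  qed
  then show ?thesis using F by (simp add: rmodule_hom_def hom_def)
qed

lemma lsmult_balanced:
  assumes "bimodule A N" "bimodule A P" "a \<in> carrier A"
  shows "balanced A N P (tensor_group A N P) (\<lambda>x y. pure_tensor A N P (a \<triangleright>\<^bsub>N\<^esub> x) y)"
proof -
  interpret N: bimodule A N by fact
  interpret T: tensor_factors A N P using assms by (intro tensor_factorsI bimodule_right_module)
  show ?thesis
    using assms(3)
    by (intro balancedI)
      (auto simp: N.lsmult_closed T.pure_closed T.pure_add_left T.pure_add_right N.lsmult_r_distr
        T.pure_balanced[symmetric] N.lsmult_rsmult)
qed

lemma tensor_lsmult_hom:
  assumes "bimodule A N" "bimodule A P" "a \<in> carrier A"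
  shows "(\<lambda>t. a \<triangleright>\<^bsub>tensor_bimodule A N P\<^esub> t) \<in> hom (tensor_group A N P) (tensor_group A N P)"
proof -
  interpret T: tensor_factors A N P using assms by (intro tensor_factorsI bimodule_right_module)
  show ?thesis
    using T.lift_hom[OF T.tensor_comm_group lsmult_balanced[OF assms]]
    by (simp add: tensor_bimodule_def)
qed

lemma tensor_lsmult_pure:
  assumes "bimodule A N" "bimodule A P" "a \<in> carrier A" "x \<in> carrier N" "y \<in> carrier P"
  shows "a \<triangleright>\<^bsub>tensor_bimodule A N P\<^esub> pure_tensor A N P x y = pure_tensor A N P (a \<triangleright>\<^bsub>N\<^esub> x) y"
proof -
  interpret T: tensor_factors A N P using assms by (intro tensor_factorsI bimodule_right_module)
  show ?thesis
    using T.lift_pure[OF T.tensor_comm_group lsmult_balanced[OF assms(1-3)] assms(4,5)]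
    by (simp add: tensor_bimodule_def)
qed

text \<open>Closure of the left action on N \<otimes> P and its additive group are all that the
  second factor has to supply; they make M \<otimes> (N \<otimes> P) available as a tensor
  product.\<close>

lemma tensor_factors_bimodule:
  assumes "right_module A M" "bimodule A N" "bimodule A P"
  shows "tensor_factors A M (tensor_bimodule A N P)"
proof -
  interpret M: right_module A M by fact
  have NP: "tensor_factors A N P" using assms by (intro tensor_factorsI bimodule_right_module)
  show ?thesis
    using assms(2,3)
    by (intro tensor_factors.intro tensor_factors_axioms.intro M.M.abelian_group_axioms
        abelian_group_tensor_bimodule[OF NP] M.rsmult_closed)
      (auto intro: hom_in_carrier[OF tensor_lsmult_hom])
qed

subsection \<open>Associativity and unit\<close>

text \<open>Generators are reached in two stages: pure tensors s \<otimes> z suffice, and for fixed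
  z the map sending s to s \<otimes> z is a homomorphism, so s may be taken pure as well.\<close>

lemma tensor3_hom_eq:
  assumes M: "right_module A M" and N: "bimodule A N" and P: "bimodule A P"
    and h: "h \<in> hom (tensor_group A (tensor_rmodule A M N) P) G"
    and k: "k \<in> hom (tensor_group A (tensor_rmodule A M N) P) G" and G: "group G"
    and eq: "\<And>x y z. \<lbrakk>x \<in> carrier M; y \<in> carrier N; z \<in> carrier P\<rbrakk>
      \<Longrightarrow> h (pure_tensor A (tensor_rmodule A M N) P (pure_tensor A M N x y) z) =
        k (pure_tensor A (tensor_rmodule A M N) P (pure_tensor A M N x y) z)"
    and t: "t \<in> carrier (tensor_group A (tensor_rmodule A M N) P)"
  shows "h t = k t"
proof -
  have T: "tensor_factors A M N" by (intro tensor_factorsI M N)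
  interpret T2: tensor_factors A "tensor_rmodule A M N" P
    by (intro tensor_factorsI right_module_tensor M N P)
  show ?thesis
  proof (rule T2.tensor_hom_eq[OF h k G _ t])
    fix s z assume s: "s \<in> carrier (tensor_rmodule A M N)" and z: "z \<in> carrier P"
    let ?p = "\<lambda>s. pure_tensor A (tensor_rmodule A M N) P s z"
    have p: "?p \<in> hom (tensor_group A M N) (tensor_group A (tensor_rmodule A M N) P)"
      using T2.pure_closed[OF _ z] T2.pure_add_left[OF _ _ z] by (intro homI) auto
    have "(h \<circ> ?p) s = (k \<circ> ?p) s"
      by (rule tensor_factors.tensor_hom_eq[OF T hom_compose[OF p h] hom_compose[OF p k] G])
        (use s z eq in auto)
    then show "h (?p s) = k (?p s)" by simp
  qed
qed

section \<open>The associativity isomorphism\<close>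

context
  fixes A :: "('a, 'k) ring_scheme" and M :: "('a, 'm, 'x) rmodule_scheme"
    and N :: "('a, 'n, 'y) bimodule_scheme" and P :: "('a, 'p, 'z) bimodule_scheme"
  assumes M: "right_module A M" and N: "bimodule A N" and P: "bimodule A P"
begin

interpretation M: right_module A M by (rule M)
interpretation N: bimodule A N by (rule N)
interpretation P: bimodule A P by (rule P)
interpretation MN: tensor_factors A M N by (intro tensor_factorsI M N)
interpretation NP: tensor_factors A N P by (intro tensor_factorsI bimodule_right_module N P)
interpretation L: tensor_factors A "tensor_rmodule A M N" P
  by (intro tensor_factorsI right_module_tensor M N P)
interpretation R: tensor_factors A M "tensor_bimodule A N P"
  by (intro tensor_factors_bimodule M N P)

private abbreviation "LG \<equiv> tensor_group A (tensor_rmodule A M N) P"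
private abbreviation "RG \<equiv> tensor_group A M (tensor_bimodule A N P)"
private abbreviation "lp x y z \<equiv> pure_tensor A (tensor_rmodule A M N) P (pure_tensor A M N x y) z"
private abbreviation "rp x y z \<equiv> pure_tensor A M (tensor_bimodule A N P) x (pure_tensor A N P y z)"

private lemma pure_NP:
  "\<lbrakk>y \<in> carrier N; z \<in> carrier P\<rbrakk> \<Longrightarrow> pure_tensor A N P y z \<in> carrier (tensor_bimodule A N P)"
  using NP.pure_closed by simp

private lemma pure_MN:
  "\<lbrakk>x \<in> carrier M; y \<in> carrier N\<rbrakk> \<Longrightarrow> pure_tensor A M N x y \<in> carrier (tensor_rmodule A M N)"
  using MN.pure_closed by simp

text \<open>For fixed z this is the inner of the two lifts that make up \<open>tensor_assoc\<close>.
  A scalar passes from x to y because the left action on N \<otimes> P acts on its first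
  factor.\<close>

private lemma inner_balanced:
  assumes z: "z \<in> carrier P"
  shows "balanced A M N RG (\<lambda>x y. rp x y z)"
proof (rule balancedI)
  fix x y y' assume "x \<in> carrier M" "y \<in> carrier N" "y' \<in> carrier N"
  then show "rp x (y \<oplus>\<^bsub>N\<^esub> y') z = rp x y z \<otimes>\<^bsub>RG\<^esub> rp x y' z"
    using R.pure_add_right[OF _ pure_NP[OF _ z] pure_NP[OF _ z]] NP.pure_add_left[OF _ _ z] by simp
next
  fix x a y assume *: "x \<in> carrier M" "a \<in> carrier A" "y \<in> carrier N"
  show "rp (x \<triangleleft>\<^bsub>M\<^esub> a) y z = rp x (a \<triangleright>\<^bsub>N\<^esub> y) z"
    using R.pure_balanced[OF *(1,2) pure_NP[OF *(3) z]] tensor_lsmult_pure[OF N P *(2,3) z] by simp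
qed (intro R.pure_closed R.pure_add_left pure_NP z; assumption)+

private lemma inner_hom:
  assumes "z \<in> carrier P"
  shows "tensor_lift A M N RG (\<lambda>x y. rp x y z) \<in> hom (tensor_group A M N) RG"
  by (rule MN.lift_hom[OF R.tensor_comm_group inner_balanced[OF assms]])

private lemma inner_pure:
  assumes "z \<in> carrier P" "x \<in> carrier M" "y \<in> carrier N"
  shows "tensor_lift A M N RG (\<lambda>x y. rp x y z) (pure_tensor A M N x y) = rp x y z"
  by (rule MN.lift_pure[OF R.tensor_comm_group inner_balanced[OF assms(1)] assms(2,3)])

text \<open>The inner lift is a homomorphism in t, which settles additivity in t. The conditions
  that change z compare two homomorphisms in t on pure tensors; there the scalar passes from y to z
  by the balancing relation of N \<otimes> P.\<close>

private lemma outer_balanced: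
  "balanced A (tensor_rmodule A M N) P RG (\<lambda>t z. tensor_lift A M N RG (\<lambda>x y. rp x y z) t)"
proof (rule balancedI)
  let ?h = "\<lambda>z. tensor_lift A M N RG (\<lambda>x y. rp x y z)"
  fix t assume "t \<in> carrier (tensor_rmodule A M N)"
  then have t: "t \<in> carrier (tensor_group A M N)" by simp
  fix z assume z: "z \<in> carrier P"
  show "?h z t \<in> carrier RG" by (rule hom_in_carrier[OF inner_hom[OF z] t])
  show "?h z (t \<oplus>\<^bsub>tensor_rmodule A M N\<^esub> t') = ?h z t \<otimes>\<^bsub>RG\<^esub> ?h z t'"
    if "t' \<in> carrier (tensor_rmodule A M N)" for t'
    using that hom_mult[OF inner_hom[OF z] t] by simp
  show "?h (z \<oplus>\<^bsub>P\<^esub> z') t = ?h z t \<otimes>\<^bsub>RG\<^esub> ?h z' t" if z': "z' \<in> carrier P" for z'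
  proof -
    have zz: "z \<oplus>\<^bsub>P\<^esub> z' \<in> carrier P" using z z' by simp
    have hh: "(\<lambda>t. ?h z t \<otimes>\<^bsub>RG\<^esub> ?h z' t) \<in> hom (tensor_group A M N) RG"
      using hom_in_carrier[OF inner_hom[OF z]] hom_in_carrier[OF inner_hom[OF z']]
        hom_mult[OF inner_hom[OF z]] hom_mult[OF inner_hom[OF z']]
      by (intro homI) (auto simp: R.T.m_ac)
    show ?thesis
    proof (rule MN.tensor_hom_eq[OF inner_hom[OF zz] hh R.T.is_group _ t])
      fix x y assume x: "x \<in> carrier M" and y: "y \<in> carrier N"
      show "?h (z \<oplus>\<^bsub>P\<^esub> z') (pure_tensor A M N x y) =
          ?h z (pure_tensor A M N x y) \<otimes>\<^bsub>RG\<^esub> ?h z' (pure_tensor A M N x y)"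
        using inner_pure[OF zz x y] inner_pure[OF z x y] inner_pure[OF z' x y]
          R.pure_add_right[OF x pure_NP[OF y z] pure_NP[OF y z']] NP.pure_add_right[OF y z z'] by simp
    qed
  qed
  show "?h z (t \<triangleleft>\<^bsub>tensor_rmodule A M N\<^esub> a) = ?h (a \<triangleright>\<^bsub>P\<^esub> z) t" if a: "a \<in> carrier A" for a
  proof -
    have az: "a \<triangleright>\<^bsub>P\<^esub> z \<in> carrier P" using a z P.lsmult_closed by simp
    have "(?h z \<circ> (\<lambda>t. t \<triangleleft>\<^bsub>tensor_rmodule A M N\<^esub> a)) t = ?h (a \<triangleright>\<^bsub>P\<^esub> z) t"
    proof (rule MN.tensor_hom_eq[OF hom_compose[OF tensor_rsmult_hom[OF M N a] inner_hom[OF z]]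
            inner_hom[OF az] R.T.is_group _ t])
      fix x y assume x: "x \<in> carrier M" and y: "y \<in> carrier N"
      show "(?h z \<circ> (\<lambda>t. t \<triangleleft>\<^bsub>tensor_rmodule A M N\<^esub> a)) (pure_tensor A M N x y) =
          ?h (a \<triangleright>\<^bsub>P\<^esub> z) (pure_tensor A M N x y)"
        using inner_pure[OF z x N.rsmult_closed[OF y a]] inner_pure[OF az x y]
          tensor_rsmult_pure[OF M N a x y] NP.pure_balanced[OF y a z] by simp
    qed
    then show ?thesis by simp
  qed
qed

lemma tensor_assoc_hom: "tensor_assoc A M N P \<in> hom LG RG"
  unfolding tensor_assoc_def Let_def by (rule L.lift_hom[OF R.tensor_comm_group outer_balanced])

lemma tensor_assoc_pure:
  assumes "x \<in> carrier M" "y \<in> carrier N" "z \<in> carrier P"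
  shows "tensor_assoc A M N P (lp x y z) = rp x y z"
  unfolding tensor_assoc_def Let_def
  using L.lift_pure[OF R.tensor_comm_group outer_balanced pure_MN[OF assms(1,2)] assms(3)]
    inner_pure[OF assms(3,1,2)] by simp

text \<open>Mirror image for the inverse direction: x is now fixed and the pair y, z varies.\<close>

private lemma inner_balanced':
  assumes x: "x \<in> carrier M"
  shows "balanced A N P LG (\<lambda>y z. lp x y z)"
proof (rule balancedI)
  fix y y' z assume "y \<in> carrier N" "y' \<in> carrier N" "z \<in> carrier P"
  then show "lp x (y \<oplus>\<^bsub>N\<^esub> y') z = lp x y z \<otimes>\<^bsub>LG\<^esub> lp x y' z"
    using L.pure_add_left[OF pure_MN[OF x] pure_MN[OF x]] MN.pure_add_right[OF x] by simp
next
  fix y a z assume *: "y \<in> carrier N" "a \<in> carrier A" "z \<in> carrier P"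
  show "lp x (y \<triangleleft>\<^bsub>N\<^esub> a) z = lp x y (a \<triangleright>\<^bsub>P\<^esub> z)"
    using L.pure_balanced[OF pure_MN[OF x *(1)] *(2,3)] tensor_rsmult_pure[OF M N *(2) x *(1)] by simp
qed (intro L.pure_closed L.pure_add_right pure_MN x; assumption)+

private lemma inner_hom':
  assumes "x \<in> carrier M"
  shows "tensor_lift A N P LG (\<lambda>y z. lp x y z) \<in> hom (tensor_group A N P) LG"
  by (rule NP.lift_hom[OF L.tensor_comm_group inner_balanced'[OF assms]])

private lemma inner_pure':
  assumes "x \<in> carrier M" "y \<in> carrier N" "z \<in> carrier P"
  shows "tensor_lift A N P LG (\<lambda>y z. lp x y z) (pure_tensor A N P y z) = lp x y z"
  by (rule NP.lift_pure[OF L.tensor_comm_group inner_balanced'[OF assms(1)] assms(2,3)])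

private lemma outer_balanced':
  "balanced A M (tensor_bimodule A N P) LG (\<lambda>x t. tensor_lift A N P LG (\<lambda>y z. lp x y z) t)"
proof (rule balancedI)
  let ?h = "\<lambda>x. tensor_lift A N P LG (\<lambda>y z. lp x y z)"
  fix t assume "t \<in> carrier (tensor_bimodule A N P)"
  then have t: "t \<in> carrier (tensor_group A N P)" by simp
  fix x assume x: "x \<in> carrier M"
  show "?h x t \<in> carrier LG" by (rule hom_in_carrier[OF inner_hom'[OF x] t])
  show "?h x (t \<oplus>\<^bsub>tensor_bimodule A N P\<^esub> t') = ?h x t \<otimes>\<^bsub>LG\<^esub> ?h x t'"
    if "t' \<in> carrier (tensor_bimodule A N P)" for t'
    using that hom_mult[OF inner_hom'[OF x] t] by simp
  show "?h (x \<oplus>\<^bsub>M\<^esub> x') t = ?h x t \<otimes>\<^bsub>LG\<^esub> ?h x' t" if x': "x' \<in> carrier M" for x'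
  proof -
    have xx: "x \<oplus>\<^bsub>M\<^esub> x' \<in> carrier M" using x x' by simp
    have hh: "(\<lambda>t. ?h x t \<otimes>\<^bsub>LG\<^esub> ?h x' t) \<in> hom (tensor_group A N P) LG"
      using hom_in_carrier[OF inner_hom'[OF x]] hom_in_carrier[OF inner_hom'[OF x']]
        hom_mult[OF inner_hom'[OF x]] hom_mult[OF inner_hom'[OF x']]
      by (intro homI) (auto simp: L.T.m_ac)
    show ?thesis
    proof (rule NP.tensor_hom_eq[OF inner_hom'[OF xx] hh L.T.is_group _ t])
      fix y z assume y: "y \<in> carrier N" and z: "z \<in> carrier P"
      show "?h (x \<oplus>\<^bsub>M\<^esub> x') (pure_tensor A N P y z) =
          ?h x (pure_tensor A N P y z) \<otimes>\<^bsub>LG\<^esub> ?h x' (pure_tensor A N P y z)"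
        using inner_pure'[OF xx y z] inner_pure'[OF x y z] inner_pure'[OF x' y z]
          L.pure_add_left[OF pure_MN[OF x y] pure_MN[OF x' y] z] MN.pure_add_left[OF x x' y] by simp
    qed
  qed
  show "?h (x \<triangleleft>\<^bsub>M\<^esub> a) t = ?h x (a \<triangleright>\<^bsub>tensor_bimodule A N P\<^esub> t)" if a: "a \<in> carrier A" for a
  proof -
    have xa: "x \<triangleleft>\<^bsub>M\<^esub> a \<in> carrier M" using a x M.rsmult_closed by simp
    have "?h (x \<triangleleft>\<^bsub>M\<^esub> a) t = (?h x \<circ> (\<lambda>t. a \<triangleright>\<^bsub>tensor_bimodule A N P\<^esub> t)) t"
    proof (rule NP.tensor_hom_eq[OF inner_hom'[OF xa]
            hom_compose[OF tensor_lsmult_hom[OF N P a] inner_hom'[OF x]] L.T.is_group _ t])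
      fix y z assume y: "y \<in> carrier N" and z: "z \<in> carrier P"
      show "?h (x \<triangleleft>\<^bsub>M\<^esub> a) (pure_tensor A N P y z) =
          (?h x \<circ> (\<lambda>t. a \<triangleright>\<^bsub>tensor_bimodule A N P\<^esub> t)) (pure_tensor A N P y z)"
        using inner_pure'[OF x N.lsmult_closed[OF a y] z] inner_pure'[OF xa y z]
          tensor_lsmult_pure[OF N P a y z] MN.pure_balanced[OF x a y] by simp
    qed
    then show ?thesis by simp
  qed
qed

text \<open>A left inverse suffices: \<open>?D\<close> sends x \<otimes> (y \<otimes> z) to (x
  \<otimes> y) \<otimes> z, and the composite is the identity on the triple tensors that
  generate.\<close>

lemma tensor_assoc_inj: "inj_on (tensor_assoc A M N P) (carrier LG)"
proof (rule inj_on_inverseI)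
  let ?D = "tensor_lift A M (tensor_bimodule A N P) LG (\<lambda>x t. tensor_lift A N P LG (\<lambda>y z. lp x y z) t)"
  have D: "?D \<in> hom RG LG" by (rule R.lift_hom[OF L.tensor_comm_group outer_balanced'])
  have i: "(\<lambda>t. t) \<in> hom LG LG" by (simp add: hom_def)
  fix t assume t: "t \<in> carrier LG"
  have "(?D \<circ> tensor_assoc A M N P) t = t"
  proof (rule tensor3_hom_eq[OF M N P hom_compose[OF tensor_assoc_hom D] i L.T.is_group _ t])
    fix x y z assume x: "x \<in> carrier M" and y: "y \<in> carrier N" and z: "z \<in> carrier P"
    show "(?D \<circ> tensor_assoc A M N P) (lp x y z) = lp x y z"
      using tensor_assoc_pure[OF x y z] inner_pure'[OF x y z]
        R.lift_pure[OF L.tensor_comm_group outer_balanced' x pure_NP[OF y z]] by simp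
  qed
  then show "?D (tensor_assoc A M N P t) = t" by simp
qed

text \<open>The image is a subgroup, so it is enough to reach x \<otimes> s; this is additive in s
  for fixed x, and s is in turn built from tensors y \<otimes> z. Surjectivity serves to rewrite
  elements of K \<otimes> (C \<otimes> C) as images of elements of (K \<otimes> C) \<otimes>
  C.\<close>

lemma tensor_assoc_surj: "tensor_assoc A M N P ` carrier LG = carrier RG"
proof
  interpret a: group_hom LG RG "tensor_assoc A M N P"
    by unfold_locales (rule tensor_assoc_hom)
  show "tensor_assoc A M N P ` carrier LG \<subseteq> carrier RG" using a.hom_closed by blast
  let ?I = "tensor_assoc A M N P ` carrier LG"
  have sub: "subgroup ?I RG" by (rule a.img_is_subgroup)
  have pu: "pure_tensor A M (tensor_bimodule A N P) x s \<in> ?I"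
    if x: "x \<in> carrier M" and s: "s \<in> carrier (tensor_bimodule A N P)" for x s
  proof -
    let ?p = "pure_tensor A M (tensor_bimodule A N P) x"
    have "?p \<in> hom (tensor_group A N P) RG"
      using R.pure_closed[OF x] R.pure_add_right[OF x] by (intro homI) auto
    then interpret p: group_hom "tensor_group A N P" RG ?p by unfold_locales
    from s have "s \<in> carrier (tensor_group A N P)" by simp
    then show ?thesis
    proof (induction s rule: NP.tensor_induct)
      case one
      then show ?case using subgroup.one_closed[OF sub] p.hom_one by simp
    next
      case (pure y z)
      have "lp x y z \<in> carrier LG" using L.pure_closed[OF pure_MN[OF x pure(1)] pure(2)] .
      then show ?case using tensor_assoc_pure[OF x pure] by (metis image_eqI)
    next
      case (diff u v)
      then show ?case
        by (simp only: p.hom_mult p.hom_inv NP.T.inv_closed subgroup.m_closed[OF sub] subgroup.m_inv_closed[OF sub])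
    qed
  qed
  show "carrier RG \<subseteq> ?I"
  proof
    fix t assume "t \<in> carrier RG"
    then show "t \<in> ?I"
    proof (induction t rule: R.tensor_induct)
      case one
      then show ?case by (rule subgroup.one_closed[OF sub])
    next
      case (pure x s)
      then show ?case by (rule pu)
    next
      case (diff u v)
      show ?case by (intro subgroup.m_closed[OF sub] subgroup.m_inv_closed[OF sub] diff(3,4))
    qed
  qed
qed

end

text \<open>Relating f \<otimes> (N \<otimes> P) to (f \<otimes> N) \<otimes> P, this square carries
  injectivity from iterated tensoring with C to tensoring with C \<otimes> C, and coassociativity
  from a comodule to its submodules.\<close>

lemma tensor_assoc_natural:
  assumes M: "right_module A M" and M': "right_module A M'" and N: "bimodule A N" and P: "bimodule A P"
    and f: "f \<in> rmodule_hom A M M'"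
    and t: "t \<in> carrier (tensor_group A (tensor_rmodule A M N) P)"
  shows "tensor_map A M (tensor_bimodule A N P) M' (tensor_bimodule A N P) f (\<lambda>y. y) (tensor_assoc A M N P t) =
    tensor_assoc A M' N P (tensor_map A (tensor_rmodule A M N) P (tensor_rmodule A M' N) P
      (tensor_map A M N M' N f (\<lambda>y. y)) (\<lambda>y. y) t)"
proof -
  interpret R': tensor_factors A M' "tensor_bimodule A N P"
    by (intro tensor_factors_bimodule M' N P)
  note MN = right_module_tensor[OF M N] and MN' = right_module_tensor[OF M' N]
  note tf = tensor_factorsI[OF M N] tensor_factorsI[OF M' N]
    tensor_factorsI[OF bimodule_right_module[OF N] P]
  note tfL = tensor_factorsI[OF MN P] tensor_factorsI[OF MN' P]
  note tfR = tensor_factors_bimodule[OF M N P] tensor_factors_bimodule[OF M' N P]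
  note ff = tensor_map_rmodule_hom[OF M M' N f]
  let ?l = "tensor_map A (tensor_rmodule A M N) P (tensor_rmodule A M' N) P
      (tensor_map A M N M' N f (\<lambda>y. y)) (\<lambda>y. y)"
  let ?r = "tensor_map A M (tensor_bimodule A N P) M' (tensor_bimodule A N P) f (\<lambda>y. y)"
  have "(?r \<circ> tensor_assoc A M N P) t = (tensor_assoc A M' N P \<circ> ?l) t"
  proof (rule tensor3_hom_eq[OF M N P
        hom_compose[OF tensor_assoc_hom[OF M N P] tensor_map_hom[OF tfR f id_lmodule_hom]]
        hom_compose[OF tensor_map_hom[OF tfL ff id_lmodule_hom] tensor_assoc_hom[OF M' N P]]
        R'.T.is_group _ t])
    fix x y z assume x: "x \<in> carrier M" and y: "y \<in> carrier N" and z: "z \<in> carrier P"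
    show "(?r \<circ> tensor_assoc A M N P) (pure_tensor A (tensor_rmodule A M N) P (pure_tensor A M N x y) z) =
        (tensor_assoc A M' N P \<circ> ?l) (pure_tensor A (tensor_rmodule A M N) P (pure_tensor A M N x y) z)"
      using x y z rmodule_homD(2)[OF f x] tensor_factors.pure_closed[OF tf(1) x y]
        tensor_factors.pure_closed[OF tf(3) y z]
      by (simp add: tensor_assoc_pure[OF M N P] tensor_assoc_pure[OF M' N P]
          tensor_map_pure[OF tfR f id_lmodule_hom] tensor_map_pure[OF tfL ff id_lmodule_hom]
          tensor_map_pure[OF tf(1,2) f id_lmodule_hom])
  qed
  then show ?thesis by simp
qed

lemma regular_bimodule:
  assumes "ring A"
  shows "bimodule A (regular_bimodule A)"
proof -
  interpret ring A by fact
  have ab: "abelian_group (regular_bimodule A)"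
    by (intro comm_group_abelian_groupI comm_group_cong[OF a_comm_group])
      (simp_all add: regular_bimodule_def)
  show ?thesis
    by (intro bimodule.intro right_module.intro right_module_axioms.intro bimodule_axioms.intro
        ab ring_axioms)
      (auto simp: regular_bimodule_def l_distr r_distr m_assoc)
qed

lemma runit_balanced:
  assumes "right_module A M"
  shows "balanced A M (regular_bimodule A) (add_monoid M) (\<lambda>x a. x \<triangleleft>\<^bsub>M\<^esub> a)"
proof -
  interpret right_module A M by fact
  show ?thesis
    by (rule balancedI) (simp_all add: regular_bimodule_def rsmult_closed rsmult_l_distr rsmult_r_distr rsmult_assoc)
qed

lemma tensor_runit_hom:
  assumes "right_module A M"
  shows "tensor_runit A M \<in> hom (tensor_group A M (regular_bimodule A)) (add_monoid M)"
proof -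
  interpret right_module A M by fact
  show ?thesis
    unfolding tensor_runit_def
    by (rule tensor_factors.lift_hom[OF tensor_factorsI[OF assms regular_bimodule[OF A.ring_axioms]]
          M.a_comm_group runit_balanced[OF assms]])
qed

lemma tensor_runit_pure:
  assumes "right_module A M" "x \<in> carrier M" "a \<in> carrier A"
  shows "tensor_runit A M (pure_tensor A M (regular_bimodule A) x a) = x \<triangleleft>\<^bsub>M\<^esub> a"
proof -
  interpret right_module A M by fact
  show ?thesis
    unfolding tensor_runit_def
    using tensor_factors.lift_pure[OF tensor_factorsI[OF assms(1) regular_bimodule[OF A.ring_axioms]]
          M.a_comm_group runit_balanced[OF assms(1)], of x a] assms
    by (simp add: regular_bimodule_def)
qed

text \<open>With f the inclusion of a submodule, the counit law of the submodule becomes that of the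
  ambient comodule.\<close>

lemma tensor_runit_natural:
  assumes M: "right_module A M" and M': "right_module A M'" and f: "f \<in> rmodule_hom A M M'"
    and t: "t \<in> carrier (tensor_group A M (regular_bimodule A))"
  shows "f (tensor_runit A M t) = tensor_runit A M'
    (tensor_map A M (regular_bimodule A) M' (regular_bimodule A) f (\<lambda>y. y) t)"
proof -
  interpret M': right_module A M' by fact
  note reg = regular_bimodule[OF M'.A.ring_axioms]
  note tf = tensor_factorsI[OF M reg] tensor_factorsI[OF M' reg]
  let ?F = "tensor_map A M (regular_bimodule A) M' (regular_bimodule A) f (\<lambda>y. y)"
  have "(f \<circ> tensor_runit A M) t = (tensor_runit A M' \<circ> ?F) t"
  proof (rule tensor_factors.tensor_hom_eq[OF tf(1) hom_compose[OF tensor_runit_hom[OF M] rmodule_homD(1)[OF f]]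
        hom_compose[OF tensor_map_hom[OF tf f id_lmodule_hom] tensor_runit_hom[OF M']] M'.M.a_group _ t])
    fix x a assume x: "x \<in> carrier M" and a: "a \<in> carrier (regular_bimodule A)"
    then have a': "a \<in> carrier A" by (simp add: regular_bimodule_def)
    show "(f \<circ> tensor_runit A M) (pure_tensor A M (regular_bimodule A) x a) =
        (tensor_runit A M' \<circ> ?F) (pure_tensor A M (regular_bimodule A) x a)"
      using x a a' by (simp add: tensor_runit_pure[OF M] tensor_runit_pure[OF M']
          tensor_map_pure[OF tf f id_lmodule_hom] rmodule_homD[OF f])
  qed
  then show ?thesis by simp
qed

section \<open>Element-wise primeness\<close>

context ring
begin

text \<open>The factor e between a and b makes the set two-sided: a e (x b) = a (e x) b.\<close>

lemma right_annihilator_ideal: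
  assumes a: "a \<in> carrier R"
  shows "ideal {b \<in> carrier R. \<forall>e\<in>carrier R. a \<otimes> e \<otimes> b = \<zero>} R"
proof (rule idealI[OF ring_axioms])
  show "subgroup {b \<in> carrier R. \<forall>e\<in>carrier R. a \<otimes> e \<otimes> b = \<zero>} (add_monoid R)"
    using a by (intro subgroup.intro) (auto simp: r_distr r_minus simp flip: a_inv_def)
next
  fix b x assume b: "b \<in> {b \<in> carrier R. \<forall>e\<in>carrier R. a \<otimes> e \<otimes> b = \<zero>}" and x: "x \<in> carrier R"
  have "a \<otimes> e \<otimes> (x \<otimes> b) = \<zero>" if e: "e \<in> carrier R" for e
  proof -
    have "a \<otimes> e \<otimes> (x \<otimes> b) = a \<otimes> (e \<otimes> x) \<otimes> b" using a b x e by (simp add: m_assoc)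
    then show ?thesis using b x e by simp
  qed
  then show "x \<otimes> b \<in> {b \<in> carrier R. \<forall>e\<in>carrier R. a \<otimes> e \<otimes> b = \<zero>}" using b x by simp
  have "a \<otimes> e \<otimes> (b \<otimes> x) = \<zero>" if e: "e \<in> carrier R" for e
  proof -
    have "a \<otimes> e \<otimes> (b \<otimes> x) = a \<otimes> e \<otimes> b \<otimes> x" using a b x e by (simp add: m_assoc)
    then show ?thesis using b x e by simp
  qed
  then show "b \<otimes> x \<in> {b \<in> carrier R. \<forall>e\<in>carrier R. a \<otimes> e \<otimes> b = \<zero>}" using b x by simp
qed

text \<open>Here e absorbs right multiplication, (a x) e b = a (x e) b. The set B will be a right
  annihilator of the previous kind.\<close>

lemma left_annihilator_ideal:
  assumes B: "B \<subseteq> carrier R"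
  shows "ideal {a \<in> carrier R. \<forall>b\<in>B. \<forall>e\<in>carrier R. a \<otimes> e \<otimes> b = \<zero>} R" (is "ideal ?I R")
proof (rule idealI[OF ring_axioms])
  show "subgroup ?I (add_monoid R)"
    using B by (intro subgroup.intro) (auto simp: l_distr l_minus subset_iff simp flip: a_inv_def)
next
  fix a x assume a: "a \<in> ?I" and x: "x \<in> carrier R"
  have "x \<otimes> a \<otimes> e \<otimes> b = \<zero>" if e: "e \<in> carrier R" and b: "b \<in> B" for e b
  proof -
    have bc: "b \<in> carrier R" using b B by blast
    have "x \<otimes> a \<otimes> e \<otimes> b = x \<otimes> (a \<otimes> e \<otimes> b)" using a bc x e by (simp add: m_assoc)
    then show ?thesis using a b x e by simp
  qed
  then show "x \<otimes> a \<in> ?I" using a x by simp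
  have "a \<otimes> x \<otimes> e \<otimes> b = \<zero>" if e: "e \<in> carrier R" and b: "b \<in> B" for e b
  proof -
    have bc: "b \<in> carrier R" using b B by blast
    have "a \<otimes> x \<otimes> e \<otimes> b = a \<otimes> (x \<otimes> e) \<otimes> b" using a bc x e by (simp add: m_assoc)
    then show ?thesis using a b x e by simp
  qed
  then show "a \<otimes> x \<in> ?I" using a x by simp
qed

text \<open>Annihilators replace the ideals generated by a and b, whose elements are finite sums: J
  is the set of y with a R y = 0, and I the set of x with x R J = 0. Then a lies in I, b lies in J,
  and I J = 0.\<close>

lemma prime_ringD:
  assumes "prime_ring R" "a \<in> carrier R" "b \<in> carrier R"
    and "\<And>e. e \<in> carrier R \<Longrightarrow> a \<otimes> e \<otimes> b = \<zero>"
  shows "a = \<zero> \<or> b = \<zero>"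
proof -
  define J where "J = {b \<in> carrier R. \<forall>e\<in>carrier R. a \<otimes> e \<otimes> b = \<zero>}"
  define I where "I = {a \<in> carrier R. \<forall>b\<in>J. \<forall>e\<in>carrier R. a \<otimes> e \<otimes> b = \<zero>}"
  have "ideal J R" unfolding J_def by (rule right_annihilator_ideal[OF assms(2)])
  moreover have "ideal I R" unfolding I_def by (rule left_annihilator_ideal) (auto simp: J_def)
  moreover have "x \<otimes> y = \<zero>" if "x \<in> I" "y \<in> J" for x y
  proof -
    \<comment> \<open>The middle factor of the annihilator condition is specialised to one.\<close>
    have "x \<otimes> \<one> \<otimes> y = \<zero>" using that unfolding I_def by blast
    then show ?thesis using that unfolding I_def by simp
  qed
  ultimately have "I = {\<zero>} \<or> J = {\<zero>}" using assms(1) unfolding prime_ring_def by blast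
  moreover have "b \<in> J" using assms unfolding J_def by simp
  moreover have "a \<in> I" using assms(2) unfolding I_def J_def by simp
  ultimately show ?thesis by blast
qed

text \<open>The same two annihilators are intersected: a lies in J by assumption and in I by the
  definition of J, and the square of the intersection is contained in I J = 0.\<close>

lemma semiprime_ringD:
  assumes "semiprime_ring R" "a \<in> carrier R"
    and "\<And>e. e \<in> carrier R \<Longrightarrow> a \<otimes> e \<otimes> a = \<zero>"
  shows "a = \<zero>"
proof -
  define J where "J = {b \<in> carrier R. \<forall>e\<in>carrier R. a \<otimes> e \<otimes> b = \<zero>}"
  define I where "I = {a \<in> carrier R. \<forall>b\<in>J. \<forall>e\<in>carrier R. a \<otimes> e \<otimes> b = \<zero>}"
  have "ideal (I \<inter> J) R"
    unfolding I_def
    by (rule i_intersect[OF left_annihilator_ideal])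
      (auto simp: J_def right_annihilator_ideal[OF assms(2)])
  moreover have "x \<otimes> y = \<zero>" if "x \<in> I \<inter> J" "y \<in> I \<inter> J" for x y
  proof -
    have "x \<otimes> \<one> \<otimes> y = \<zero>" using that unfolding I_def by blast
    then show ?thesis using that unfolding I_def by simp
  qed
  ultimately have "I \<inter> J = {\<zero>}" using assms(1) unfolding semiprime_ring_def by blast
  moreover have "a \<in> J" using assms unfolding J_def by simp
  moreover have "a \<in> I" using assms(2) unfolding I_def J_def by simp
  ultimately show ?thesis by blast
qed

lemma reduced_ringD:
  assumes "reduced_ring R" "a \<in> carrier R" "a \<otimes> a = \<zero>"
  shows "a = \<zero>"
proof -
  have "a [^] (2::nat) = \<zero>" using assms(2,3) by (simp add: numeral_2_eq_2)
  then show ?thesis using assms(1,2) unfolding reduced_ring_def by blast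
qed

end

section \<open>Subcomodules and quotients\<close>

lemma right_module_carrier_update:
  assumes M: "right_module A M" and K: "subgroup K (add_monoid M)"
    and act: "\<And>x a. \<lbrakk>x \<in> K; a \<in> carrier A\<rbrakk> \<Longrightarrow> x \<triangleleft>\<^bsub>M\<^esub> a \<in> K"
  shows "right_module A (M\<lparr>carrier := K\<rparr>)"
proof -
  interpret right_module A M by fact
  interpret K: subgroup K "add_monoid M" by fact
  have Kc: "x \<in> carrier M" if "x \<in> K" for x using K.subset that by auto
  have "abelian_group (M\<lparr>carrier := K\<rparr>)"
  proof (rule abelian_groupI)
    fix x assume "x \<in> carrier (M\<lparr>carrier := K\<rparr>)"
    then show "\<exists>y\<in>carrier (M\<lparr>carrier := K\<rparr>). y \<oplus>\<^bsub>M\<lparr>carrier := K\<rparr>\<^esub> x = \<zero>\<^bsub>M\<lparr>carrier := K\<rparr>\<^esub>"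
      using K.m_inv_closed[of x] M.l_neg[OF Kc, of x] by (auto simp: a_inv_def)
  qed (use K.m_closed K.one_closed Kc in \<open>auto simp: M.a_ac\<close>)
  then show ?thesis
    by (intro right_module.intro right_module_axioms.intro A.ring_axioms)
      (auto simp: act Kc rsmult_l_distr rsmult_r_distr rsmult_assoc rsmult_one)
qed

lemma colinear_homD:
  assumes "f \<in> colinear_hom A C M N"
  shows "f \<in> rmodule_hom A M N" "f \<in> extensional (carrier M)"
    "x \<in> carrier M \<Longrightarrow> coaction N (f x) = tensor_map A M C N C f (\<lambda>y. y) (coaction M x)"
  using assms by (auto simp: colinear_hom_def)

lemma rmodule_hom_restrict:
  "(\<lambda>x\<in>carrier M. f x) \<in> rmodule_hom A M N" if "f \<in> rmodule_hom A M N" "right_module A M"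
proof -
  interpret right_module A M by fact
  show ?thesis using that(1) by (auto simp: rmodule_hom_def hom_def rsmult_closed)
qed

text \<open>Flatness is recorded at the two carrier types where injectivity is drawn from it:
  \<open>'m\<close> for the inclusion K \<rightarrow> M, and \<open>('m, 'c) tensor\<close> for the
  induced map K \<otimes> C \<rightarrow> M \<otimes> C.\<close>

locale flat_comodule = RM: right_module A M + CC: coring A C
  for A :: "('a, 'k) ring_scheme" and C :: "('a, 'c, 'z) coring_scheme"
    and M :: "('a, 'm, 'c, 'x) comodule_scheme" +
  assumes comodule: "right_comodule A C M"
    and flat_M: "left_flat TYPE('m) A C" and flat_MC: "left_flat TYPE(('m, 'c) tensor) A C"
begin

lemma M: "right_module A M"
  by (rule RM.right_module_axioms)

lemma bimodule_C: "bimodule A C"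
  by (rule CC.bimodule_axioms)

lemmas coaction_hom = right_comodule.coaction_hom[OF comodule]
  and coaction_coassoc = right_comodule.coaction_coassoc[OF comodule]
  and coaction_counit = right_comodule.coaction_counit[OF comodule]

lemma tensor_factors_coring: "right_module A L \<Longrightarrow> tensor_factors A L C"
  by (rule tensor_factorsI[OF _ bimodule_C])

lemma coaction_in: "x \<in> carrier M \<Longrightarrow> coaction M x \<in> carrier (tensor_group A M C)"
  using rmodule_homD(2)[OF coaction_hom] by simp

lemma coaction_tensor_hom: "coaction M \<in> hom (add_monoid M) (tensor_group A M C)"
  using rmodule_homD(1)[OF coaction_hom] by (simp add: hom_def)

text \<open>Each law of the lifted coaction \<rho> is proved after an injective map, where it
  becomes a law of M: additivity and A-linearity after \<open>?J\<close>, coassociativity after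
  \<open>?JCC\<close>, the counit law after the inclusion itself.\<close>

lemma subcomoduleI:
  assumes K: "subgroup K (add_monoid M)"
    and act: "\<And>x a. \<lbrakk>x \<in> K; a \<in> carrier A\<rbrakk> \<Longrightarrow> x \<triangleleft>\<^bsub>M\<^esub> a \<in> K"
    and coact: "\<And>x. x \<in> K \<Longrightarrow> coaction M x \<in> tensor_map A (M\<lparr>carrier := K\<rparr>) C M C (\<lambda>x. x) (\<lambda>y. y) `
      carrier (tensor_group A (M\<lparr>carrier := K\<rparr>) C)"
  shows "subcomodule A C K M"
proof -
  interpret K: subgroup K "add_monoid M" by fact
  have Kc: "x \<in> carrier M" if "x \<in> K" for x using K.subset that by auto
  \<comment> \<open>\<open>J0\<close> is formed with the record that still carries the coaction of
    M, because the record \<open>?K\<close> contains \<rho>, which is defined from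
    \<open>J0\<close>. The tensor product does not see the difference.\<close>
  define J0 where "J0 = tensor_map A (M\<lparr>carrier := K\<rparr>) C M C (\<lambda>x. x) (\<lambda>y. y)"
  \<comment> \<open>A chosen preimage of the coaction; injectivity of the map makes it unique and
    thereby linear in x.\<close>
  define \<rho> where "\<rho> = (\<lambda>x. SOME t. t \<in> carrier (tensor_group A (M\<lparr>carrier := K\<rparr>) C) \<and> J0 t = coaction M x)"
  let ?K = "M\<lparr>carrier := K, coaction := \<rho>\<rparr>"
  have same: "same_rmodule (M\<lparr>carrier := K\<rparr>) ?K" "same_rmodule M M" by (simp_all add: same_rmodule_def)
  have KM: "right_module A ?K"
    by (rule same_right_module[OF same(1) right_module_carrier_update[OF M K act]])
  let ?J = "tensor_map A ?K C M C (\<lambda>x. x) (\<lambda>y. y)"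
  have J0: "J0 = ?J" unfolding J0_def by (rule same_tensor_map[OF same])
  have \<rho>: "\<rho> x \<in> carrier (tensor_group A ?K C)" "?J (\<rho> x) = coaction M x" if "x \<in> K" for x
  proof -
    have "\<exists>t. t \<in> carrier (tensor_group A (M\<lparr>carrier := K\<rparr>) C) \<and> J0 t = coaction M x"
      using coact[OF that] unfolding J0_def by force
    then have "\<rho> x \<in> carrier (tensor_group A (M\<lparr>carrier := K\<rparr>) C) \<and> J0 (\<rho> x) = coaction M x"
      unfolding \<rho>_def by (rule someI_ex)
    then show "\<rho> x \<in> carrier (tensor_group A ?K C)" "?J (\<rho> x) = coaction M x"
      using same_tensor(1)[OF same(1), of A C] J0 by simp_all
  qed
  have i: "(\<lambda>x. x) \<in> rmodule_hom A ?K M"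
    using Kc by (auto simp: rmodule_hom_def hom_def)
  have iK: "inj_on (\<lambda>x. x) (carrier ?K)" by (simp add: inj_on_def)
  have Jinj: "inj_on ?J (carrier (tensor_group A ?K C))"
    by (rule left_flat_inj[OF flat_M KM M i iK])
  have Jh: "?J \<in> rmodule_hom A (tensor_rmodule A ?K C) (tensor_rmodule A M C)"
    by (rule tensor_map_rmodule_hom[OF KM M bimodule_C i])
  note tK = tensor_factors_coring[OF KM] and tM = tensor_factors_coring[OF M]
  note KC = right_module_tensor[OF KM bimodule_C] and MC = right_module_tensor[OF M bimodule_C]
  interpret KC: right_module A "tensor_rmodule A ?K C" by (rule KC)
  have \<rho>h: "\<rho> \<in> rmodule_hom A ?K (tensor_rmodule A ?K C)"
  proof -
    have "\<rho> (x \<oplus>\<^bsub>M\<^esub> y) = \<rho> x \<oplus>\<^bsub>tensor_rmodule A ?K C\<^esub> \<rho> y" if "x \<in> K" "y \<in> K" for x y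
    proof (rule inj_onD[OF Jinj])
      have xy: "x \<oplus>\<^bsub>M\<^esub> y \<in> K" using K.m_closed[OF that] by simp
      show "?J (\<rho> (x \<oplus>\<^bsub>M\<^esub> y)) = ?J (\<rho> x \<oplus>\<^bsub>tensor_rmodule A ?K C\<^esub> \<rho> y)"
        using \<rho> that rmodule_homD(3)[OF Jh, of "\<rho> x" "\<rho> y"] rmodule_homD(3)[OF coaction_hom Kc Kc]
        by (simp add: \<rho>(2)[OF xy])
      show "\<rho> (x \<oplus>\<^bsub>M\<^esub> y) \<in> carrier (tensor_group A ?K C)" by (rule \<rho>(1)[OF xy])
      show "\<rho> x \<oplus>\<^bsub>tensor_rmodule A ?K C\<^esub> \<rho> y \<in> carrier (tensor_group A ?K C)"
        using KC.M.a_closed[of "\<rho> x" "\<rho> y"] \<rho>(1) that by simp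
    qed
    moreover have "\<rho> (x \<triangleleft>\<^bsub>M\<^esub> a) = \<rho> x \<triangleleft>\<^bsub>tensor_rmodule A ?K C\<^esub> a" if "x \<in> K" "a \<in> carrier A" for x a
    proof (rule inj_onD[OF Jinj])
      have xa: "x \<triangleleft>\<^bsub>M\<^esub> a \<in> K" using act that by simp
      show "?J (\<rho> (x \<triangleleft>\<^bsub>M\<^esub> a)) = ?J (\<rho> x \<triangleleft>\<^bsub>tensor_rmodule A ?K C\<^esub> a)"
        using \<rho>[OF that(1)] that rmodule_homD(4)[OF Jh, of "\<rho> x" a] rmodule_homD(4)[OF coaction_hom Kc]
        by (simp add: \<rho>(2)[OF xa])
      show "\<rho> (x \<triangleleft>\<^bsub>M\<^esub> a) \<in> carrier (tensor_group A ?K C)" by (rule \<rho>(1)[OF xa])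
      show "\<rho> x \<triangleleft>\<^bsub>tensor_rmodule A ?K C\<^esub> a \<in> carrier (tensor_group A ?K C)"
        using KC.rsmult_closed[of "\<rho> x" a] \<rho>(1) that by simp
    qed
    ultimately show ?thesis using \<rho>(1) by (auto simp: rmodule_hom_def hom_def)
  qed
  have reg: "bimodule A (regular_bimodule A)" by (rule regular_bimodule[OF RM.A.ring_axioms])
  note tR = tensor_factorsI[OF KM reg] tensor_factorsI[OF M reg]
  have eps: "counit C \<in> lmodule_hom A C (regular_bimodule A)"
    by (rule bimodule_hom_lmodule_hom[OF CC.counit_hom])
  have Del: "comult C \<in> lmodule_hom A C (tensor_bimodule A C C)"
    by (rule bimodule_hom_lmodule_hom[OF CC.comult_hom])
  note tCC = tensor_factors_bimodule[OF KM bimodule_C bimodule_C]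
    tensor_factors_bimodule[OF M bimodule_C bimodule_C]
  note tL = tensor_factors_coring[OF KC] tensor_factors_coring[OF MC]
  let ?JR = "tensor_map A ?K (regular_bimodule A) M (regular_bimodule A) (\<lambda>x. x) (\<lambda>y. y)"
  let ?JCC = "tensor_map A ?K (tensor_bimodule A C C) M (tensor_bimodule A C C) (\<lambda>x. x) (\<lambda>y. y)"
  let ?JL = "tensor_map A (tensor_rmodule A ?K C) C (tensor_rmodule A M C) C ?J (\<lambda>y. y)"
  \<comment> \<open>Second use of flatness, with K \<otimes> C and M \<otimes> C as test modules and
    \<open>?J\<close> as the injective map between them.\<close>
  have JLinj: "inj_on ?JL (carrier (tensor_group A (tensor_rmodule A ?K C) C))"
    by (rule left_flat_inj[OF flat_MC KC MC Jh]) (use Jinj in simp)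
  \<comment> \<open>Elements are pulled back along the surjective associativity map of K; by
    naturality \<open>?JCC\<close> turns into \<open>?JL\<close> followed by the injective
    associativity map of M.\<close>
  have JCCinj: "inj_on ?JCC (carrier (tensor_group A ?K (tensor_bimodule A C C)))"
  proof (rule inj_onI)
    fix u v assume u: "u \<in> carrier (tensor_group A ?K (tensor_bimodule A C C))"
      and v: "v \<in> carrier (tensor_group A ?K (tensor_bimodule A C C))" and eq: "?JCC u = ?JCC v"
    note surj = tensor_assoc_surj[OF KM bimodule_C bimodule_C]
    obtain s where s: "s \<in> carrier (tensor_group A (tensor_rmodule A ?K C) C)" "u = tensor_assoc A ?K C C s"
      using u surj by (metis (no_types, lifting) imageE)
    obtain t where t: "t \<in> carrier (tensor_group A (tensor_rmodule A ?K C) C)" "v = tensor_assoc A ?K C C t"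
      using v surj by (metis (no_types, lifting) imageE)
    note nat = tensor_assoc_natural[OF KM M bimodule_C bimodule_C i]
    have "tensor_assoc A M C C (?JL s) = tensor_assoc A M C C (?JL t)"
      using eq nat[OF s(1)] nat[OF t(1)] s(2) t(2) by simp
    then have "?JL s = ?JL t"
      using inj_onD[OF tensor_assoc_inj[OF M bimodule_C bimodule_C]]
        tensor_map_closed[OF tL Jh id_lmodule_hom] s(1) t(1) by blast
    then have "s = t" using inj_onD[OF JLinj] s(1) t(1) by blast
    then show "u = v" using s t by simp
  qed
  have "right_comodule A C ?K"
  proof (intro right_comodule.intro right_comodule_axioms.intro)
    show "right_module A ?K" by (rule KM)
    show "coring A C" by (rule CC.coring_axioms)
    show "coaction ?K \<in> rmodule_hom A ?K (tensor_rmodule A ?K C)" using \<rho>h by simp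
  next
    fix x assume "x \<in> carrier ?K"
    then have x: "x \<in> K" by simp
    note \<rho>x = \<rho>[OF x]
    let ?e = "tensor_map A ?K C ?K (regular_bimodule A) (\<lambda>x. x) (counit C) (\<rho> x)"
    have e: "?e \<in> carrier (tensor_group A ?K (regular_bimodule A))"
      by (rule tensor_map_closed[OF tK tR(1) id_rmodule_hom eps \<rho>x(1)])
    \<comment> \<open>The inclusion is the identity on elements, so the value of the unit map over K
      may be computed over M.\<close>
    have "tensor_runit A ?K ?e = tensor_runit A M (?JR ?e)"
      by (rule tensor_runit_natural[OF KM M i e])
    also have "?JR ?e = tensor_map A ?K C M (regular_bimodule A) (\<lambda>x. x) (counit C) (\<rho> x)"
      by (rule tensor_map_comp[OF tK tR id_rmodule_hom eps i id_lmodule_hom \<rho>x(1)])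
    also have "\<dots> = tensor_map A M C M (regular_bimodule A) (\<lambda>x. x) (counit C) (?J (\<rho> x))"
      by (rule tensor_map_comp[OF tK tM tR(2) i id_lmodule_hom id_rmodule_hom eps \<rho>x(1), symmetric])
    also have "tensor_runit A M \<dots> = x"
      using coaction_counit[OF Kc[OF x]] \<rho>x(2) by simp
    finally show "tensor_runit A ?K
        (tensor_map A ?K C ?K (regular_bimodule A) (\<lambda>x. x) (counit C) (coaction ?K x)) = x" by simp
    let ?l = "tensor_map A ?K C (tensor_rmodule A ?K C) C \<rho> (\<lambda>y. y) (\<rho> x)"
    let ?r = "tensor_map A ?K C ?K (tensor_bimodule A C C) (\<lambda>x. x) (comult C) (\<rho> x)"
    have l: "?l \<in> carrier (tensor_group A (tensor_rmodule A ?K C) C)"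
      by (rule tensor_map_closed[OF tK tL(1) \<rho>h id_lmodule_hom \<rho>x(1)])
    have r: "?r \<in> carrier (tensor_group A ?K (tensor_bimodule A C C))"
      by (rule tensor_map_closed[OF tK tCC(1) id_rmodule_hom Del \<rho>x(1)])
    \<comment> \<open>Both sides of coassociativity are pushed into M \<otimes> (C \<otimes> C).
      There \<open>?J\<close> composed with \<rho> is the coaction of M, and coassociativity of M at
      x connects the two ends of the chain.\<close>
    have "?JCC (tensor_assoc A ?K C C ?l) = tensor_assoc A M C C (?JL ?l)"
      by (rule tensor_assoc_natural[OF KM M bimodule_C bimodule_C i l])
    also have "?JL ?l = tensor_map A ?K C (tensor_rmodule A M C) C (\<lambda>x. ?J (\<rho> x)) (\<lambda>y. y) (\<rho> x)"
      by (rule tensor_map_comp[OF tK tL \<rho>h id_lmodule_hom Jh id_lmodule_hom \<rho>x(1)])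
    also have "\<dots> = tensor_map A ?K C (tensor_rmodule A M C) C (\<lambda>x. coaction M x) (\<lambda>y. y) (\<rho> x)"
      using \<rho>(2) by (subst tensor_map_cong[where f' = "coaction M"]) auto
    also have "\<dots> = tensor_map A M C (tensor_rmodule A M C) C (coaction M) (\<lambda>y. y) (?J (\<rho> x))"
      by (rule tensor_map_comp[OF tK tM tL(2) i id_lmodule_hom coaction_hom id_lmodule_hom \<rho>x(1), symmetric])
    also have "tensor_assoc A M C C \<dots> = tensor_map A M C M (tensor_bimodule A C C) (\<lambda>x. x) (comult C) (?J (\<rho> x))"
      using coaction_coassoc[OF Kc[OF x]] \<rho>x(2) by simp
    also have "\<dots> = tensor_map A ?K C M (tensor_bimodule A C C) (\<lambda>x. x) (comult C) (\<rho> x)"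
      by (rule tensor_map_comp[OF tK tM tCC(2) i id_lmodule_hom id_rmodule_hom Del \<rho>x(1)])
    also have "\<dots> = ?JCC ?r"
      by (rule tensor_map_comp[OF tK tCC id_rmodule_hom Del i id_lmodule_hom \<rho>x(1), symmetric])
    finally have "tensor_assoc A ?K C C ?l = ?r"
      using inj_onD[OF JCCinj] r hom_in_carrier[OF tensor_assoc_hom[OF KM bimodule_C bimodule_C] l] by blast
    then show "tensor_assoc A ?K C C
        (tensor_map A ?K C (tensor_rmodule A ?K C) C (coaction ?K) (\<lambda>y. y) (coaction ?K x)) =
        tensor_map A ?K C ?K (tensor_bimodule A C C) (\<lambda>x. x) (comult C) (coaction ?K x)" by simp
  qed
  moreover have "(\<lambda>x\<in>K. x) \<in> colinear_hom A C ?K M"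
  proof -
    have "(\<lambda>x\<in>K. x) \<in> rmodule_hom A ?K M"
      using rmodule_hom_restrict[OF i KM] by simp
    moreover have "tensor_map A ?K C M C (\<lambda>x\<in>K. x) (\<lambda>y. y) = ?J"
      by (rule tensor_map_cong) auto
    ultimately show ?thesis using \<rho>(2) unfolding colinear_hom_def by auto
  qed
  ultimately show ?thesis using Kc unfolding subcomodule_def by blast
qed

text \<open>For colinear f the coaction of f(m) is f \<otimes> C applied to the coaction of m. As f
  takes values in K, the map f \<otimes> C factors through K \<otimes> C, which gives the condition
  on generators; both conditions on K define subgroups of M, so generators suffice.\<close>

lemma image_sum_subcomodule:
  assumes F: "F \<subseteq> colinear_hom A C M M"
  shows "subcomodule A C (image_sum M F) M"
proof -
  let ?U = "\<Union>f\<in>F. f ` carrier M"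
  define K where "K = image_sum M F"
  have U: "?U \<subseteq> carrier M" using F colinear_homD(1) rmodule_homD(2) by fast
  have Kg: "K = generate (add_monoid M) ?U" unfolding K_def image_sum_def ..
  have K: "subgroup K (add_monoid M)"
    unfolding Kg using U by (intro RM.M.add.generate_is_subgroup) auto
  interpret K: subgroup K "add_monoid M" by (rule K)
  have UK: "?U \<subseteq> K" unfolding Kg by (auto intro: generate.incl)
  have Kc: "x \<in> carrier M" if "x \<in> K" for x using K.subset that by auto
  have rh: "(\<lambda>x. x \<triangleleft>\<^bsub>M\<^esub> a) \<in> hom (add_monoid M) (add_monoid M)" if "a \<in> carrier A" for a
    using that by (intro homI) (auto simp: RM.rsmult_closed RM.rsmult_l_distr)
  \<comment> \<open>The elements sent into K by a form a subgroup, and the generators belong to it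
    because f(m) a = f(m a).\<close>
  have K1: "K \<subseteq> {x \<in> carrier M. x \<triangleleft>\<^bsub>M\<^esub> a \<in> K}" if a: "a \<in> carrier A" for a
  proof -
    interpret r: group_hom "add_monoid M" "add_monoid M" "\<lambda>x. x \<triangleleft>\<^bsub>M\<^esub> a"
      by (intro group_hom.intro group_hom_axioms.intro RM.M.a_group rh a)
    have "subgroup {x \<in> carrier M. x \<triangleleft>\<^bsub>M\<^esub> a \<in> K} (add_monoid M)"
      using r.hom_inv r.hom_one r.hom_mult K.one_closed K.m_closed K.m_inv_closed RM.M.add.inv_closed
      by (intro subgroup.intro) auto
    moreover have "?U \<subseteq> {x \<in> carrier M. x \<triangleleft>\<^bsub>M\<^esub> a \<in> K}"
    proof
      fix u assume u: "u \<in> ?U"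
      then obtain f m where f: "f \<in> F" "m \<in> carrier M" "u = f m" by blast
      then have "u \<triangleleft>\<^bsub>M\<^esub> a = f (m \<triangleleft>\<^bsub>M\<^esub> a)"
        using rmodule_homD(4)[OF colinear_homD(1)[OF subsetD[OF F f(1)]] f(2) a] f(3) by simp
      then have "u \<triangleleft>\<^bsub>M\<^esub> a \<in> ?U" using f(1) RM.rsmult_closed[OF f(2) a] by auto
      then show "u \<in> {x \<in> carrier M. x \<triangleleft>\<^bsub>M\<^esub> a \<in> K}" using UK U u by blast
    qed
    ultimately show ?thesis unfolding Kg by (intro RM.M.add.generate_subgroup_incl)
  qed
  then have act: "x \<triangleleft>\<^bsub>M\<^esub> a \<in> K" if "x \<in> K" "a \<in> carrier A" for x a using that by blast
  let ?K = "M\<lparr>carrier := K\<rparr>"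
  let ?J = "tensor_map A ?K C M C (\<lambda>x. x) (\<lambda>y. y)"
  let ?I = "?J ` carrier (tensor_group A ?K C)"
  have KM: "right_module A ?K" by (rule right_module_carrier_update[OF M K act])
  note tK = tensor_factors_coring[OF KM] and tM = tensor_factors_coring[OF M]
  interpret tK: tensor_factors A ?K C by (rule tK)
  interpret tM: tensor_factors A M C by (rule tM)
  have i: "(\<lambda>x. x) \<in> rmodule_hom A ?K M" using Kc by (auto simp: rmodule_hom_def hom_def)
  interpret J: group_hom "tensor_group A ?K C" "tensor_group A M C" ?J
    by unfold_locales (rule tensor_map_hom[OF tK tM i id_lmodule_hom])
  have I: "subgroup ?I (tensor_group A M C)" by (rule J.img_is_subgroup)
  interpret I: subgroup ?I "tensor_group A M C" by (rule I)
  interpret co: group_hom "add_monoid M" "tensor_group A M C" "coaction M"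
    by (intro group_hom.intro group_hom_axioms.intro RM.M.a_group tM.T.is_group coaction_tensor_hom)
  have "subgroup {x \<in> carrier M. coaction M x \<in> ?I} (add_monoid M)"
    using co.hom_inv co.hom_one co.hom_mult I.one_closed I.m_closed I.m_inv_closed RM.M.add.inv_closed
    by (intro subgroup.intro) auto
  moreover have "?U \<subseteq> {x \<in> carrier M. coaction M x \<in> ?I}"
  proof
    fix u assume u: "u \<in> ?U"
    then obtain f m where f: "f \<in> F" "m \<in> carrier M" "u = f m" by blast
    note fc = colinear_homD[OF subsetD[OF F f(1)]]
    \<comment> \<open>Viewing f with codomain K yields the factorization of f \<otimes> C through K
      \<otimes> C.\<close>
    have fK: "f \<in> rmodule_hom A M ?K"
      using fc(1) UK f(1) by (auto simp: rmodule_hom_def hom_def)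
    have "coaction M u = tensor_map A M C M C f (\<lambda>y. y) (coaction M m)"
      using fc(3) f by simp
    also have "\<dots> = ?J (tensor_map A M C ?K C f (\<lambda>y. y) (coaction M m))"
      by (rule tensor_map_comp[OF tM tK tM fK id_lmodule_hom i id_lmodule_hom coaction_in[OF f(2)], symmetric])
    also have "\<dots> \<in> ?I"
      by (intro imageI tensor_map_closed[OF tM tK fK id_lmodule_hom coaction_in[OF f(2)]])
    finally show "u \<in> {x \<in> carrier M. coaction M x \<in> ?I}" using U u by blast
  qed
  ultimately have "K \<subseteq> {x \<in> carrier M. coaction M x \<in> ?I}"
    unfolding Kg by (intro RM.M.add.generate_subgroup_incl)
  then have "subcomodule A C K M" by (intro subcomoduleI[OF K act]) auto
  then show ?thesis unfolding K_def .
qed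

end

context flat_comodule
begin

lemma zero_rsmult: "a \<in> carrier A \<Longrightarrow> \<zero>\<^bsub>M\<^esub> \<triangleleft>\<^bsub>M\<^esub> a = \<zero>\<^bsub>M\<^esub>"
  using RM.rsmult_l_distr[of "\<zero>\<^bsub>M\<^esub>" "\<zero>\<^bsub>M\<^esub>" a] RM.rsmult_closed[of "\<zero>\<^bsub>M\<^esub>" a]
  by (simp add: RM.M.add.l_cancel_one)

lemma coaction_zero: "coaction M \<zero>\<^bsub>M\<^esub> = \<one>\<^bsub>tensor_group A M C\<^esub>"
  using rmodule_hom_zero[OF coaction_hom RM.M.abelian_group_axioms
      abelian_group_tensor_rmodule[OF tensor_factors_coring[OF M]]] by simp

text \<open>K is a module in its own right and so has its own negatives; uniqueness of negatives in
  M identifies them with those of M.\<close>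

lemma subcomodule_subgroup:
  assumes "subcomodule A C K M"
  shows "subgroup K (add_monoid M)" and "\<And>x a. \<lbrakk>x \<in> K; a \<in> carrier A\<rbrakk> \<Longrightarrow> x \<triangleleft>\<^bsub>M\<^esub> a \<in> K"
proof -
  obtain \<rho> where \<rho>: "right_comodule A C (M\<lparr>carrier := K, coaction := \<rho>\<rparr>)" and Kc: "K \<subseteq> carrier M"
    using assms unfolding subcomodule_def by blast
  interpret K: right_module A "M\<lparr>carrier := K, coaction := \<rho>\<rparr>"
    using right_comodule.axioms(1)[OF \<rho>] .
  show "x \<triangleleft>\<^bsub>M\<^esub> a \<in> K" if "x \<in> K" "a \<in> carrier A" for x a
    using K.rsmult_closed that by simp
  have "\<ominus>\<^bsub>M\<^esub> x \<in> K" if x: "x \<in> K" for x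
  proof -
    let ?y = "\<ominus>\<^bsub>M\<lparr>carrier := K, coaction := \<rho>\<rparr>\<^esub> x"
    have y: "?y \<in> K" "?y \<oplus>\<^bsub>M\<^esub> x = \<zero>\<^bsub>M\<^esub>"
      using K.M.a_inv_closed[of x] K.M.l_neg[of x] x by simp_all
    then have "\<ominus>\<^bsub>M\<^esub> x = ?y" using RM.M.minus_equality x Kc by blast
    then show ?thesis using y by simp
  qed
  then show "subgroup K (add_monoid M)"
    using Kc K.M.a_closed K.M.zero_closed by (intro subgroup.intro) (auto simp flip: a_inv_def)
qed

section \<open>Colinear maps out of the quotient by a subcomodule\<close>

context
  fixes K assumes K: "subcomodule A C K M"
begin

interpretation K: abelian_subgroup K M
  by (intro abelian_subgroupI3 additive_subgroup.intro subcomodule_subgroup K RM.M.abelian_group_axioms)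

private abbreviation "Q \<equiv> quotient_comodule A C M K"
private abbreviation "\<pi> \<equiv> \<lambda>x. K +>\<^bsub>M\<^esub> x"

private lemma coset_mem: "y \<in> \<pi> x \<longleftrightarrow> (\<exists>k\<in>K. y = k \<oplus>\<^bsub>M\<^esub> x)"
  by (auto simp: a_r_coset_def')

lemma quotient_carrier: "carrier Q = (\<lambda>x. K +>\<^bsub>M\<^esub> x) ` carrier M"
  by (auto simp: quotient_comodule_def A_RCOSETS_def')

lemma quotient_zero: "\<zero>\<^bsub>Q\<^esub> = K"
  by (simp add: quotient_comodule_def)

private lemma quotient_add:
  "\<lbrakk>x \<in> carrier M; y \<in> carrier M\<rbrakk> \<Longrightarrow> \<pi> x \<oplus>\<^bsub>Q\<^esub> \<pi> y = \<pi> (x \<oplus>\<^bsub>M\<^esub> y)"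
  by (simp add: quotient_comodule_def K.a_rcos_sum)

text \<open>All cosets in the union that defines the action coincide, because K is stable under
  a.\<close>

private lemma quotient_rsmult:
  assumes x: "x \<in> carrier M" and a: "a \<in> carrier A"
  shows "\<pi> x \<triangleleft>\<^bsub>Q\<^esub> a = \<pi> (x \<triangleleft>\<^bsub>M\<^esub> a)"
proof -
  have "\<pi> (y \<triangleleft>\<^bsub>M\<^esub> a) = \<pi> (x \<triangleleft>\<^bsub>M\<^esub> a)" if y: "y \<in> \<pi> x" for y
  proof -
    obtain k where k: "k \<in> K" "y = k \<oplus>\<^bsub>M\<^esub> x" using y coset_mem by blast
    then have "y \<triangleleft>\<^bsub>M\<^esub> a = k \<triangleleft>\<^bsub>M\<^esub> a \<oplus>\<^bsub>M\<^esub> x \<triangleleft>\<^bsub>M\<^esub> a"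
      using RM.rsmult_l_distr[OF K.a_Hcarr[OF k(1)] x a] by simp
    then have "y \<triangleleft>\<^bsub>M\<^esub> a \<in> \<pi> (x \<triangleleft>\<^bsub>M\<^esub> a)"
      using subcomodule_subgroup(2)[OF K k(1) a] coset_mem by blast
    then show ?thesis using K.a_repr_independence'[OF _ RM.rsmult_closed[OF x a]] by simp
  qed
  moreover have "x \<in> \<pi> x" using K.a_rcos_self x by blast
  ultimately have "(\<Union>y\<in>\<pi> x. \<pi> (y \<triangleleft>\<^bsub>M\<^esub> a)) = \<pi> (x \<triangleleft>\<^bsub>M\<^esub> a)" by blast
  then show ?thesis by (simp add: quotient_comodule_def quotient_rmodule_def)
qed

private lemma quotient_abelian_group: "abelian_group Q"
  by (rule comm_group_abelian_groupI, rule comm_group_cong[OF K.a_factorgroup_is_comm_group])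
    (auto simp: quotient_comodule_def A_FactGroup_def FactGroup_def A_RCOSETS_def set_add_def)

private lemma proj_rmodule_hom: "\<pi> \<in> rmodule_hom A M Q"
  by (auto simp: rmodule_hom_def hom_def quotient_carrier quotient_add quotient_rsmult)

private lemma quotient_tensor_factors: "tensor_factors A Q C"
proof -
  interpret T: tensor_factors A M C by (rule tensor_factors_coring[OF M])
  show ?thesis
    by (intro tensor_factors.intro tensor_factors_axioms.intro quotient_abelian_group
        right_module_abelian_group[OF bimodule_right_module[OF bimodule_C]] T.lsmult_in)
      (auto simp: quotient_carrier quotient_rsmult RM.rsmult_closed)
qed

text \<open>On K the coaction comes from K \<otimes> C, and the projection is zero on K, so
  including and then projecting is the zero map tensored with C.\<close>

private lemma proj_coaction_subcomodule:
  assumes k: "k \<in> K"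
  shows "tensor_map A M C Q C \<pi> (\<lambda>y. y) (coaction M k) = \<one>\<^bsub>tensor_group A Q C\<^esub>"
proof -
  obtain \<rho> where \<rho>: "right_comodule A C (M\<lparr>carrier := K, coaction := \<rho>\<rparr>)"
    and inc: "(\<lambda>x\<in>K. x) \<in> colinear_hom A C (M\<lparr>carrier := K, coaction := \<rho>\<rparr>) M"
    using K unfolding subcomodule_def by blast
  let ?K = "M\<lparr>carrier := K, coaction := \<rho>\<rparr>"
  have KM: "right_module A ?K" by (rule right_comodule.axioms(1)[OF \<rho>])
  note t = tensor_factors_coring[OF KM] tensor_factors_coring[OF M] quotient_tensor_factors
  have \<rho>k: "\<rho> k \<in> carrier (tensor_group A ?K C)"
    using rmodule_homD(2)[OF right_comodule.coaction_hom[OF \<rho>], of k] k by simp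
  have "coaction M k = tensor_map A ?K C M C (\<lambda>x\<in>K. x) (\<lambda>y. y) (\<rho> k)"
    using colinear_homD(3)[OF inc, of k] k by simp
  then have "tensor_map A M C Q C \<pi> (\<lambda>y. y) (coaction M k) =
      tensor_map A ?K C Q C (\<lambda>x. \<pi> ((\<lambda>x\<in>K. x) x)) (\<lambda>y. y) (\<rho> k)"
    using tensor_map_comp[OF t colinear_homD(1)[OF inc] id_lmodule_hom proj_rmodule_hom id_lmodule_hom \<rho>k]
    by simp
  also have "\<dots> = \<one>\<^bsub>tensor_group A Q C\<^esub>"
    by (rule tensor_map_zero[OF t(1,3) rmodule_hom_comp[OF colinear_homD(1)[OF inc] proj_rmodule_hom]
          id_lmodule_hom _ \<rho>k])
      (simp add: quotient_zero K.a_rcos_const)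
  finally show ?thesis .
qed

text \<open>This justifies \<open>the_elem\<close> in the quotient coaction: two representatives
  differ by an element of K, whose coaction the projection kills. The equation itself is the
  colinearity of the projection M \<rightarrow> M / K.\<close>

private lemma quotient_coaction:
  assumes x: "x \<in> carrier M"
  shows "coaction Q (\<pi> x) = tensor_map A M C Q C \<pi> (\<lambda>y. y) (coaction M x)"
proof -
  let ?g = "\<lambda>x. tensor_map A M C Q C \<pi> (\<lambda>y. y) (coaction M x)"
  have t: "tensor_factors A M C" by (rule tensor_factors_coring[OF M])
  have h: "tensor_map A M C Q C \<pi> (\<lambda>y. y) \<in> hom (tensor_group A M C) (tensor_group A Q C)"
    by (rule tensor_map_hom[OF t quotient_tensor_factors proj_rmodule_hom id_lmodule_hom])
  interpret QC: comm_group "tensor_group A Q C"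
    by (rule tensor_factors.tensor_comm_group[OF quotient_tensor_factors])
  have "?g y = ?g x" if y: "y \<in> \<pi> x" for y
  proof -
    obtain k where k: "k \<in> K" "y = k \<oplus>\<^bsub>M\<^esub> x" using y coset_mem by blast
    have kc: "k \<in> carrier M" by (rule K.a_Hcarr[OF k(1)])
    have "coaction M y = coaction M k \<otimes>\<^bsub>tensor_group A M C\<^esub> coaction M x"
      using rmodule_homD(3)[OF coaction_hom kc x] k(2) by simp
    then show ?thesis
      using hom_mult[OF h coaction_in[OF kc] coaction_in[OF x]] proj_coaction_subcomodule[OF k(1)]
        hom_in_carrier[OF h coaction_in[OF x]] by simp
  qed
  moreover have "x \<in> \<pi> x" using K.a_rcos_self x by blast
  ultimately have g: "?g ` \<pi> x = {?g x}" by blast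
  have "same_rmodule (quotient_rmodule M K) Q" "same_rmodule M M"
    by (simp_all add: same_rmodule_def quotient_rmodule_def quotient_comodule_def)
  then have e: "tensor_map A M C (quotient_rmodule M K) C \<pi> (\<lambda>y. y) = tensor_map A M C Q C \<pi> (\<lambda>y. y)"
    by (intro same_tensor_map)
  have "coaction Q (\<pi> x) =
      the_elem ((\<lambda>x. tensor_map A M C (quotient_rmodule M K) C \<pi> (\<lambda>y. y) (coaction M x)) ` \<pi> x)"
    by (simp add: quotient_comodule_def)
  then show ?thesis unfolding e g the_elem_eq .
qed

text \<open>Composing h with the colinear projection turns maps out of M / K into endomorphisms of M
  that are zero on K.\<close>

lemma quotient_hom_lift:
  assumes h: "h \<in> colinear_hom A C Q M"
  shows "(\<lambda>x\<in>carrier M. h (K +>\<^bsub>M\<^esub> x)) \<in> colinear_hom A C M M"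
proof -
  note t = tensor_factors_coring[OF M] quotient_tensor_factors
  have c: "(\<lambda>x. h (\<pi> x)) \<in> rmodule_hom A M M"
    by (rule rmodule_hom_comp[OF proj_rmodule_hom colinear_homD(1)[OF h]])
  have "coaction M (h (\<pi> x)) =
      tensor_map A M C M C (\<lambda>x\<in>carrier M. h (\<pi> x)) (\<lambda>y. y) (coaction M x)" if x: "x \<in> carrier M" for x
  proof -
    have "coaction M (h (\<pi> x)) = tensor_map A Q C M C h (\<lambda>y. y) (tensor_map A M C Q C \<pi> (\<lambda>y. y) (coaction M x))"
      using colinear_homD(3)[OF h, of "\<pi> x"] quotient_coaction[OF x] x by (simp add: quotient_carrier)
    also have "\<dots> = tensor_map A M C M C (\<lambda>x. h (\<pi> x)) (\<lambda>y. y) (coaction M x)"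
      by (rule tensor_map_comp[OF t t(1) proj_rmodule_hom id_lmodule_hom colinear_homD(1)[OF h] id_lmodule_hom
            coaction_in[OF x]])
    also have "tensor_map A M C M C (\<lambda>x. h (\<pi> x)) (\<lambda>y. y) =
        tensor_map A M C M C (\<lambda>x\<in>carrier M. h (\<pi> x)) (\<lambda>y. y)"
      by (rule tensor_map_cong) auto
    finally show ?thesis .
  qed
  then show ?thesis
    using rmodule_hom_restrict[OF c M] by (auto simp: colinear_hom_def)
qed

lemma quotient_hom_vanishes:
  assumes h: "h \<in> colinear_hom A C Q M" and k: "k \<in> K"
  shows "h (K +>\<^bsub>M\<^esub> k) = \<zero>\<^bsub>M\<^esub>"
  using rmodule_hom_zero[OF colinear_homD(1)[OF h] quotient_abelian_group RM.M.abelian_group_axioms]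
    K.a_rcos_const[OF k] by (simp add: quotient_zero)

text \<open>\<open>coretractable\<close> says that the set of colinear maps differs from the
  singleton of the zero map. Only with zero known to belong to that set does this yield a nonzero
  map.\<close>

lemma quotient_zero_hom: "(\<lambda>Y\<in>carrier Q. \<zero>\<^bsub>M\<^esub>) \<in> colinear_hom A C Q M"
proof -
  note t = tensor_factors_coring[OF M] quotient_tensor_factors
  let ?z = "\<lambda>Y\<in>carrier Q. \<zero>\<^bsub>M\<^esub>"
  interpret Q: abelian_group Q by (rule quotient_abelian_group)
  have z: "?z \<in> rmodule_hom A Q M"
    using tensor_factors.rsmult_in[OF quotient_tensor_factors] by (auto simp: rmodule_hom_def hom_def zero_rsmult)
  have "coaction Q Y \<in> carrier (tensor_group A Q C)" if Y: "Y \<in> carrier Q" for Y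
  proof -
    obtain x where x: "x \<in> carrier M" "Y = \<pi> x" using Y by (auto simp: quotient_carrier)
    show ?thesis
      unfolding x(2) quotient_coaction[OF x(1)]
      by (rule tensor_map_closed[OF t proj_rmodule_hom id_lmodule_hom coaction_in[OF x(1)]])
  qed
  then have "tensor_map A Q C M C ?z (\<lambda>y. y) (coaction Q Y) = \<one>\<^bsub>tensor_group A M C\<^esub>" if "Y \<in> carrier Q" for Y
    using that by (intro tensor_map_zero[OF t(2,1) z id_lmodule_hom]) auto
  then show ?thesis using z coaction_zero by (auto simp: colinear_hom_def)
qed

lemma coset_nonzero:
  assumes "x \<in> carrier M" "x \<notin> K"
  shows "K +>\<^bsub>M\<^esub> x \<noteq> \<zero>\<^bsub>Q\<^esub>"
  using K.a_rcos_self[OF assms(1)] assms(2) by (auto simp: quotient_zero)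

end

section \<open>The endomorphism ring\<close>

abbreviation E where "E \<equiv> End_op A C M"

lemma End_op_carrier: "carrier E = colinear_hom A C M M"
  by (simp add: End_op_def)

lemma End_in: "\<lbrakk>f \<in> carrier E; x \<in> carrier M\<rbrakk> \<Longrightarrow> f x \<in> carrier M"
  using rmodule_homD(2)[OF colinear_homD(1)] by (auto simp: End_op_carrier)

lemma End_add: "\<lbrakk>f \<in> carrier E; x \<in> carrier M; y \<in> carrier M\<rbrakk> \<Longrightarrow> f (x \<oplus>\<^bsub>M\<^esub> y) = f x \<oplus>\<^bsub>M\<^esub> f y"
  using rmodule_homD(3)[OF colinear_homD(1)] by (auto simp: End_op_carrier)

lemma End_group_hom: "f \<in> carrier E \<Longrightarrow> group_hom (add_monoid M) (add_monoid M) f"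
  using rmodule_homD(1)[OF colinear_homD(1)]
  by (auto simp: End_op_carrier intro!: group_hom.intro group_hom_axioms.intro RM.M.a_group)

lemma End_eqI:
  assumes "f \<in> carrier E" "g \<in> carrier E" "\<And>x. x \<in> carrier M \<Longrightarrow> f x = g x"
  shows "f = g"
  using assms colinear_homD(2) unfolding End_op_carrier by (metis extensionalityI)

lemma End_mult: "f \<otimes>\<^bsub>E\<^esub> g = (\<lambda>x\<in>carrier M. g (f x))"
  by (simp add: End_op_def compose_def)

lemma End_zero: "\<zero>\<^bsub>E\<^esub> = (\<lambda>x\<in>carrier M. \<zero>\<^bsub>M\<^esub>)"
  by (simp add: End_op_def)

lemma End_one: "\<one>\<^bsub>E\<^esub> = (\<lambda>x\<in>carrier M. x)"
  by (simp add: End_op_def)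

lemma End_plus: "f \<oplus>\<^bsub>E\<^esub> g = (\<lambda>x\<in>carrier M. f x \<oplus>\<^bsub>M\<^esub> g x)"
  by (simp add: End_op_def)

text \<open>Elements of \<open>E\<close> are extensional while sums, composites and negatives are
  formed pointwise. The conditions may be checked for the unrestricted map, since
  \<open>tensor_map\<close> sees a map only on the carrier.\<close>

lemma End_restrictI:
  assumes f: "f \<in> rmodule_hom A M M"
    and co: "\<And>x. x \<in> carrier M \<Longrightarrow> coaction M (f x) = tensor_map A M C M C f (\<lambda>y. y) (coaction M x)"
  shows "(\<lambda>x\<in>carrier M. f x) \<in> carrier E"
proof -
  have "tensor_map A M C M C (\<lambda>x\<in>carrier M. f x) (\<lambda>y. y) = tensor_map A M C M C f (\<lambda>y. y)"
    by (rule tensor_map_cong) auto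
  then show ?thesis
    using rmodule_hom_restrict[OF f M] co by (auto simp: End_op_carrier colinear_hom_def)
qed

lemma End_one_closed: "\<one>\<^bsub>E\<^esub> \<in> carrier E"
  unfolding End_one
  by (intro End_restrictI id_rmodule_hom)
    (simp add: tensor_map_id[OF tensor_factors_coring[OF M] coaction_in])

lemma End_mult_closed:
  assumes f: "f \<in> carrier E" and g: "g \<in> carrier E"
  shows "f \<otimes>\<^bsub>E\<^esub> g \<in> carrier E"
proof -
  note t = tensor_factors_coring[OF M]
  note fc = colinear_homD[OF f[unfolded End_op_carrier]] and gc = colinear_homD[OF g[unfolded End_op_carrier]]
  show ?thesis
    unfolding End_mult
    by (intro End_restrictI rmodule_hom_comp[OF fc(1) gc(1)])
      (simp add: gc(3)[OF End_in[OF f]] fc(3)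
        tensor_map_comp[OF t t t fc(1) id_lmodule_hom gc(1) id_lmodule_hom coaction_in])
qed

lemma zero_rmodule_hom: "(\<lambda>x. \<zero>\<^bsub>M\<^esub>) \<in> rmodule_hom A M M"
  by (auto simp: rmodule_hom_def hom_def zero_rsmult)

lemma End_zero_closed: "\<zero>\<^bsub>E\<^esub> \<in> carrier E"
  unfolding End_zero
  by (intro End_restrictI zero_rmodule_hom)
    (simp add: coaction_zero tensor_map_zero[OF tensor_factors_coring[OF M] tensor_factors_coring[OF M]
        zero_rmodule_hom id_lmodule_hom _ coaction_in])

lemma plus_rmodule_hom:
  assumes f: "f \<in> rmodule_hom A M M" and g: "g \<in> rmodule_hom A M M"
  shows "(\<lambda>x. f x \<oplus>\<^bsub>M\<^esub> g x) \<in> rmodule_hom A M M"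
  using rmodule_homD[OF f] rmodule_homD[OF g]
  by (auto simp: rmodule_hom_def hom_def RM.rsmult_l_distr RM.M.a_ac)

lemma rsmult_minus:
  assumes "x \<in> carrier M" "a \<in> carrier A"
  shows "(\<ominus>\<^bsub>M\<^esub> x) \<triangleleft>\<^bsub>M\<^esub> a = \<ominus>\<^bsub>M\<^esub> (x \<triangleleft>\<^bsub>M\<^esub> a)"
  using RM.rsmult_l_distr[of "\<ominus>\<^bsub>M\<^esub> x" x a] assms
  by (intro RM.M.minus_equality[symmetric]) (auto simp: RM.M.l_neg zero_rsmult RM.rsmult_closed)

lemma minus_rmodule_hom:
  assumes f: "f \<in> rmodule_hom A M M"
  shows "(\<lambda>x. \<ominus>\<^bsub>M\<^esub> f x) \<in> rmodule_hom A M M"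
  using rmodule_homD[OF f]
  by (auto simp: rmodule_hom_def hom_def rsmult_minus RM.M.minus_add)

lemma End_plus_closed:
  assumes f: "f \<in> carrier E" and g: "g \<in> carrier E"
  shows "f \<oplus>\<^bsub>E\<^esub> g \<in> carrier E"
proof -
  note t = tensor_factors_coring[OF M]
  note fc = colinear_homD[OF f[unfolded End_op_carrier]] and gc = colinear_homD[OF g[unfolded End_op_carrier]]
  show ?thesis
    unfolding End_plus
  proof (rule End_restrictI[OF plus_rmodule_hom[OF fc(1) gc(1)]])
    fix x assume x: "x \<in> carrier M"
    have "tensor_map A M C M C (\<lambda>x. f x \<oplus>\<^bsub>M\<^esub> g x) (\<lambda>y. y) (coaction M x) =
        coaction M (f x) \<otimes>\<^bsub>tensor_group A M C\<^esub> coaction M (g x)"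
      using tensor_map_add[OF t t fc(1) gc(1) plus_rmodule_hom[OF fc(1) gc(1)] id_lmodule_hom _ coaction_in[OF x]]
      by (simp add: fc(3)[OF x] gc(3)[OF x])
    then show "coaction M (f x \<oplus>\<^bsub>M\<^esub> g x) = tensor_map A M C M C (\<lambda>x. f x \<oplus>\<^bsub>M\<^esub> g x) (\<lambda>y. y) (coaction M x)"
      using rmodule_homD(3)[OF coaction_hom End_in[OF f x] End_in[OF g x]] by simp
  qed
qed

text \<open>By additivity of the tensor product, (-f) \<otimes> C and f \<otimes> C applied to the
  coaction of x sum to zero; so do the coactions of -f(x) and f(x). Cancelling the common summand,
  the coaction of f(x), gives colinearity.\<close>

lemma End_minus_closed:
  assumes f: "f \<in> carrier E"
  shows "(\<lambda>x\<in>carrier M. \<ominus>\<^bsub>M\<^esub> f x) \<in> carrier E"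
proof -
  note t = tensor_factors_coring[OF M]
  note fc = colinear_homD[OF f[unfolded End_op_carrier]]
  interpret T: tensor_factors A M C by (rule t)
  let ?m = "\<lambda>x. \<ominus>\<^bsub>M\<^esub> f x"
  note mh = minus_rmodule_hom[OF fc(1)]
  show ?thesis
  proof (rule End_restrictI[OF mh])
    fix x assume x: "x \<in> carrier M"
    note c = coaction_in[OF x]
    let ?F = "\<lambda>f. tensor_map A M C M C f (\<lambda>y. y) (coaction M x)"
    have "?F (\<lambda>x. \<zero>\<^bsub>M\<^esub>) = ?F ?m \<otimes>\<^bsub>tensor_group A M C\<^esub> ?F f"
      by (rule tensor_map_add[OF t t mh fc(1) zero_rmodule_hom id_lmodule_hom _ c])
        (simp add: RM.M.l_neg End_in[OF f])
    moreover have "?F (\<lambda>x. \<zero>\<^bsub>M\<^esub>) = \<one>\<^bsub>tensor_group A M C\<^esub>"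
      by (rule tensor_map_zero[OF t t zero_rmodule_hom id_lmodule_hom _ c]) simp
    moreover have "coaction M (?m x) \<otimes>\<^bsub>tensor_group A M C\<^esub> ?F f = \<one>\<^bsub>tensor_group A M C\<^esub>"
      using rmodule_homD(3)[OF coaction_hom, of "?m x" "f x"] fc(3)[OF x] End_in[OF f x] coaction_zero
      by (simp add: RM.M.l_neg)
    ultimately show "coaction M (?m x) = ?F ?m"
      using T.T.inv_unique' tensor_map_closed[OF t t mh id_lmodule_hom c]
        tensor_map_closed[OF t t fc(1) id_lmodule_hom c] coaction_in End_in[OF f x] RM.M.a_inv_closed
        T.T.right_cancel by metis
  qed
qed

lemma End_ring: "ring E"
proof (rule ringI)
  show "abelian_group E"
  proof (rule abelian_groupI)
    fix f assume f: "f \<in> carrier E"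
    show "\<zero>\<^bsub>E\<^esub> \<oplus>\<^bsub>E\<^esub> f = f"
      by (rule End_eqI[OF End_plus_closed[OF End_zero_closed f] f]) (simp add: End_plus End_zero End_in[OF f])
    show "\<exists>g\<in>carrier E. g \<oplus>\<^bsub>E\<^esub> f = \<zero>\<^bsub>E\<^esub>"
      using End_minus_closed[OF f]
      by (intro bexI[of _ "\<lambda>x\<in>carrier M. \<ominus>\<^bsub>M\<^esub> f x"])
        (auto simp: End_plus End_zero End_in[OF f] RM.M.l_neg intro!: restrict_ext)
  qed (auto simp: End_plus_closed End_zero_closed,
      auto simp: End_plus End_in RM.M.a_ac intro!: restrict_ext)
  show "Group.monoid E"
  proof (rule monoidI)
    fix f assume f: "f \<in> carrier E"
    show "\<one>\<^bsub>E\<^esub> \<otimes>\<^bsub>E\<^esub> f = f"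
      by (rule End_eqI[OF End_mult_closed[OF End_one_closed f] f]) (simp add: End_mult End_one End_in[OF f])
    show "f \<otimes>\<^bsub>E\<^esub> \<one>\<^bsub>E\<^esub> = f"
      by (rule End_eqI[OF End_mult_closed[OF f End_one_closed] f]) (simp add: End_mult End_one End_in[OF f])
  qed (auto simp: End_mult_closed End_one_closed, auto simp: End_mult End_in intro!: restrict_ext)
qed (auto simp: End_plus End_mult End_in End_add intro!: restrict_ext)

end

section \<open>Primeness of the endomorphism ring\<close>

context flat_comodule
begin

interpretation E: ring E by (rule End_ring)

lemma End_mult_eq_zero_iff:
  assumes "f \<in> carrier E" "g \<in> carrier E"
  shows "f \<otimes>\<^bsub>E\<^esub> g = \<zero>\<^bsub>E\<^esub> \<longleftrightarrow> (\<forall>x\<in>f ` carrier M. g x = \<zero>\<^bsub>M\<^esub>)"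
proof
  assume "f \<otimes>\<^bsub>E\<^esub> g = \<zero>\<^bsub>E\<^esub>"
  then show "\<forall>x\<in>f ` carrier M. g x = \<zero>\<^bsub>M\<^esub>"
    unfolding End_mult End_zero by (auto dest: fun_cong split: if_splits)
next
  assume "\<forall>x\<in>f ` carrier M. g x = \<zero>\<^bsub>M\<^esub>"
  then show "f \<otimes>\<^bsub>E\<^esub> g = \<zero>\<^bsub>E\<^esub>"
    unfolding End_mult End_zero by (intro restrict_ext) auto
qed

lemma End_eq_zero_iff:
  assumes "f \<in> carrier E"
  shows "f = \<zero>\<^bsub>E\<^esub> \<longleftrightarrow> (\<forall>x\<in>carrier M. f x = \<zero>\<^bsub>M\<^esub>)"
  using End_eqI[OF assms End_zero_closed] by (auto simp: End_zero)

text \<open>The kernel of g is a subgroup containing every f(M), hence also their sum.\<close>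

lemma End_zero_on_image_sum:
  assumes F: "F \<subseteq> carrier E" and g: "g \<in> carrier E"
    and fg: "\<And>f. f \<in> F \<Longrightarrow> f \<otimes>\<^bsub>E\<^esub> g = \<zero>\<^bsub>E\<^esub>" and x: "x \<in> image_sum M F"
  shows "g x = \<zero>\<^bsub>M\<^esub>"
proof -
  interpret g: group_hom "add_monoid M" "add_monoid M" g by (rule End_group_hom[OF g])
  have "(\<Union>f\<in>F. f ` carrier M) \<subseteq> kernel (add_monoid M) (add_monoid M) g"
  proof (rule UN_least)
    fix f assume "f \<in> F"
    then have "f \<in> carrier E" "\<forall>x\<in>f ` carrier M. g x = \<zero>\<^bsub>M\<^esub>"
      using F fg End_mult_eq_zero_iff g by blast+
    then show "f ` carrier M \<subseteq> kernel (add_monoid M) (add_monoid M) g"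
      using End_in by (auto simp: kernel_def)
  qed
  then have "image_sum M F \<subseteq> kernel (add_monoid M) (add_monoid M) g"
    unfolding image_sum_def by (intro RM.M.add.generate_subgroup_incl g.subgroup_kernel)
  then show ?thesis using x by (auto simp: kernel_def)
qed

lemma image_in_image_sum:
  "\<lbrakk>f \<in> F; x \<in> carrier M\<rbrakk> \<Longrightarrow> f x \<in> image_sum M F"
  unfolding image_sum_def by (rule generate.incl) blast

lemma image_subgroup: "f \<in> carrier E \<Longrightarrow> subgroup (f ` carrier M) (add_monoid M)"
  using group_hom.img_is_subgroup[OF End_group_hom] by fastforce

text \<open>f(M) is already a subgroup. This brings M f and M f f under the statements about
  families of endomorphisms.\<close>

lemma image_sum_singleton: "f \<in> carrier E \<Longrightarrow> image_sum M {f} = f ` carrier M"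
  unfolding image_sum_def using RM.M.add.generate_subgroup_incl[OF _ image_subgroup, of "f ` carrier M" f]
  by (auto intro: generate.incl)

section \<open>Endomorphisms that annihilate a given family\<close>

lemma coretractable_annihilator:
  assumes "coretractable A C M" "F \<subseteq> carrier E" "image_sum M F \<noteq> carrier M"
  obtains g where "g \<in> carrier E" "g \<noteq> \<zero>\<^bsub>E\<^esub>" "\<And>f. f \<in> F \<Longrightarrow> f \<otimes>\<^bsub>E\<^esub> g = \<zero>\<^bsub>E\<^esub>"
proof -
  let ?K = "image_sum M F"
  let ?Q = "quotient_comodule A C M ?K"
  have K: "subcomodule A C ?K M"
    using assms(2) by (intro image_sum_subcomodule) (simp add: End_op_carrier)
  have "colinear_hom A C ?Q M \<noteq> {\<lambda>Y\<in>carrier ?Q. \<zero>\<^bsub>M\<^esub>}"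
    using assms K unfolding coretractable_def by blast
  then obtain h where h: "h \<in> colinear_hom A C ?Q M" "h \<noteq> (\<lambda>Y\<in>carrier ?Q. \<zero>\<^bsub>M\<^esub>)"
    using quotient_zero_hom[OF K] by blast
  let ?g = "\<lambda>x\<in>carrier M. h (?K +>\<^bsub>M\<^esub> x)"
  have g: "?g \<in> carrier E"
    using quotient_hom_lift[OF K h(1)] by (simp add: End_op_carrier)
  have "?g \<noteq> \<zero>\<^bsub>E\<^esub>"
  proof
    assume "?g = \<zero>\<^bsub>E\<^esub>"
    then have "\<forall>x\<in>carrier M. ?g x = \<zero>\<^bsub>M\<^esub>" using End_eq_zero_iff[OF g] by blast
    \<comment> \<open>The projection is onto, so vanishing of the composite on M forces h to vanish
      on all of M / K.\<close>
    then have "\<forall>Y\<in>carrier ?Q. h Y = \<zero>\<^bsub>M\<^esub>" by (auto simp: quotient_carrier[OF K])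
    then have "h = (\<lambda>Y\<in>carrier ?Q. \<zero>\<^bsub>M\<^esub>)"
      using colinear_homD(2)[OF h(1)] by (intro extensionalityI[where A = "carrier ?Q"]) auto
    then show False using h(2) by blast
  qed
  moreover have "f \<otimes>\<^bsub>E\<^esub> ?g = \<zero>\<^bsub>E\<^esub>" if f: "f \<in> F" for f
  proof -
    have fE: "f \<in> carrier E" using f assms(2) by blast
    show ?thesis
      unfolding End_mult_eq_zero_iff[OF fE g]
      using quotient_hom_vanishes[OF K h(1) image_in_image_sum[OF f]] End_in[OF fE] by auto
  qed
  ultimately show thesis using that[OF g] by blast
qed

lemma self_cogenerator_annihilator:
  assumes "self_cogenerator A C M" "F \<subseteq> carrier E" "x \<in> carrier M" "x \<notin> image_sum M F"
  obtains g where "g \<in> carrier E" "g x \<noteq> \<zero>\<^bsub>M\<^esub>" "\<And>f. f \<in> F \<Longrightarrow> f \<otimes>\<^bsub>E\<^esub> g = \<zero>\<^bsub>E\<^esub>"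
proof -
  let ?K = "image_sum M F"
  let ?Q = "quotient_comodule A C M ?K"
  have K: "subcomodule A C ?K M"
    using assms(2) by (intro image_sum_subcomodule) (simp add: End_op_carrier)
  have "(\<Inter>h\<in>colinear_hom A C ?Q M. a_kernel ?Q M h) = {\<zero>\<^bsub>?Q\<^esub>}"
    using assms(1) K unfolding self_cogenerator_def by blast
  \<comment> \<open>The coset of x is nonzero, hence outside the intersection of the
    kernels.\<close>
  then obtain h where h: "h \<in> colinear_hom A C ?Q M" "?K +>\<^bsub>M\<^esub> x \<notin> a_kernel ?Q M h"
    using coset_nonzero[OF K assms(3,4)] by blast
  let ?g = "\<lambda>x\<in>carrier M. h (?K +>\<^bsub>M\<^esub> x)"
  have g: "?g \<in> carrier E"
    using quotient_hom_lift[OF K h(1)] by (simp add: End_op_carrier)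
  have "?g x \<noteq> \<zero>\<^bsub>M\<^esub>"
    using h(2) assms(3) by (auto simp: a_kernel_def' quotient_carrier[OF K])
  moreover have "f \<otimes>\<^bsub>E\<^esub> ?g = \<zero>\<^bsub>E\<^esub>" if f: "f \<in> F" for f
  proof -
    have fE: "f \<in> carrier E" using f assms(2) by blast
    show ?thesis
      unfolding End_mult_eq_zero_iff[OF fE g]
      using quotient_hom_vanishes[OF K h(1) image_in_image_sum[OF f]] End_in[OF fE] by auto
  qed
  ultimately show thesis using that[OF g] by blast
qed

lemma End_one_nonzero:
  assumes "carrier M \<noteq> {\<zero>\<^bsub>M\<^esub>}"
  shows "\<one>\<^bsub>E\<^esub> \<noteq> \<zero>\<^bsub>E\<^esub>"
  using assms End_eq_zero_iff[OF End_one_closed] RM.M.zero_closed by (auto simp: End_one)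

section \<open>Image conditions and the four primeness notions\<close>

lemma left_mult_coset: "f \<in> carrier E \<Longrightarrow> f <#\<^bsub>E\<^esub> carrier E \<subseteq> carrier E"
  by (auto simp: l_coset_def)

lemma left_right_mult_coset: "f \<in> carrier E \<Longrightarrow> (f <#\<^bsub>E\<^esub> carrier E) #>\<^bsub>E\<^esub> f \<subseteq> carrier E"
  by (auto simp: l_coset_def r_coset_def)

text \<open>If I J = 0 and f is a nonzero element of I, then f E is contained in I, so every g in J
  vanishes on M f E = M.\<close>

lemma E_primeI:
  assumes nz: "carrier M \<noteq> {\<zero>\<^bsub>M\<^esub>}"
    and H: "\<And>f. \<lbrakk>f \<in> carrier E; f \<noteq> \<zero>\<^bsub>E\<^esub>\<rbrakk> \<Longrightarrow> carrier M = image_sum M (f <#\<^bsub>E\<^esub> carrier E)"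
  shows "E_prime A C M"
  unfolding E_prime_def prime_ring_def
proof (intro conjI allI impI End_ring End_one_nonzero nz)
  fix I J assume IJ: "ideal I E \<and> ideal J E \<and> (\<forall>a\<in>I. \<forall>b\<in>J. a \<otimes>\<^bsub>E\<^esub> b = \<zero>\<^bsub>E\<^esub>)"
  interpret I: ideal I E using IJ by blast
  interpret J: ideal J E using IJ by blast
  have "J \<subseteq> {\<zero>\<^bsub>E\<^esub>}" if nzI: "I \<noteq> {\<zero>\<^bsub>E\<^esub>}"
  proof
    fix g assume g: "g \<in> J"
    obtain f where f: "f \<in> I" "f \<noteq> \<zero>\<^bsub>E\<^esub>" using nzI I.zero_closed by blast
    have fE: "f \<in> carrier E" and gE: "g \<in> carrier E" using f g I.a_Hcarr J.a_Hcarr by blast+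
    have "g x = \<zero>\<^bsub>M\<^esub>" if "x \<in> carrier M" for x
    proof (rule End_zero_on_image_sum[OF left_mult_coset[OF fE] gE])
      show "x \<in> image_sum M (f <#\<^bsub>E\<^esub> carrier E)" using that H[OF fE f(2)] by blast
      fix k assume "k \<in> f <#\<^bsub>E\<^esub> carrier E"
      then have "k \<in> I" using I.I_r_closed f(1) by (auto simp: l_coset_def)
      then show "k \<otimes>\<^bsub>E\<^esub> g = \<zero>\<^bsub>E\<^esub>" using IJ g by blast
    qed
    then show "g \<in> {\<zero>\<^bsub>E\<^esub>}" using End_eq_zero_iff[OF gE] by blast
  qed
  then show "I = {\<zero>\<^bsub>E\<^esub>} \<or> J = {\<zero>\<^bsub>E\<^esub>}" using J.zero_closed by blast
qed

lemma completely_E_primeI: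
  assumes nz: "carrier M \<noteq> {\<zero>\<^bsub>M\<^esub>}"
    and H: "\<And>f. \<lbrakk>f \<in> carrier E; f \<noteq> \<zero>\<^bsub>E\<^esub>\<rbrakk> \<Longrightarrow> carrier M = f ` carrier M"
  shows "completely_E_prime A C M"
  unfolding completely_E_prime_def noncomm_domain_def
proof (intro conjI ballI impI End_ring End_one_nonzero nz)
  fix f g assume f: "f \<in> carrier E" and g: "g \<in> carrier E" and fg: "f \<otimes>\<^bsub>E\<^esub> g = \<zero>\<^bsub>E\<^esub>"
  have "g = \<zero>\<^bsub>E\<^esub>" if "f \<noteq> \<zero>\<^bsub>E\<^esub>"
    using fg End_mult_eq_zero_iff[OF f g] End_eq_zero_iff[OF g] H[OF f that] by metis
  then show "f = \<zero>\<^bsub>E\<^esub> \<or> g = \<zero>\<^bsub>E\<^esub>" by blast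
qed

lemma E_primeD:
  assumes "coretractable A C M" "E_prime A C M" and f: "f \<in> carrier E" "f \<noteq> \<zero>\<^bsub>E\<^esub>"
  shows "carrier M = image_sum M (f <#\<^bsub>E\<^esub> carrier E)"
proof (rule ccontr)
  assume "carrier M \<noteq> image_sum M (f <#\<^bsub>E\<^esub> carrier E)"
  then obtain g where g: "g \<in> carrier E" "g \<noteq> \<zero>\<^bsub>E\<^esub>"
      "\<And>k. k \<in> f <#\<^bsub>E\<^esub> carrier E \<Longrightarrow> k \<otimes>\<^bsub>E\<^esub> g = \<zero>\<^bsub>E\<^esub>"
    using coretractable_annihilator[OF assms(1) left_mult_coset[OF f(1)]] by metis
  have "f \<otimes>\<^bsub>E\<^esub> e \<otimes>\<^bsub>E\<^esub> g = \<zero>\<^bsub>E\<^esub>" if "e \<in> carrier E" for e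
    using that by (intro g(3)) (auto simp: l_coset_def)
  then show False
    using E.prime_ringD[OF _ f(1) g(1)] assms(2) f(2) g(2) unfolding E_prime_def by blast
qed

lemma completely_E_primeD:
  assumes "coretractable A C M" "completely_E_prime A C M" and f: "f \<in> carrier E" "f \<noteq> \<zero>\<^bsub>E\<^esub>"
  shows "carrier M = f ` carrier M"
proof (rule ccontr)
  assume "carrier M \<noteq> f ` carrier M"
  then have "image_sum M {f} \<noteq> carrier M" using image_sum_singleton[OF f(1)] by simp
  then obtain g where "g \<in> carrier E" "g \<noteq> \<zero>\<^bsub>E\<^esub>" "f \<otimes>\<^bsub>E\<^esub> g = \<zero>\<^bsub>E\<^esub>"
    using coretractable_annihilator[OF assms(1), of "{f}"] f(1) by blast
  then show False using assms(2) f unfolding completely_E_prime_def noncomm_domain_def by blast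
qed

text \<open>For f in an ideal I of square zero, each f e f is a product of two elements of I and so
  vanishes. Hence M f E f = 0, which is M f if f is nonzero; the identity plays the role of g in
  \<open>End_zero_on_image_sum\<close>.\<close>

lemma E_semiprimeI:
  assumes H: "\<And>f. \<lbrakk>f \<in> carrier E; f \<noteq> \<zero>\<^bsub>E\<^esub>\<rbrakk> \<Longrightarrow>
    f ` carrier M = image_sum M ((f <#\<^bsub>E\<^esub> carrier E) #>\<^bsub>E\<^esub> f)"
  shows "E_semiprime A C M"
  unfolding E_semiprime_def semiprime_ring_def
proof (intro conjI allI impI End_ring)
  fix I assume IJ: "ideal I E \<and> (\<forall>a\<in>I. \<forall>b\<in>I. a \<otimes>\<^bsub>E\<^esub> b = \<zero>\<^bsub>E\<^esub>)"
  interpret I: ideal I E using IJ by blast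
  have "f = \<zero>\<^bsub>E\<^esub>" if f: "f \<in> I" for f
  proof (rule ccontr)
    assume nz: "f \<noteq> \<zero>\<^bsub>E\<^esub>"
    have fE: "f \<in> carrier E" using f I.a_Hcarr by blast
    have "f x = \<zero>\<^bsub>M\<^esub>" if x: "x \<in> carrier M" for x
    proof -
      have "\<one>\<^bsub>E\<^esub> (f x) = \<zero>\<^bsub>M\<^esub>"
      proof (rule End_zero_on_image_sum[OF left_right_mult_coset[OF fE] End_one_closed])
        show "f x \<in> image_sum M ((f <#\<^bsub>E\<^esub> carrier E) #>\<^bsub>E\<^esub> f)" using H[OF fE nz] x by blast
        fix k assume "k \<in> (f <#\<^bsub>E\<^esub> carrier E) #>\<^bsub>E\<^esub> f"
        then obtain e where e: "e \<in> carrier E" "k = f \<otimes>\<^bsub>E\<^esub> e \<otimes>\<^bsub>E\<^esub> f"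
          by (auto simp: l_coset_def r_coset_def)
        have "k = \<zero>\<^bsub>E\<^esub>" unfolding e(2) using IJ f I.I_r_closed[OF f e(1)] by blast
        then show "k \<otimes>\<^bsub>E\<^esub> \<one>\<^bsub>E\<^esub> = \<zero>\<^bsub>E\<^esub>" by simp
      qed
      then show ?thesis using End_in[OF fE x] by (simp add: End_one)
    qed
    then show False using nz End_eq_zero_iff[OF fE] by blast
  qed
  then show "I = {\<zero>\<^bsub>E\<^esub>}" using I.zero_closed by blast
qed

text \<open>Applying f repeatedly to f(M) = f(f(M)) keeps the image of every positive power equal to
  f(M), so a vanishing power makes f vanish.\<close>

lemma completely_E_semiprimeI:
  assumes H: "\<And>f. \<lbrakk>f \<in> carrier E; f \<noteq> \<zero>\<^bsub>E\<^esub>\<rbrakk> \<Longrightarrow> f ` carrier M = (f \<otimes>\<^bsub>E\<^esub> f) ` carrier M"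
  shows "completely_E_semiprime A C M"
  unfolding completely_E_semiprime_def reduced_ring_def
proof (intro conjI ballI allI impI End_ring)
  fix f and n :: nat assume f: "f \<in> carrier E" and fn: "f [^]\<^bsub>E\<^esub> n = \<zero>\<^bsub>E\<^esub>"
  show "f = \<zero>\<^bsub>E\<^esub>"
  proof (rule ccontr)
    assume nz: "f \<noteq> \<zero>\<^bsub>E\<^esub>"
    have im: "(a \<otimes>\<^bsub>E\<^esub> b) ` carrier M = b ` a ` carrier M" for a b
      by (auto simp: End_mult image_image)
    \<comment> \<open>The exponent starts at one: the zeroth power is the identity, whose image is
      M.\<close>
    have "(f [^]\<^bsub>E\<^esub> Suc k) ` carrier M = f ` carrier M" for k
    proof (induction k)
      case (Suc k)
      have "(f [^]\<^bsub>E\<^esub> Suc (Suc k)) ` carrier M = f ` (f [^]\<^bsub>E\<^esub> Suc k) ` carrier M"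
        using im[of "f [^]\<^bsub>E\<^esub> Suc k" f] by simp
      also have "\<dots> = (f \<otimes>\<^bsub>E\<^esub> f) ` carrier M" unfolding Suc im ..
      finally show ?case using H[OF f nz] by simp
    qed (use f in simp)
    \<comment> \<open>Raising the exponent by one covers the case n = 0 and fits the form of the
      induction.\<close>
    moreover have "f [^]\<^bsub>E\<^esub> Suc n = \<zero>\<^bsub>E\<^esub>" using fn f by simp
    ultimately have "f ` carrier M = \<zero>\<^bsub>E\<^esub> ` carrier M" by metis
    then have "\<forall>x\<in>carrier M. f x = \<zero>\<^bsub>M\<^esub>" by (auto simp: End_zero)
    then show False using nz End_eq_zero_iff[OF f] by blast
  qed
qed

text \<open>A point f(m) outside M f E f yields g with f E f g = 0 and g(f(m)) nonzero. Then (f g) E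
  (f g) = 0, so semiprimeness forces f g = 0, contrary to the choice of g. The other inclusion holds
  because every element of f E f ends with f.\<close>

lemma E_semiprimeD:
  assumes "self_cogenerator A C M" "E_semiprime A C M" and f: "f \<in> carrier E"
  shows "f ` carrier M = image_sum M ((f <#\<^bsub>E\<^esub> carrier E) #>\<^bsub>E\<^esub> f)" (is "_ = image_sum M ?F")
proof
  have "k ` carrier M \<subseteq> f ` carrier M" if "k \<in> ?F" for k
  proof -
    obtain e where "e \<in> carrier E" "k = f \<otimes>\<^bsub>E\<^esub> e \<otimes>\<^bsub>E\<^esub> f"
      using \<open>k \<in> ?F\<close> by (auto simp: l_coset_def r_coset_def)
    then show ?thesis using End_in f by (auto simp: End_mult)
  qed
  then show "image_sum M ?F \<subseteq> f ` carrier M"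
    unfolding image_sum_def
    by (intro RM.M.add.generate_subgroup_incl[OF _ image_subgroup[OF f]]) blast
  show "f ` carrier M \<subseteq> image_sum M ?F"
  proof (rule image_subsetI, rule ccontr)
    fix m assume m: "m \<in> carrier M" and "f m \<notin> image_sum M ?F"
    then obtain g where g: "g \<in> carrier E" "g (f m) \<noteq> \<zero>\<^bsub>M\<^esub>"
        "\<And>k. k \<in> ?F \<Longrightarrow> k \<otimes>\<^bsub>E\<^esub> g = \<zero>\<^bsub>E\<^esub>"
      using self_cogenerator_annihilator[OF assms(1) left_right_mult_coset[OF f] End_in[OF f m]] by metis
    have fg: "f \<otimes>\<^bsub>E\<^esub> g \<in> carrier E" using f g(1) by simp
    have "f \<otimes>\<^bsub>E\<^esub> g \<otimes>\<^bsub>E\<^esub> e \<otimes>\<^bsub>E\<^esub> (f \<otimes>\<^bsub>E\<^esub> g) = \<zero>\<^bsub>E\<^esub>" if e: "e \<in> carrier E" for e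
    proof -
      \<comment> \<open>Regrouping puts g e in the middle of f E f and leaves the final g to
        annihilate it.\<close>
      have "f \<otimes>\<^bsub>E\<^esub> (g \<otimes>\<^bsub>E\<^esub> e) \<otimes>\<^bsub>E\<^esub> f \<in> ?F"
        using g(1) e by (auto simp: l_coset_def r_coset_def)
      then have "f \<otimes>\<^bsub>E\<^esub> (g \<otimes>\<^bsub>E\<^esub> e) \<otimes>\<^bsub>E\<^esub> f \<otimes>\<^bsub>E\<^esub> g = \<zero>\<^bsub>E\<^esub>" by (rule g(3))
      then show ?thesis using f g(1) e by (simp add: E.m_assoc)
    qed
    then have "f \<otimes>\<^bsub>E\<^esub> g = \<zero>\<^bsub>E\<^esub>"
      using E.semiprime_ringD[OF _ fg] assms(2) unfolding E_semiprime_def by blast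
    then show False using End_mult_eq_zero_iff[OF f g(1)] g(2) m by blast
  qed
qed

text \<open>The annihilator argument gives only f f g = 0. Since (f g f)(f g f) = f g (f f g) f = 0,
  reducedness gives f g f = 0; then (f g)(f g) = (f g f) g = 0 gives f g = 0, which contradicts that
  g(f(m)) is nonzero.\<close>

lemma completely_E_semiprimeD:
  assumes "self_cogenerator A C M" "completely_E_semiprime A C M" and f: "f \<in> carrier E"
  shows "f ` carrier M = (f \<otimes>\<^bsub>E\<^esub> f) ` carrier M"
proof
  have ff: "f \<otimes>\<^bsub>E\<^esub> f \<in> carrier E" using f by simp
  have red: "reduced_ring E" using assms(2) unfolding completely_E_semiprime_def .
  show "(f \<otimes>\<^bsub>E\<^esub> f) ` carrier M \<subseteq> f ` carrier M"
    using End_in[OF f] by (auto simp: End_mult)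
  show "f ` carrier M \<subseteq> (f \<otimes>\<^bsub>E\<^esub> f) ` carrier M"
  proof (rule image_subsetI, rule ccontr)
    fix m assume m: "m \<in> carrier M" and "f m \<notin> (f \<otimes>\<^bsub>E\<^esub> f) ` carrier M"
    then obtain g where g: "g \<in> carrier E" "g (f m) \<noteq> \<zero>\<^bsub>M\<^esub>" "f \<otimes>\<^bsub>E\<^esub> f \<otimes>\<^bsub>E\<^esub> g = \<zero>\<^bsub>E\<^esub>"
      using self_cogenerator_annihilator[OF assms(1), of "{f \<otimes>\<^bsub>E\<^esub> f}" "f m"] ff End_in[OF f m]
        image_sum_singleton[OF ff] by auto
    have fgf: "f \<otimes>\<^bsub>E\<^esub> g \<otimes>\<^bsub>E\<^esub> f \<in> carrier E" using f g(1) by simp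
    have "f \<otimes>\<^bsub>E\<^esub> g \<otimes>\<^bsub>E\<^esub> f \<otimes>\<^bsub>E\<^esub> (f \<otimes>\<^bsub>E\<^esub> g \<otimes>\<^bsub>E\<^esub> f) = f \<otimes>\<^bsub>E\<^esub> g \<otimes>\<^bsub>E\<^esub> (f \<otimes>\<^bsub>E\<^esub> f \<otimes>\<^bsub>E\<^esub> g) \<otimes>\<^bsub>E\<^esub> f"
      using f g(1) by (simp add: E.m_assoc)
    also have "\<dots> = \<zero>\<^bsub>E\<^esub>" using f g(1) by (simp add: g(3))
    finally have "f \<otimes>\<^bsub>E\<^esub> g \<otimes>\<^bsub>E\<^esub> f = \<zero>\<^bsub>E\<^esub>" by (rule E.reduced_ringD[OF red fgf])
    moreover have "f \<otimes>\<^bsub>E\<^esub> g \<otimes>\<^bsub>E\<^esub> (f \<otimes>\<^bsub>E\<^esub> g) = f \<otimes>\<^bsub>E\<^esub> g \<otimes>\<^bsub>E\<^esub> f \<otimes>\<^bsub>E\<^esub> g"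
      using f g(1) by (simp add: E.m_assoc)
    ultimately have "f \<otimes>\<^bsub>E\<^esub> g \<otimes>\<^bsub>E\<^esub> (f \<otimes>\<^bsub>E\<^esub> g) = \<zero>\<^bsub>E\<^esub>"
      using E.l_null[OF g(1)] by simp
    then have "f \<otimes>\<^bsub>E\<^esub> g = \<zero>\<^bsub>E\<^esub>"
      by (rule E.reduced_ringD[OF red E.m_closed[OF f g(1)]])
    then show False using End_mult_eq_zero_iff[OF f g(1)] g(2) m by blast
  qed
qed

end

theorem theorem3p17:
  fixes R :: "('r, 's) ring_scheme" and A :: "('r, 'a) module"
    and C :: "('a, 'c) coring" and M :: "('a, 'm, 'c) comodule"
    and E :: "('m \<Rightarrow> 'm) ring"
  assumes R: "cring R" "\<one>\<^bsub>R\<^esub> \<noteq> \<zero>\<^bsub>R\<^esub>"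
    and A: "unital_algebra R A"
    and C: "coring A C" "carrier C \<noteq> {\<zero>\<^bsub>C\<^esub>}"
    and flat: "left_flat TYPE('a) A C" "left_flat TYPE('m) A C" "left_flat TYPE(('m, 'c) tensor) A C"
    and M: "right_comodule A C M" "carrier M \<noteq> {\<zero>\<^bsub>M\<^esub>}"
    and E: "E = End_op A C M"
  shows
    "((\<forall>f\<in>carrier E. f \<noteq> \<zero>\<^bsub>E\<^esub> \<longrightarrow> carrier M = image_sum M (f <#\<^bsub>E\<^esub> carrier E))
        \<longrightarrow> E_prime A C M) \<and>
     ((\<forall>f\<in>carrier E. f \<noteq> \<zero>\<^bsub>E\<^esub> \<longrightarrow> carrier M = f ` carrier M)
        \<longrightarrow> completely_E_prime A C M) \<and>
     (coretractable A C M \<longrightarrow>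
        (E_prime A C M \<longleftrightarrow>
          (\<forall>f\<in>carrier E. f \<noteq> \<zero>\<^bsub>E\<^esub> \<longrightarrow> carrier M = image_sum M (f <#\<^bsub>E\<^esub> carrier E))) \<and>
        (completely_E_prime A C M \<longleftrightarrow>
          (\<forall>f\<in>carrier E. f \<noteq> \<zero>\<^bsub>E\<^esub> \<longrightarrow> carrier M = f ` carrier M))) \<and>
     ((\<forall>f\<in>carrier E. f \<noteq> \<zero>\<^bsub>E\<^esub> \<longrightarrow>
          f ` carrier M = image_sum M ((f <#\<^bsub>E\<^esub> carrier E) #>\<^bsub>E\<^esub> f))
        \<longrightarrow> E_semiprime A C M) \<and>
     ((\<forall>f\<in>carrier E. f \<noteq> \<zero>\<^bsub>E\<^esub> \<longrightarrow> f ` carrier M = (f \<otimes>\<^bsub>E\<^esub> f) ` carrier M)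
        \<longrightarrow> completely_E_semiprime A C M) \<and>
     (self_cogenerator A C M \<longrightarrow>
        (E_semiprime A C M \<longleftrightarrow>
          (\<forall>f\<in>carrier E. f \<noteq> \<zero>\<^bsub>E\<^esub> \<longrightarrow>
            f ` carrier M = image_sum M ((f <#\<^bsub>E\<^esub> carrier E) #>\<^bsub>E\<^esub> f))) \<and>
        (completely_E_semiprime A C M \<longleftrightarrow>
          (\<forall>f\<in>carrier E. f \<noteq> \<zero>\<^bsub>E\<^esub> \<longrightarrow> f ` carrier M = (f \<otimes>\<^bsub>E\<^esub> f) ` carrier M)))"
proof -
  interpret F: flat_comodule A C M
    by (intro flat_comodule.intro flat_comodule_axioms.intro right_comodule.axioms(1)[OF M(1)] C(1) M(1) flat)
  have 1: "E_prime A C M"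
    if "\<forall>f\<in>carrier E. f \<noteq> \<zero>\<^bsub>E\<^esub> \<longrightarrow> carrier M = image_sum M (f <#\<^bsub>E\<^esub> carrier E)"
    using F.E_primeI[OF M(2)] that unfolding E by blast
  have 2: "completely_E_prime A C M"
    if "\<forall>f\<in>carrier E. f \<noteq> \<zero>\<^bsub>E\<^esub> \<longrightarrow> carrier M = f ` carrier M"
    using F.completely_E_primeI[OF M(2)] that unfolding E by blast
  have 3: "E_semiprime A C M"
    if "\<forall>f\<in>carrier E. f \<noteq> \<zero>\<^bsub>E\<^esub> \<longrightarrow>
      f ` carrier M = image_sum M ((f <#\<^bsub>E\<^esub> carrier E) #>\<^bsub>E\<^esub> f)"
    using F.E_semiprimeI that unfolding E by blast
  have 4: "completely_E_semiprime A C M"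
    if "\<forall>f\<in>carrier E. f \<noteq> \<zero>\<^bsub>E\<^esub> \<longrightarrow> f ` carrier M = (f \<otimes>\<^bsub>E\<^esub> f) ` carrier M"
    using F.completely_E_semiprimeI that unfolding E by blast
  \<comment> \<open>Facts \<open>1\<close> to \<open>4\<close> serve twice, as the unconditional
    implications and as one half of each equivalence; \<open>D\<close> supplies the other
    halves.\<close>
  note D = F.E_primeD[folded E] F.completely_E_primeD[folded E]
    F.E_semiprimeD[folded E] F.completely_E_semiprimeD[folded E]
  show ?thesis
    by (intro conjI impI iffI ballI; (rule 1 2 3 4 D; assumption))
qed

end
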